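(* Let $n\geq1$ and let $f:[0,1]^n\to X$ be a Lipschitz map into a metric space $X$. Then $f$ factors through a metric tree if and only if $\operatorname{rank}\operatorname{md}(f,x)\leq 1$ almost everywhere.
   Context: Factorization: a Lipschitz map $f:X\to Y$ between metric spaces factors through a metric space $Z$ if there are Lipschitz maps $\psi:X\to Z$ and $\phi:Z\to Y$ with $f=\phi\circ\psi$. A metric space is geodesic if any two points can be connected by a curve whose length equals the distance between the points. A metric tree ($\mathbb{R}$-tree) is a geodesic space that contains no subset homeomorphic to $\mathbb{S}^1$. Metric derivative: a map $f$ from an open set $\Omega\subset\mathbb{R}^n$ to a metric space $(X,d)$ is metrically differentiable at $x\in\Omega$ if there is a seminorm $\operatorname{md}(f,x)(\cdot)$ on $\mathbb{R}^n$ with $$\lim_{y\to x}\frac{d(f(y),f(x))-\operatorname{md}(f,x)(y-x)}{|y-x|}=0 .$$ The seminorm is then unique; Lipschitz maps are metrically differentiable a.e. (Kirchheim). For a map on the closed cube this is applied in the interior. The rank of a seminorm $\sigma$ on $\mathbb{R}^n$ is $n-\dim\{v:\sigma(v)=0\}$. *)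

theory Defs
  imports "HOL-Analysis.Analysis"
begin

definition curve_length :: "'a metric \<Rightarrow> (real \<Rightarrow> 'a) \<Rightarrow> ennreal" where
  "curve_length X \<gamma> =
     (SUP (N, t) \<in> {(N :: nat, t :: nat \<Rightarrow> real). mono_on {..N} t \<and> t ` {..N} \<subseteq> {0..1}}.
        \<Sum>i<N. ennreal (mdist X (\<gamma> (t i)) (\<gamma> (t (Suc i)))))"

definition geodesic_metric :: "'a metric \<Rightarrow> bool" where
  "geodesic_metric X \<longleftrightarrow>
     (\<forall>x\<in>mspace X. \<forall>y\<in>mspace X. \<exists>\<gamma>. pathin (mtopology_of X) \<gamma> \<and> \<gamma> 0 = x \<and> \<gamma> 1 = y \<and>
        curve_length X \<gamma> = ennreal (mdist X x y))"

definition metric_tree :: "'a metric \<Rightarrow> bool" where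
  "metric_tree X \<longleftrightarrow> geodesic_metric X \<and>
     \<not> (\<exists>S \<subseteq> mspace X. subtopology (mtopology_of X) S homeomorphic_space
                        top_of_set (sphere (0 :: complex) 1))"

text \<open>HOL cannot quantify over the type of the points of the intermediate space \<open>Z\<close> inside a
  formula, so factoring through some tree is stated for trees whose points lie in a fixed type.
  For maps defined on a cube in \<open>real ^ 'n\<close> the type \<open>real ^ 'n\<close> itself, under arbitrary metrics on
  its subsets, is large enough: the image of the cube in a tree is again a tree and has at most
  as many points as the cube.\<close>

definition factors_through :: "'a metric \<Rightarrow> 'b metric \<Rightarrow> 'c metric \<Rightarrow> ('a \<Rightarrow> 'b) \<Rightarrow> bool" where
  "factors_through X Y Z f \<longleftrightarrow>
     (\<exists>\<psi> \<phi>. Lipschitz_continuous_map X Z \<psi> \<and> Lipschitz_continuous_map Z Y \<phi> \<and>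
        (\<forall>x\<in>mspace X. f x = (\<phi> \<circ> \<psi>) x))"

text \<open>Nonnegativity and vanishing at the origin follow from the two conditions.\<close>

definition is_seminorm :: "('a :: real_vector \<Rightarrow> real) \<Rightarrow> bool" where
  "is_seminorm \<sigma> \<longleftrightarrow>
     (\<forall>u v. \<sigma> (u + v) \<le> \<sigma> u + \<sigma> v) \<and> (\<forall>c v. \<sigma> (c *\<^sub>R v) = \<bar>c\<bar> * \<sigma> v)"

definition seminorm_rank :: "('a :: euclidean_space \<Rightarrow> real) \<Rightarrow> nat" where
  "seminorm_rank \<sigma> = DIM('a) - dim {v. \<sigma> v = 0}"

definition has_metric_derivative ::
    "'b metric \<Rightarrow> 'a :: euclidean_space set \<Rightarrow> ('a \<Rightarrow> 'b) \<Rightarrow> 'a \<Rightarrow> ('a \<Rightarrow> real) \<Rightarrow> bool" where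
  "has_metric_derivative X \<Omega> f x \<sigma> \<longleftrightarrow> is_seminorm \<sigma> \<and>
     ((\<lambda>y. (mdist X (f y) (f x) - \<sigma> (y - x)) / norm (y - x)) \<longlongrightarrow> 0) (at x within \<Omega>)"

definition metrically_differentiable ::
    "'b metric \<Rightarrow> 'a :: euclidean_space set \<Rightarrow> ('a \<Rightarrow> 'b) \<Rightarrow> 'a \<Rightarrow> bool" where
  "metrically_differentiable X \<Omega> f x \<longleftrightarrow> (\<exists>\<sigma>. has_metric_derivative X \<Omega> f x \<sigma>)"

text \<open>Only meaningful where \<open>f\<close> is metrically differentiable; for open \<open>\<Omega>\<close> and \<open>x \<in> \<Omega>\<close>
  the seminorm is then unique.\<close>

definition md ::
    "'b metric \<Rightarrow> 'a :: euclidean_space set \<Rightarrow> ('a \<Rightarrow> 'b) \<Rightarrow> 'a \<Rightarrow> ('a \<Rightarrow> real)" where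
  "md X \<Omega> f x = (THE \<sigma>. has_metric_derivative X \<Omega> f x \<sigma>)"

definition unit_cube :: "(real ^ 'n) metric" where
  "unit_cube = submetric euclidean_metric (cbox 0 1)"

text \<open>The open cube differs from the closed one by a null set, so ``almost everywhere'' is
  expressed on the open cube.  The condition includes that the metric derivative exists.\<close>

definition md_rank_le_one_ae :: "'b metric \<Rightarrow> (real ^ 'n \<Rightarrow> 'b) \<Rightarrow> bool" where
  "md_rank_le_one_ae X f \<longleftrightarrow>
     (AE x in lebesgue_on (box 0 1). metrically_differentiable X (box 0 1) f x \<and>
        seminorm_rank (md X (box 0 1) f x) \<le> 1)"

end

theory Submission
  imports Defs
begin

text \<open>
Throughout, \<open>f\<close> is composed with the nearest-point projection onto the cube, which
gives a Lipschitz map \<open>F\<close> on all of \<open>\<real>\<^sup>n\<close>; translates of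
\<open>F\<close> then make sense everywhere. The bridge between trees and analysis is the
four-point condition: a metric tree satisfies it (\<open>metric_tree_imp_four_point\<close>), and
a connected space that satisfies it is a metric tree
(\<open>four_point_connected_imp_metric_tree\<close>).

Existence of the metric derivative. The metric speed of a Lipschitz curve \<open>c\<close> is the
supremum of the absolute derivatives of the functions \<open>t \<mapsto> d(c t,
w\<^sub>i)\<close>, where the points \<open>w\<^sub>i\<close> are dense on the curve, and Fubini's
theorem turns this into existence of directional speeds almost everywhere in
\<open>\<real>\<^sup>n\<close>. An inequality between distances of points \<open>x + t u\<close>,
such as the triangle inequality, becomes, after division by \<open>t\<close>, an inequality
between directional speeds, because difference quotients with a base point moved by
\<open>O(t)\<close> still converge in \<open>L\<^sup>1\<close> to the same limit
(\<open>L1_conv_shift\<close>). This gives a seminorm almost everywhere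
(\<open>metric_derivative_exists_AE\<close>).

From a tree to rank one. Let \<open>f = \<phi> \<circ> \<psi>\<close> with \<open>\<psi>\<close>
mapping into a tree. The four-point condition on the corners of small parallelograms passes to the
limit and says \<open>\<sigma> (u + v) + \<sigma> (u - v) \<le> 2 max (\<sigma> u) (\<sigma>
v)\<close> for the metric derivative \<open>\<sigma>\<close> of \<open>\<psi>\<close>. No norm on
a plane satisfies this, so \<open>\<sigma>\<close> has rank at most one, and the metric derivative
of \<open>f\<close> is at most a multiple of \<open>\<sigma>\<close>.

From rank one to a tree. Let \<open>h(x)\<close> be the infimum of the \<open>f\<close>-lengths of
polygons from a fixed root to \<open>x\<close>, let \<open>m(x,y)\<close> be the supremum of the
levels \<open>s\<close> for which \<open>x\<close> and \<open>y\<close> can be joined by a polygon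
inside \<open>{h \<ge> s}\<close>, and put \<open>p(x,y) = h(x) + h(y) - 2 m(x,y)\<close>, the
distance in the tree of superlevel components of \<open>h\<close>. For every function
\<open>h\<close> the quantity \<open>m\<close> satisfies \<open>m(x,z) \<ge> min (m(x,y))
(m(y,z))\<close>, which gives the four-point condition for \<open>p\<close>. What remains is
\<open>d(f x, f y) \<le> p(x,y)\<close> (\<open>mdist_joined\<close>), and this is where the rank
enters. If \<open>a\<close> and \<open>b\<close> are Lipschitz with respect to
\<open>f\<close>-length, their derivatives vanish on the kernel of the metric derivative, so the
Jacobian of \<open>(a,b)\<close> on every plane is zero almost everywhere, and Stokes' theorem
gives \<open>\<integral> a db = 0\<close> around every closed polygon
(\<open>line_int_triangle\<close>). Apply this to a nearly shortest polygon from the root to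
\<open>x\<close>, a polygon from \<open>x\<close> to \<open>y\<close> inside \<open>{h \<ge>
s}\<close>, and a nearly shortest polygon back, with \<open>b = d(f \<cdot>, f x)\<close> and
\<open>a\<close> a cut-off that is one below level \<open>s\<close> and zero above. Only the parts
below level \<open>s\<close> contribute, so \<open>b\<close> takes nearly the same value at the
two points where the shortest polygons cross level \<open>s\<close>; the triangle inequality
through the second crossing point gives \<open>d(f x, f y) \<le> (h(x) - s) + (h(y) - s)\<close>.
The tree is the quotient of the cube by \<open>p\<close>.
\<close>

section \<open>Metric speed of Lipschitz curves\<close>

text \<open>The averages over intervals to the left of \<open>t\<close> are averages to the right
for the reflected function.\<close>

lemma lebesgue_differentiation_real:
  fixes f :: "real \<Rightarrow> real"
  assumes f: "\<And>a b. f integrable_on {a..b}"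
  obtains N where "negligible N"
    "\<And>t e. \<lbrakk>t \<notin> N; 0 < e\<rbrakk> \<Longrightarrow> \<exists>d>0. \<forall>h. 0 < h \<and> h < d \<longrightarrow>
        \<bar>integral {t..t+h} f / h - f t\<bar> < e \<and> \<bar>integral {t-h..t} f / h - f t\<bar> < e"
proof -
  have f': "f integrable_on cbox a b" for a b :: real
    using f by simp
  have g': "(\<lambda>x. f (- x)) integrable_on cbox a b" for a b :: real
    using f[of "-b" "-a"] Henstock_Kurzweil_Integration.integrable_reflect_real[where f=f and a="-b" and b="-a"] by simp
  obtain N1 where N1: "negligible N1" "\<And>x e. \<lbrakk>x \<notin> N1; 0 < e\<rbrakk> \<Longrightarrow> \<exists>d>0. \<forall>h. 0 < h \<and> h < d \<longrightarrow>
                         norm(integral (cbox x (x + h *\<^sub>R One)) f /\<^sub>R h ^ DIM(real) - f x) < e"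
    using integrable_ccontinuous_explicit[OF f'] by blast
  obtain N2 where N2: "negligible N2" "\<And>x e. \<lbrakk>x \<notin> N2; 0 < e\<rbrakk> \<Longrightarrow> \<exists>d>0. \<forall>h. 0 < h \<and> h < d \<longrightarrow>
         norm(integral (cbox x (x + h *\<^sub>R One)) (\<lambda>x. f (- x)) /\<^sub>R h ^ DIM(real) - f (- x)) < e"
    using integrable_ccontinuous_explicit[OF g'] by blast
  have "negligible (uminus ` N2)"
    using N2(1) by (rule negligible_locally_Lipschitz_image[rotated])
      (use open_UNIV in \<open>force intro!: exI[of _ "1::real"] simp: abs_minus_commute\<close>)+
  then have "negligible (N1 \<union> uminus ` N2)"
    using N1(1) by simp
  moreover have "\<exists>d>0. \<forall>h. 0 < h \<and> h < d \<longrightarrow>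
        \<bar>integral {t..t+h} f / h - f t\<bar> < e \<and> \<bar>integral {t-h..t} f / h - f t\<bar> < e"
    if t: "t \<notin> N1 \<union> uminus ` N2" and e: "0 < e" for t e
  proof -
    have "t \<notin> N1" "- t \<notin> N2"
      using t by (auto simp: image_iff)
    obtain d1 where d1: "d1 > 0" "\<forall>h. 0 < h \<and> h < d1 \<longrightarrow> \<bar>integral {t..t+h} f / h - f t\<bar> < e"
      using N1(2)[OF \<open>t \<notin> N1\<close> e] by (auto simp: divide_inverse_commute)
    obtain d2 where d2: "d2 > 0"
       "\<forall>h. 0 < h \<and> h < d2 \<longrightarrow> \<bar>integral {-t..-t+h} (\<lambda>x. f (- x)) / h - f t\<bar> < e"
      using N2(2)[OF \<open>- t \<notin> N2\<close> e] by (auto simp: divide_inverse_commute)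
    have "integral {-t..-t+h} (\<lambda>x. f (- x)) = integral {t-h..t} f" for h
    proof -
      have "{- t..- t + h} = {- t..- (t - h)}" by simp
      then show ?thesis using Henstock_Kurzweil_Integration.integral_reflect_real[of t "t-h" f] by metis
    qed
    with d1 d2 show ?thesis
      by (intro exI[of _ "min d1 d2"]) auto
  qed
  ultimately show thesis
    by (rule that)
qed

text \<open>A Lipschitz function is absolutely continuous. Adding a large linear term makes it a
bi-Lipschitz bijection \<open>F\<close>; the measure \<open>A \<mapsto> \<lambda>(F(A))\<close>
vanishes on null sets because Lipschitz images of null sets are null, and its Radon-Nikodym
density is the derivative of \<open>F\<close>.\<close>

lemma lipschitz_density:
  fixes a :: "real \<Rightarrow> real"
  assumes L: "\<And>x y. \<bar>a x - a y\<bar> \<le> L * \<bar>x - y\<bar>"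
  obtains f where "f \<in> borel_measurable borel"
    "\<And>x y. x \<le> y \<Longrightarrow> (f has_integral (a y - a x)) {x..y}"
proof -
  define K where "K = \<bar>L\<bar> + 1"
  have K0: "K > 0" by (simp add: K_def)
  have K: "\<bar>a x - a y\<bar> \<le> K * \<bar>x - y\<bar>" for x y
    by (rule order_trans[OF L]) (auto simp: K_def intro!: mult_right_mono)
  define F where "F = (\<lambda>x. a x + 2 * K * x)"
  have Fge: "F y - F x \<ge> K * (y - x)" if "x \<le> y" for x y
    using K[of x y] that by (auto simp: F_def algebra_simps)
  have Fle: "F y - F x \<le> 3 * K * (y - x)" if "x \<le> y" for x y
    using K[of x y] that by (auto simp: F_def algebra_simps)
  have Fsm: "F x < F y" if "x < y" for x y
    using Fge[of x y] that K0 mult_pos_pos[of K "y - x"] by linarith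
  have Fle': "F x \<le> F y" if "x \<le> y" for x y
    using Fsm[of x y] that by (cases "x = y") auto
  have injF: "inj F"
    by (metis Fsm injI linorder_neq_iff)
  have FLip: "\<bar>F x - F y\<bar> \<le> 3 * K * \<bar>x - y\<bar>" for x y
    using Fle[of x y] Fle[of y x] Fge[of x y] Fge[of y x] K0
    by (cases "x \<le> y") (auto simp: abs_if intro: mult_nonneg_nonneg)
  have contF: "continuous_on UNIV F"
    by (rule lipschitz_on_continuous_on[of "3 * K"], rule lipschitz_onI)
       (use FLip K0 in \<open>auto simp: dist_real_def\<close>)
  have surjF: "\<exists>x. F x = y" for y
  proof -
    define r where "r = \<bar>y - F 0\<bar> / K"
    have "r \<ge> 0" "K * r = \<bar>y - F 0\<bar>" using K0 by (auto simp: r_def)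
    then have "F (-r) \<le> y" "y \<le> F r"
      using Fge[of "-r" 0] Fge[of 0 r] by (auto simp: algebra_simps)
    then show ?thesis
      using IVT'[of F "-r" y r] \<open>r \<ge> 0\<close> continuous_on_subset[OF contF] by auto
  qed
  define G where "G = inv F"
  have FG: "F (G y) = y" for y
    unfolding G_def by (rule f_inv_into_f) (metis surjF rangeI)
  have GF: "G (F x) = x" for x
    unfolding G_def using injF by simp
  have Gmono: "mono G"
    by (rule monoI) (metis FG Fsm leD leI)
  have Gm[measurable]: "G \<in> borel_measurable borel"
    by (rule borel_measurable_mono[OF Gmono])
  have preim: "G -` A = F ` A" for A
    by (auto simp: image_iff GF) (metis FG)
  define N where "N = distr lborel borel G"
  have setsN: "sets N = sets lborel" by (simp add: N_def)
  have Nbox: "emeasure N {x..y} = ennreal (F y - F x)" if "x \<le> y" for x y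
  proof -
    have "F ` {x..y} = {F x..F y}"
    proof (rule antisym)
      show "F ` {x..y} \<subseteq> {F x..F y}"
        using Fle' by auto
      show "{F x..F y} \<subseteq> F ` {x..y}"
      proof
        fix z assume z: "z \<in> {F x..F y}"
        have "x \<le> G z" "G z \<le> y"
          using z monoD[OF Gmono, of "F x" z] monoD[OF Gmono, of z "F y"] by (auto simp: GF)
        then show "z \<in> F ` {x..y}" by (metis FG atLeastAtMost_iff image_eqI)
      qed
    qed
    moreover have "F x \<le> F y"
      using that by (rule Fle')
    ultimately show ?thesis
      by (simp add: N_def emeasure_distr preim)
  qed
  have ac: "absolutely_continuous lborel N"
    unfolding absolutely_continuous_def
  proof
    fix A :: "real set" assume A: "A \<in> null_sets lborel"
    then have Ab: "A \<in> sets borel" by auto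
    have "negligible A"
      using A by (simp add: negligible_iff_null_sets null_sets_completionI)
    then have "negligible (F ` A)"
      by (rule negligible_locally_Lipschitz_image[rotated])
         (use FLip in \<open>auto intro!: exI[of _ UNIV] exI[of _ "3 * K"]\<close>)
    moreover have "F ` A \<in> sets borel"
      using measurable_sets[OF Gm Ab] by (simp add: preim)
    ultimately have "emeasure lborel (F ` A) = 0"
      by (auto simp: negligible_iff_null_sets null_sets_def)
    then show "A \<in> null_sets N"
      using Ab by (auto simp: null_sets_def N_def emeasure_distr preim)
  qed
  obtain g where g[measurable]: "g \<in> borel_measurable borel" and gN: "density lborel g = N"
    using sigma_finite_measure.Radon_Nikodym[OF sigma_finite_lborel ac setsN] by auto
  have gint: "(\<integral>\<^sup>+z. g z * indicator {x..y} z \<partial>lborel) = ennreal (F y - F x)" if "x \<le> y" for x y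
    using Nbox[OF that] by (simp add: emeasure_density flip: gN)
  have gfin: "AE z in lborel. g z \<noteq> \<infinity>"
  proof -
    have "AE z in lborel. g z * indicator {- real n..real n} z \<noteq> \<infinity>" for n
      by (rule nn_integral_noteq_infinite) (auto simp: gint)
    then have "AE z in lborel. \<forall>n. g z * indicator {- real n..real n} z \<noteq> \<infinity>"
      by (simp add: AE_all_countable)
    then show ?thesis
    proof eventually_elim
      case (elim z)
      obtain n where "\<bar>z\<bar> \<le> real n" using real_arch_simple by blast
      with elim[rule_format, of n] show ?case by (auto simp: indicator_def abs_le_iff split: if_splits)
    qed
  qed
  define f where "f = (\<lambda>z. enn2real (g z) - 2 * K)"
  have "f \<in> borel_measurable borel" by (simp add: f_def)
  moreover have "(f has_integral (a y - a x)) {x..y}" if "x \<le> y" for x y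
  proof -
    have "(\<integral>\<^sup>+z. ennreal (enn2real (g z) * indicator {x..y} z) \<partial>lborel)
        = (\<integral>\<^sup>+z. g z * indicator {x..y} z \<partial>lborel)"
      by (rule nn_integral_cong_AE, use gfin in eventually_elim)
         (auto simp: indicator_def less_top)
    also have "\<dots> = ennreal (F y - F x)" by (rule gint[OF that])
    finally have eq: "(\<integral>\<^sup>+z. ennreal (enn2real (g z) * indicator {x..y} z) \<partial>lborel) = ennreal (F y - F x)" .
    have F0: "0 \<le> F y - F x"
      using Fle'[OF that] by simp
    have "((\<lambda>z. enn2real (g z) * indicator {x..y} z) has_integral (F y - F x)) UNIV"
      by (rule nn_integral_has_integral[OF _ _ eq F0]) auto
    moreover have "(\<lambda>z. enn2real (g z) * indicator {x..y} z) = (\<lambda>z. if z \<in> {x..y} then enn2real (g z) else 0)"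
      by (auto simp: indicator_def)
    ultimately have "((\<lambda>z. enn2real (g z)) has_integral (F y - F x)) {x..y}"
      by (metis (no_types) has_integral_restrict_UNIV)
    from has_integral_diff[OF this has_integral_const_real[of "2 * K" x y]]
    show ?thesis using that by (simp add: f_def F_def algebra_simps)
  qed
  ultimately show thesis by (rule that)
qed

lemma integral_mono_AE_spike:
  fixes f g :: "real \<Rightarrow> real"
  assumes "f integrable_on S" "g integrable_on S" "negligible N" "\<And>x. x \<in> S \<Longrightarrow> x \<notin> N \<Longrightarrow> f x \<le> g x"
  shows "integral S f \<le> integral S g"
proof -
  let ?f = "\<lambda>x. if x \<in> N then g x else f x"
  have "integral S f = integral S ?f"
    by (rule integral_spike[OF assms(3)]) auto
  also have "\<dots> \<le> integral S g"
  proof (rule integral_le)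
    show "?f integrable_on S"
      by (rule integrable_spike[OF assms(1,3)]) auto
  qed (use assms in auto)
  finally show ?thesis .
qed

text \<open>Let \<open>s\<close> be the supremum of the absolute densities of the functions
\<open>t \<mapsto> d(c t, w\<^sub>i)\<close>, where \<open>w\<^sub>i\<close> runs through a dense
sequence on the curve. Each of these functions bounds the distance quotient from below, and
\<open>d(c u, c v) \<le> \<integral>\<^sub>u\<^sup>v s\<close> bounds it from above, so at
Lebesgue points the quotient converges to \<open>s\<close>.\<close>

lemma metric_speed_exists_ae:
  fixes M :: "'a metric" and c :: "real \<Rightarrow> 'a"
  assumes cM: "\<And>t. c t \<in> mspace M" and L: "\<And>s t. mdist M (c s) (c t) \<le> L * \<bar>s - t\<bar>"
  obtains N where "negligible N"
    "\<And>t. t \<notin> N \<Longrightarrow> \<exists>l. ((\<lambda>h. mdist M (c (t + h)) (c t) / \<bar>h\<bar>) \<longlongrightarrow> l) (at 0)"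
proof -
  have L0: "L \<ge> 0" using order_trans[OF mdist_nonneg L[of 0 1]] by simp
  define q where "q = (from_nat_into \<rat> :: nat \<Rightarrow> real)"
  define a where "a = (\<lambda>i t. mdist M (c t) (c (q i)))"
  have tri: "\<bar>a i s - a i t\<bar> \<le> mdist M (c s) (c t)" for i s t
    using mdist_triangle[OF cM cM cM, of s "q i" t] mdist_triangle[OF cM cM cM, of t "q i" s]
    by (auto simp: a_def mdist_commute abs_le_iff)
  have aL: "\<bar>a i s - a i t\<bar> \<le> L * \<bar>s - t\<bar>" for i s t
    using tri L by (rule order_trans)
  have "\<forall>i. \<exists>f. f \<in> borel_measurable borel \<and>
      (\<forall>x y. x \<le> y \<longrightarrow> (f has_integral (a i y - a i x)) {x..y})"
    by (metis lipschitz_density[OF aL])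
  then obtain f where fm[measurable]: "\<And>i. f i \<in> borel_measurable borel"
    and fi: "\<And>i x y. x \<le> y \<Longrightarrow> (f i has_integral (a i y - a i x)) {x..y}"
    by metis
  have fint: "f i integrable_on {x..y}" for i x y
    by (cases "x \<le> y") (use fi in \<open>auto simp: integrable_on_def\<close>)
  have fint': "integral {x..y} (f i) = a i y - a i x" if "x \<le> y" for i x y
    using fi[OF that] by (rule integral_unique)
  have "\<forall>i. \<exists>N. negligible N \<and> (\<forall>t e. t \<notin> N \<and> 0 < e \<longrightarrow> (\<exists>d>0. \<forall>h. 0 < h \<and> h < d \<longrightarrow>
        \<bar>integral {t..t+h} (f i) / h - f i t\<bar> < e \<and> \<bar>integral {t-h..t} (f i) / h - f i t\<bar> < e))"
    by (metis lebesgue_differentiation_real[OF fint])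
  then obtain Nf where Nf: "\<And>i. negligible (Nf i)"
    "\<And>i t e. \<lbrakk>t \<notin> Nf i; 0 < e\<rbrakk> \<Longrightarrow> \<exists>d>0. \<forall>h. 0 < h \<and> h < d \<longrightarrow>
        \<bar>integral {t..t+h} (f i) / h - f i t\<bar> < e \<and> \<bar>integral {t-h..t} (f i) / h - f i t\<bar> < e"
    by metis
  define N0 where "N0 = (\<Union>i. Nf i)"
  have N0: "negligible N0"
    unfolding N0_def by (rule negligible_countable_Union) (auto simp: Nf)
  have fL: "\<bar>f i t\<bar> \<le> L" if "t \<notin> N0" for i t
  proof (rule field_le_epsilon)
    fix e :: real assume e: "e > 0"
    have "t \<notin> Nf i" using that by (auto simp: N0_def)
    then obtain d where d: "d > 0" "\<And>h. 0 < h \<and> h < d \<Longrightarrow> \<bar>integral {t..t+h} (f i) / h - f i t\<bar> < e"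
      using Nf(2)[of t i e] e by meson
    have "\<bar>integral {t..t+d/2} (f i) / (d/2)\<bar> \<le> L"
    proof -
      have "\<bar>integral {t..t+d/2} (f i)\<bar> \<le> L * (d/2)"
        using aL[of i "t+d/2" t] \<open>d > 0\<close> fint'[of t "t+d/2" i] by simp
      then have "\<bar>integral {t..t+d/2} (f i)\<bar> / (d/2) \<le> L"
        using \<open>d > 0\<close> by (subst pos_divide_le_eq) auto
      then show ?thesis using \<open>d > 0\<close> by (simp only: abs_divide)
    qed
    moreover have "\<bar>integral {t..t+d/2} (f i) / (d/2) - f i t\<bar> < e"
      using d(2)[of "d/2"] \<open>d > 0\<close> by simp
    ultimately show "\<bar>f i t\<bar> \<le> L + e" by linarith
  qed
  \<comment> \<open>Truncation by \<open>L\<close> changes nothing outside a null set and keeps the supremum finite everywhere.\<close>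
  define s where "s = (\<lambda>t. SUP i. min L \<bar>f i t\<bar>)"
  have bdd: "bdd_above (range (\<lambda>i. min L \<bar>f i t\<bar>))" for t
    by (auto intro!: bdd_aboveI[of _ L])
  have s_ge: "min L \<bar>f i t\<bar> \<le> s t" for i t
    unfolding s_def by (rule cSUP_upper[OF _ bdd]) auto
  have s_ge': "\<bar>f i t\<bar> \<le> s t" if "t \<notin> N0" for i t
    using s_ge[of i t] fL[OF that, of i] by auto
  have s0: "0 \<le> s t" for t using s_ge[of 0 t] L0 by (auto simp: min_def split: if_splits)
  have sL: "s t \<le> L" for t unfolding s_def by (rule cSUP_least) auto
  have sm[measurable]: "s \<in> borel_measurable borel"
    unfolding s_def by (rule borel_measurable_cSUP) (auto simp: bdd)
  have sint: "s integrable_on {x..y}" for x y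
  proof (rule measurable_bounded_by_integrable_imp_integrable_real)
    show "s \<in> borel_measurable (lebesgue_on {x..y})"
      by (rule measurable_restrict_space1) (auto intro: measurable_completion)
    show "(\<lambda>_. L) integrable_on {x..y}" by (rule integrable_const_ivl)
  qed (use s0 sL in auto)
  obtain Ns where Ns: "negligible Ns"
    "\<And>t e. \<lbrakk>t \<notin> Ns; 0 < e\<rbrakk> \<Longrightarrow> \<exists>d>0. \<forall>h. 0 < h \<and> h < d \<longrightarrow>
        \<bar>integral {t..t+h} s / h - s t\<bar> < e \<and> \<bar>integral {t-h..t} s / h - s t\<bar> < e"
    using lebesgue_differentiation_real[OF sint] by blast
  have dense: "\<exists>i. \<bar>q i - u\<bar> < e" if "e > 0" for u e
  proof -
    obtain r where "r \<in> \<rat>" "u < r" "r < u + e" using Rats_dense_in_real[of u "u+e"] \<open>e > 0\<close> less_add_same_cancel1[of u e] by blast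
    moreover obtain i where "q i = r"
      unfolding q_def using from_nat_into_surj[OF countable_rat \<open>r \<in> \<rat>\<close>] by blast
    ultimately show ?thesis by (intro exI[of _ i]) auto
  qed
  have up: "mdist M (c u) (c v) \<le> integral {u..v} s" if "u \<le> v" for u v
  proof (rule field_le_epsilon)
    fix e :: real assume e: "e > 0"
    \<comment> \<open>A reference point within \<open>e / 2\<close> of \<open>c u\<close> loses at most \<open>e\<close> in the two triangle inequalities.\<close>
    obtain i where i: "\<bar>q i - u\<bar> < e / (2 * L + 1)" using dense[of "e / (2 * L + 1)" u] e L0 by auto
    have "a i u \<le> L * \<bar>q i - u\<bar>" using L[of u "q i"] by (simp add: a_def abs_minus_commute)
    moreover have "2 * (L * \<bar>q i - u\<bar>) \<le> e"
    proof -
      have "(2 * L + 1) * \<bar>q i - u\<bar> \<le> e" using i L0 by (simp add: field_simps)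
      then show ?thesis by (auto simp: algebra_simps)
    qed
    moreover have "mdist M (c u) (c v) \<le> a i u + a i v"
      using mdist_triangle[OF cM[of u] cM[of "q i"] cM[of v]] mdist_commute[of M "c v" "c (q i)"] by (simp add: a_def)
    moreover have "a i v - a i u \<le> integral {u..v} s"
    proof -
      have "integral {u..v} (f i) \<le> integral {u..v} s"
        by (rule integral_mono_AE_spike[OF fint sint N0]) (use s_ge' in \<open>auto simp: abs_le_iff\<close>)
      then show ?thesis using fint'[OF that] by simp
    qed
    ultimately show "mdist M (c u) (c v) \<le> integral {u..v} s + e" by linarith
  qed
  have lim: "((\<lambda>h. mdist M (c (t + h)) (c t) / \<bar>h\<bar>) \<longlongrightarrow> s t) (at 0)" if t: "t \<notin> N0 \<union> Ns" for t
  proof (rule LIM_I)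
    fix e :: real assume e: "e > 0"
    have "s t - e / 2 < s t" using e by simp
    then obtain i where "s t - e / 2 < min L \<bar>f i t\<bar>"
      unfolding s_def by (subst (asm) less_cSUP_iff[OF _ bdd]) auto
    then have i: "s t - e / 2 < \<bar>f i t\<bar>" by simp
    obtain d1 where d1: "d1 > 0" "\<And>h. 0 < h \<and> h < d1 \<Longrightarrow>
        \<bar>integral {t..t+h} (f i) / h - f i t\<bar> < e/2 \<and> \<bar>integral {t-h..t} (f i) / h - f i t\<bar> < e/2"
    proof -
      have "t \<notin> Nf i" "e / 2 > 0" using t e by (auto simp: N0_def)
      then show thesis using Nf(2)[of t i "e/2"] that by meson
    qed
    obtain d2 where d2: "d2 > 0" "\<And>h. 0 < h \<and> h < d2 \<Longrightarrow>
        \<bar>integral {t..t+h} s / h - s t\<bar> < e \<and> \<bar>integral {t-h..t} s / h - s t\<bar> < e"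
    proof -
      have "t \<notin> Ns" using t by auto
      then show thesis using Ns(2)[of t e] e that by meson
    qed
    have "\<bar>mdist M (c (t + h)) (c t) / \<bar>h\<bar> - s t\<bar> < e" if h: "h \<noteq> 0" "\<bar>h\<bar> < min d1 d2" for h
    proof -
      define u where "u = min t (t + h)"
      define v where "v = max t (t + h)"
      have uv: "u \<le> v" "v - u = \<bar>h\<bar>" by (auto simp: u_def v_def)
      have D: "mdist M (c (t + h)) (c t) = mdist M (c u) (c v)"
        by (auto simp: u_def v_def min_def max_def mdist_commute)
      have A: "\<bar>integral {u..v} (f i) / \<bar>h\<bar> - f i t\<bar> < e/2" "\<bar>integral {u..v} s / \<bar>h\<bar> - s t\<bar> < e"
        using d1(2)[of "\<bar>h\<bar>"] d2(2)[of "\<bar>h\<bar>"] h by (auto simp: u_def v_def min_def max_def abs_if split: if_splits)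
      have "mdist M (c u) (c v) / \<bar>h\<bar> \<le> integral {u..v} s / \<bar>h\<bar>"
        by (rule divide_right_mono[OF up[OF uv(1)]]) simp
      moreover have "\<bar>integral {u..v} (f i)\<bar> / \<bar>h\<bar> \<le> mdist M (c u) (c v) / \<bar>h\<bar>"
        by (rule divide_right_mono) (use tri[of i v u] fint'[OF uv(1)] in \<open>auto simp: mdist_commute\<close>)
      moreover have "\<bar>f i t\<bar> - e / 2 < \<bar>integral {u..v} (f i)\<bar> / \<bar>h\<bar>"
      proof -
        have "\<bar>integral {u..v} (f i)\<bar> / \<bar>h\<bar> = \<bar>integral {u..v} (f i) / \<bar>h\<bar>\<bar>" by (simp)
        then show ?thesis using A(1) by linarith
      qed
      ultimately show ?thesis using A(2) i unfolding D by linarith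
    qed
    then show "\<exists>r>0. \<forall>x. x \<noteq> 0 \<and> norm (x - 0) < r \<longrightarrow> norm (mdist M (c (t + x)) (c t) / \<bar>x\<bar> - s t) < e"
      using d1(1) d2(1) by (intro exI[of _ "min d1 d2"]) auto
  qed
  have "negligible (N0 \<union> Ns)" using N0 Ns(1) by simp
  with lim show thesis by (intro that[of "N0 \<union> Ns"]) auto
qed

section \<open>Metric trees satisfy the four-point condition\<close>

definition geodesic_segment :: "'a metric \<Rightarrow> (real \<Rightarrow> 'a) \<Rightarrow> real \<Rightarrow> bool" where
  "geodesic_segment Z g D \<longleftrightarrow> 0 \<le> D \<and> (\<forall>r\<in>{0..D}. g r \<in> mspace Z) \<and>
     (\<forall>r\<in>{0..D}. \<forall>s\<in>{0..D}. mdist Z (g r) (g s) = \<bar>r - s\<bar>)"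

text \<open>Gromov's condition of being \<open>0\<close>-hyperbolic.\<close>

definition four_point :: "'a metric \<Rightarrow> bool" where
  "four_point Z \<longleftrightarrow> (\<forall>x\<in>mspace Z. \<forall>y\<in>mspace Z. \<forall>z\<in>mspace Z. \<forall>w\<in>mspace Z.
     mdist Z x y + mdist Z z w \<le> max (mdist Z x z + mdist Z y w) (mdist Z x w + mdist Z y z))"

lemma mdist_self: "x \<in> mspace m \<Longrightarrow> mdist m x x = 0"
  by simp

lemma openin_mtopology_of:
  "openin (mtopology_of Z) U \<longleftrightarrow>
     U \<subseteq> mspace Z \<and> (\<forall>x\<in>U. \<exists>r>0. \<forall>y\<in>mspace Z. mdist Z x y < r \<longrightarrow> y \<in> U)"
proof -
  have "openin (mtopology_of Z) U \<longleftrightarrow> U \<subseteq> mspace Z \<and>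
      (\<forall>x. x \<in> U \<longrightarrow> (\<exists>r>0. Metric_space.mball (mspace Z) (mdist Z) x r \<subseteq> U))"
    by (simp only: mtopology_of_def Metric_space.openin_mtopology[OF Metric_space_mspace_mdist])
  moreover have "Metric_space.mball (mspace Z) (mdist Z) x r \<subseteq> U \<longleftrightarrow> (\<forall>y\<in>mspace Z. mdist Z x y < r \<longrightarrow> y \<in> U)"
    if "x \<in> mspace Z" for x r
    using that unfolding Metric_space.mball_def[OF Metric_space_mspace_mdist] by blast
  ultimately show ?thesis
    by (smt (verit) subsetD)
qed

lemma nonexpansive_continuous_map:
  fixes g :: "real \<Rightarrow> 'a"
  assumes "\<And>r. r \<in> S \<Longrightarrow> g r \<in> mspace Z"
    and "\<And>r s. r \<in> S \<Longrightarrow> s \<in> S \<Longrightarrow> mdist Z (g r) (g s) \<le> \<bar>r - s\<bar>"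
  shows "continuous_map (top_of_set S) (mtopology_of Z) g"
  unfolding continuous_map_def
proof (intro conjI allI impI)
  show "g \<in> topspace (top_of_set S) \<rightarrow> topspace (mtopology_of Z)"
    using assms(1) by auto
  fix U assume U: "openin (mtopology_of Z) U"
  have "\<exists>e>0. \<forall>r'\<in>S. dist r' r < e \<longrightarrow> g r' \<in> U" if r: "r \<in> S" "g r \<in> U" for r
  proof -
    obtain e where "e > 0" "\<And>y. y \<in> mspace Z \<Longrightarrow> mdist Z (g r) y < e \<Longrightarrow> y \<in> U"
      using U r unfolding openin_mtopology_of by blast
    then show ?thesis
      using assms(1) le_less_trans[OF assms(2)[OF r(1)], of _ e]
      by (intro exI[of _ e]) (simp add: dist_real_def abs_minus_commute)
  qed
  then show "openin (top_of_set S) {x \<in> topspace (top_of_set S). g x \<in> U}"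
    unfolding openin_euclidean_subtopology_iff by simp
qed

text \<open>Along a curve \<open>\<gamma>\<close> whose length is the distance of its ends all
triangle inequalities are equalities. Hence \<open>t \<mapsto> d(x, \<gamma> t)\<close> is
nondecreasing, and choosing a parameter for every value of it reparametrizes
\<open>\<gamma>\<close> by arc length.\<close>

lemma geodesic_metric_segment:
  assumes Z: "geodesic_metric Z" and x: "x \<in> mspace Z" and y: "y \<in> mspace Z"
  obtains g where "geodesic_segment Z g (mdist Z x y)" "g 0 = x" "g (mdist Z x y) = y"
proof -
  define D where "D = mdist Z x y"
  obtain \<gamma> where \<gamma>: "pathin (mtopology_of Z) \<gamma>" "\<gamma> 0 = x" "\<gamma> 1 = y"
    "curve_length Z \<gamma> = ennreal D"
    using Z[unfolded geodesic_metric_def, rule_format, OF x y] unfolding D_def by metis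
  have \<gamma>Z: "\<gamma> t \<in> mspace Z" if "t \<in> {0..1}" for t
    using continuous_map_image_subset_topspace[OF \<gamma>(1)[unfolded pathin_def]] that
    by (auto simp: image_subset_iff)
  have tri: "mdist Z u w \<le> mdist Z u v + mdist Z v w"
    if "u \<in> mspace Z" "v \<in> mspace Z" "w \<in> mspace Z" for u v w
    by (rule mdist_triangle[OF that])
  have three: "mdist Z x (\<gamma> s) + mdist Z (\<gamma> s) (\<gamma> t) + mdist Z (\<gamma> t) y \<le> D"
    if st: "0 \<le> s" "s \<le> t" "t \<le> 1" for s t
  proof -
    define T where "T = (\<lambda>i::nat. if i = 0 then 0 else if i = 1 then s else if i = 2 then t else (1::real))"
    have "(\<Sum>i<3. ennreal (mdist Z (\<gamma> (T i)) (\<gamma> (T (Suc i))))) \<le> curve_length Z \<gamma>"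
    proof -
      have "mono T"
        unfolding mono_iff_le_Suc using st by (auto simp: T_def)
      moreover have "T i \<in> {0..1}" for i using st by (simp add: T_def)
      ultimately have "(3, T) \<in> {(N, t). mono_on {..N} t \<and> t ` {..N} \<subseteq> {0..1}}"
        by (simp add: mono_imp_mono_on image_subset_iff del: atLeastAtMost_iff)
      then show ?thesis
        unfolding curve_length_def by (rule SUP_upper2) simp
    qed
    also have "(\<Sum>i<3. ennreal (mdist Z (\<gamma> (T i)) (\<gamma> (T (Suc i)))))
        = ennreal (\<Sum>i<3. mdist Z (\<gamma> (T i)) (\<gamma> (T (Suc i))))"
      by (rule sum_ennreal) simp
    finally have "(\<Sum>i<3. mdist Z (\<gamma> (T i)) (\<gamma> (T (Suc i)))) \<le> D"
      using \<gamma>(4) by (simp add: D_def)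
    then show ?thesis
      by (simp add: numeral_3_eq_3 T_def \<gamma>)
  qed
  define \<tau> where "\<tau> = (\<lambda>t. mdist Z x (\<gamma> t))"
  have dist\<gamma>: "mdist Z (\<gamma> s) (\<gamma> t) = \<tau> t - \<tau> s" "mdist Z (\<gamma> t) y = D - \<tau> t"
    if st: "0 \<le> s" "s \<le> t" "t \<le> 1" for s t
  proof -
    have Z: "\<gamma> s \<in> mspace Z" "\<gamma> t \<in> mspace Z" using st \<gamma>Z by auto
    show "mdist Z (\<gamma> s) (\<gamma> t) = \<tau> t - \<tau> s" "mdist Z (\<gamma> t) y = D - \<tau> t"
      using three[OF st] tri[OF x Z(1) Z(2)] tri[OF x Z(2) y] unfolding \<tau>_def D_def
      by linarith+
  qed
  have "continuous_map (top_of_set {0..1}) euclideanreal \<tau>"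
    unfolding \<tau>_def by (rule continuous_map_mdist) (use \<gamma>(1) x in \<open>auto simp: pathin_def\<close>)
  then have cont: "continuous_on {0..1} \<tau>" by simp
  have "\<tau> 0 = 0" "\<tau> 1 = D" using x by (auto simp: \<tau>_def \<gamma> D_def)
  then have "\<exists>t. t \<in> {0..1} \<and> \<tau> t = r" if "r \<in> {0..D}" for r
    using IVT'[of \<tau> 0 r 1] cont that by auto
  then have "\<forall>r. \<exists>t. r \<in> {0..D} \<longrightarrow> t \<in> {0..1} \<and> \<tau> t = r" by blast
  then obtain T where T: "\<And>r. r \<in> {0..D} \<Longrightarrow> T r \<in> {0..1} \<and> \<tau> (T r) = r"
    by (rule choice[THEN exE]) blast
  define g where "g = \<gamma> \<circ> T"
  have D0: "D \<ge> 0" by (simp add: D_def)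
  have "mdist Z (g r) (g s) = \<bar>r - s\<bar>" if "r \<in> {0..D}" "s \<in> {0..D}" for r s
  proof -
    have ord: "mdist Z (g r) (g s) = \<bar>r - s\<bar>" if "T r \<le> T s" "r \<in> {0..D}" "s \<in> {0..D}" for r s
    proof -
      have "mdist Z (g r) (g s) = s - r"
        using dist\<gamma>(1)[of "T r" "T s"] T[OF that(2)] T[OF that(3)] that(1) by (auto simp: g_def)
      moreover have "0 \<le> mdist Z (g r) (g s)" by simp
      ultimately show ?thesis by linarith
    qed
    show ?thesis
      using ord[of r s] ord[of s r] that mdist_commute[of Z "g r" "g s"] abs_minus_commute[of r s]
      by (cases "T r \<le> T s") auto
  qed
  then have seg: "geodesic_segment Z g D"
    using T \<gamma>Z D0 by (auto simp: geodesic_segment_def g_def)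
  have "\<tau> (T 0) = 0" "\<tau> (T D) = D" "T D \<in> {0..1}" "T 0 \<in> {0..1}" using T D0 by auto
  then have "mdist Z x (g 0) = 0" "mdist Z (g D) y = 0"
    using dist\<gamma>(2)[of "T D" "T D"] by (auto simp: g_def \<tau>_def)
  then have "g 0 = x" "g D = y"
    using x y seg D0 by (auto simp: geodesic_segment_def)
  with seg show thesis by (intro that[of g]) (auto simp: D_def)
qed

text \<open>The circle is mapped by projecting it to the real axis; the upper half then runs along
the first arc and the lower half along the second. The endpoints of the second arc may come in
either order.\<close>

lemma two_arcs_circle:
  fixes \<alpha> \<beta> :: "real \<Rightarrow> 'a"
  assumes \<alpha>: "continuous_map (top_of_set {a..b}) T \<alpha>" "inj_on \<alpha> {a..b}" "a < b"
    and \<beta>: "continuous_map (top_of_set {c..d}) T \<beta>" "inj_on \<beta> {c..d}"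
    and u: "u \<in> {c..d}" "v \<in> {c..d}" "\<alpha> a = \<beta> u" "\<alpha> b = \<beta> v"
    and disj: "\<And>s. a < s \<Longrightarrow> s < b \<Longrightarrow> \<alpha> s \<notin> \<beta> ` {c..d}" and T: "Hausdorff_space T"
  shows "\<exists>S \<subseteq> topspace T. subtopology T S homeomorphic_space top_of_set (sphere (0 :: complex) 1)"
proof -
  define p where "p = (\<lambda>z. a + (Re z + 1) / 2 * (b - a))"
  define q where "q = (\<lambda>z. u + (Re z + 1) / 2 * (v - u))"
  let ?C = "top_of_set (sphere (0 :: complex) 1)"
  define F where "F = (\<lambda>z. if 0 \<le> Im z then \<alpha> (p z) else \<beta> (q z))"
  have uv: "u \<noteq> v" using u \<alpha>(2,3) by (metis atLeastAtMost_iff inj_onD less_imp_le order_refl less_irrefl)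
  have Re1: "-1 \<le> Re z" "Re z \<le> 1" if "cmod z = 1" for z
    using abs_Re_le_cmod[of z] that by auto
  have p: "p z \<in> {a..b}" if "cmod z = 1" for z
  proof -
    have "0 \<le> (Re z + 1) / 2 * (b - a)" "(Re z + 1) / 2 * (b - a) \<le> 1 * (b - a)"
      using Re1[OF that] \<alpha>(3) by (intro mult_nonneg_nonneg mult_right_mono; simp)+
    then show ?thesis by (simp add: p_def)
  qed
  have q: "q z \<in> {c..d}" if "cmod z = 1" for z
  proof -
    have "q z = (1 - (Re z + 1) / 2) *\<^sub>R u + ((Re z + 1) / 2) *\<^sub>R v"
      by (simp add: q_def field_simps)
    also have "\<dots> \<in> {c..d}"
      using convexD_alt[OF convex_real_interval(5) u(1) u(2), of "(Re z + 1) / 2"] Re1[OF that] by auto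
    finally show ?thesis .
  qed
  have contF: "continuous_map ?C T F"
    unfolding F_def
  proof (rule continuous_map_cases_le)
    show "continuous_map ?C euclideanreal (\<lambda>z. 0)" "continuous_map ?C euclideanreal Im"
      by (auto intro!: continuous_intros)
    have P: "continuous_map ?C (top_of_set {a..b}) p" "continuous_map ?C (top_of_set {c..d}) q"
      using p q by (auto simp: continuous_map_in_subtopology p_def q_def intro!: continuous_intros)
    from continuous_map_compose[OF P(1) \<alpha>(1)]
    show "continuous_map (subtopology ?C {x \<in> topspace ?C. 0 \<le> Im x}) T (\<lambda>z. \<alpha> (p z))"
      by (simp add: o_def continuous_map_from_subtopology)
    from continuous_map_compose[OF P(2) \<beta>(1)]
    show "continuous_map (subtopology ?C {x \<in> topspace ?C. Im x \<le> 0}) T (\<lambda>z. \<beta> (q z))"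
      by (simp add: o_def continuous_map_from_subtopology)
    fix z assume z: "z \<in> topspace ?C" "0 = Im z"
    then have "(Re z)\<^sup>2 = 1" using cmod_power2[of z] by simp
    then have "Re z = 1 \<or> Re z = -1" by (simp add: power2_eq_1_iff)
    moreover have "p z = b \<and> q z = v" if "Re z = 1" using that by (simp add: p_def q_def field_simps)
    moreover have "p z = a \<and> q z = u" if "Re z = -1" using that by (simp add: p_def q_def)
    ultimately show "\<alpha> (p z) = \<beta> (q z)"
      using u by metis
  qed
  have eq: "w = z" if wz: "cmod w = 1" "cmod z = 1" "Re w = Re z" "(0 \<le> Im w) = (0 \<le> Im z)" for w z
  proof -
    have "(Im w)\<^sup>2 = (Im z)\<^sup>2" using cmod_power2[of z] cmod_power2[of w] wz by simp
    then have "Im w = Im z" using wz(4) by (auto simp: power2_eq_iff)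
    then show ?thesis using wz(3) by (simp add: complex_eq_iff)
  qed
  have no: "\<alpha> (p w) \<noteq> \<beta> (q z)" if wz: "cmod w = 1" "cmod z = 1" "0 \<le> Im w" "Im z < 0" for w z
  proof
    assume e: "\<alpha> (p w) = \<beta> (q z)"
    then have "\<alpha> (p w) \<in> \<beta> ` {c..d}" using q[OF wz(2)] by auto
    then have "p w = a \<or> p w = b" using disj[of "p w"] p[OF wz(1)] by fastforce
    have Rz: "Re z \<noteq> 1 \<and> Re z \<noteq> -1"
      using cmod_power2[of z] wz by auto
    from \<open>p w = a \<or> p w = b\<close> show False
    proof
      assume "p w = a"
      then have "\<beta> u = \<beta> (q z)" using e u by simp
      then have "u = q z" using \<beta>(2) u(1) q[OF wz(2)] by (auto dest: inj_onD)
      then show False using Rz uv by (auto simp: q_def)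
    next
      assume "p w = b"
      then have "\<beta> v = \<beta> (q z)" using e u by simp
      then have "v = q z" using \<beta>(2) u(2) q[OF wz(2)] by (auto dest: inj_onD)
      then have "(Re z + 1) / 2 * (v - u) = 1 * (v - u)" by (simp add: q_def)
      then have "(Re z + 1) / 2 = 1" using uv by (metis mult_right_cancel right_minus_eq)
      then show False using Rz by simp
    qed
  qed
  have injF: "inj_on F (topspace ?C)"
  proof (rule inj_onI)
    fix w z assume wz: "w \<in> topspace ?C" "z \<in> topspace ?C" "F w = F z"
    then have c: "cmod w = 1" "cmod z = 1" by auto
    have "(0 \<le> Im w) = (0 \<le> Im z)"
      using no[OF c] no[OF c(2) c(1)] wz(3) by (fastforce simp: F_def split: if_splits)
    moreover have "Re w = Re z"
    proof (cases "0 \<le> Im z")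
      case True
      then have "\<alpha> (p w) = \<alpha> (p z)" using wz(3) calculation by (auto simp: F_def)
      then have "p w = p z" using \<alpha>(2) p[OF c(1)] p[OF c(2)] by (auto dest: inj_onD)
      then show ?thesis using \<alpha>(3) by (simp add: p_def)
    next
      case False
      then have "\<beta> (q w) = \<beta> (q z)" using wz(3) calculation by (auto simp: F_def)
      then have "q w = q z" using \<beta>(2) q[OF c(1)] q[OF c(2)] by (auto dest: inj_onD)
      then show ?thesis using uv by (simp add: q_def)
    qed
    ultimately show "w = z" using eq c by blast
  qed
  have "compact_space ?C"
    by (simp add: compact_space_subtopology)
  then have "embedding_map ?C T F"
    using continuous_imp_embedding_map[OF contF _ T injF] by blast
  then have "?C homeomorphic_space subtopology T (F ` topspace ?C)"
    by (auto simp: embedding_map_def homeomorphic_map_imp_homeomorphic_space)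
  moreover have "F ` topspace ?C \<subseteq> topspace T"
    using contF by (auto simp: continuous_map_def)
  ultimately show ?thesis
    using homeomorphic_space_sym by blast
qed


lemma geodesic_segment_continuous:
  assumes "geodesic_segment Z g D"
  shows "continuous_map (top_of_set {0..D}) (mtopology_of Z) g" "inj_on g {0..D}"
proof -
  show "continuous_map (top_of_set {0..D}) (mtopology_of Z) g"
    by (rule nonexpansive_continuous_map) (use assms in \<open>auto simp: geodesic_segment_def\<close>)
  show "inj_on g {0..D}"
  proof (rule inj_onI)
    fix r s assume rs: "r \<in> {0..D}" "s \<in> {0..D}" "g r = g s"
    then have "mdist Z (g r) (g s) = \<bar>r - s\<bar>" "g s \<in> mspace Z"
      using assms unfolding geodesic_segment_def by blast+
    then show "r = s" using rs(3) by (simp add: mdist_self)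
  qed
qed

lemma Hausdorff_space_mtopology_of: "Hausdorff_space (mtopology_of Z)"
proof -
  interpret Metric_space "mspace Z" "mdist Z" by simp
  show ?thesis unfolding mtopology_of_def by (rule Hausdorff_space_mtopology)
qed

text \<open>Otherwise a maximal open piece of the arc off the geodesic and the part of the
geodesic between the ends of that piece form a circle.\<close>

lemma arc_subset_geodesic:
  fixes \<alpha> :: "real \<Rightarrow> 'a"
  assumes tree: "metric_tree Z"
    and \<alpha>: "continuous_map (top_of_set {a..b}) (mtopology_of Z) \<alpha>" "inj_on \<alpha> {a..b}"
    and \<beta>: "geodesic_segment Z \<beta> D" and ends: "\<alpha> a = \<beta> 0" "\<alpha> b = \<beta> D" and s: "s \<in> {a..b}"
  shows "\<alpha> s \<in> \<beta> ` {0..D}"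
proof (rule ccontr)
  assume ns: "\<alpha> s \<notin> \<beta> ` {0..D}"
  have D0: "0 \<le> D" using \<beta> by (simp add: geodesic_segment_def)
  note cb = geodesic_segment_continuous[OF \<beta>]
  have "compactin (mtopology_of Z) (\<beta> ` {0..D})"
    by (rule image_compactin[OF _ cb(1)]) (simp add: compactin_subtopology)
  then have cl: "closedin (mtopology_of Z) (\<beta> ` {0..D})"
    by (rule compactin_imp_closedin[OF Hausdorff_space_mtopology_of])
  define K where "K = {r \<in> {a..b}. \<alpha> r \<in> \<beta> ` {0..D}}"
  have "closedin (top_of_set {a..b}) {r \<in> topspace (top_of_set {a..b}). \<alpha> r \<in> \<beta> ` {0..D}}"
    by (rule closedin_continuous_map_preimage[OF \<alpha>(1) cl])
  then have "closedin (top_of_set {a..b}) K"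
    by (simp add: K_def)
  then have K: "closed K"
    by (metis closed_atLeastAtMost closedin_closed_trans)
  have aK: "a \<in> K" "b \<in> K" "s \<notin> K" using s ends ns D0 by (auto simp: K_def)
  define s1 where "s1 = Sup (K \<inter> {a..s})"
  define s2 where "s2 = Inf (K \<inter> {s..b})"
  have "s1 \<in> K \<inter> {a..s}" unfolding s1_def
    by (rule closed_contains_Sup) (use aK s K in \<open>auto intro!: bdd_aboveI[of _ s]\<close>)
  moreover have "s2 \<in> K \<inter> {s..b}" unfolding s2_def
    by (rule closed_contains_Inf) (use aK s K in \<open>auto intro!: bdd_belowI[of _ s]\<close>)
  ultimately have s12: "s1 \<in> K" "s2 \<in> K" "s1 < s" "s < s2" "a \<le> s1" "s2 \<le> b"
    using aK by (auto simp: less_le)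
  have gap: "r \<notin> K" if "s1 < r" "r < s2" for r
  proof
    assume r: "r \<in> K"
    show False
    proof (cases "r \<le> s")
      case True
      then have "r \<le> s1" unfolding s1_def
        by (intro cSup_upper) (use r in \<open>auto simp: K_def intro!: bdd_aboveI[of _ s]\<close>)
      then show False using that by simp
    next
      case False
      then have "s2 \<le> r" unfolding s2_def
        by (intro cInf_lower) (use r in \<open>auto simp: K_def intro!: bdd_belowI[of _ s]\<close>)
      then show False using that by simp
    qed
  qed
  obtain u v where uv: "u \<in> {0..D}" "\<alpha> s1 = \<beta> u" "v \<in> {0..D}" "\<alpha> s2 = \<beta> v"
    using s12(1,2) by (auto simp: K_def)
  have "\<exists>S \<subseteq> topspace (mtopology_of Z). subtopology (mtopology_of Z) S homeomorphic_space top_of_set (sphere (0 :: complex) 1)"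
  proof (rule two_arcs_circle[OF _ _ _ cb(1) cb(2) uv(1) uv(3) uv(2) uv(4)])
    have sub: "{s1..s2} \<subseteq> {a..b}" using s12 by auto
    show "continuous_map (top_of_set {s1..s2}) (mtopology_of Z) \<alpha>"
      by (rule continuous_map_from_subtopology_mono[OF \<alpha>(1) sub])
    show "inj_on \<alpha> {s1..s2}" using \<alpha>(2) sub by (rule inj_on_subset)
    show "s1 < s2" using s12 by simp
    show "\<alpha> r \<notin> \<beta> ` {0..D}" if "s1 < r" "r < s2" for r
      using gap[OF that] that s12 by (auto simp: K_def)
  qed (rule Hausdorff_space_mtopology_of)
  then show False using tree by (auto simp: metric_tree_def)
qed

text \<open>A geodesic from \<open>z\<close> to its nearest point \<open>g r\<close> meets the
segment \<open>g\<close> only in \<open>g r\<close>, so continuing it along \<open>g\<close> gives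
an arc from \<open>z\<close> to \<open>g D\<close>. By the previous lemma the geodesic from
\<open>z\<close> to \<open>g D\<close> passes through \<open>g r\<close>.\<close>

lemma tree_nearest_point_between:
  assumes tree: "metric_tree Z" and g: "geodesic_segment Z g D" and z: "z \<in> mspace Z"
    and r: "r \<in> {0..D}" and min: "\<And>r'. r' \<in> {0..D} \<Longrightarrow> mdist Z z (g r) \<le> mdist Z z (g r')"
  shows "mdist Z z (g D) = mdist Z z (g r) + (D - r)"
proof -
  have gZ: "g r' \<in> mspace Z" if "r' \<in> {0..D}" for r' using g that by (auto simp: geodesic_segment_def)
  have gd: "mdist Z (g r1) (g r2) = \<bar>r1 - r2\<bar>" if "r1 \<in> {0..D}" "r2 \<in> {0..D}" for r1 r2
    using g that by (auto simp: geodesic_segment_def)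
  have D: "D \<in> {0..D}" using r by auto
  define E where "E = mdist Z z (g r)"
  have geo: "geodesic_metric Z" using tree by (simp add: metric_tree_def)
  obtain k where k: "geodesic_segment Z k E" "k 0 = z" "k E = g r"
    unfolding E_def by (rule geodesic_metric_segment[OF geo z gZ[OF r]])
  have E0: "E \<ge> 0" by (simp add: E_def)
  have kZ: "k t \<in> mspace Z" if "t \<in> {0..E}" for t using k that by (auto simp: geodesic_segment_def)
  have kd: "mdist Z (k t1) (k t2) = \<bar>t1 - t2\<bar>" if "t1 \<in> {0..E}" "t2 \<in> {0..E}" for t1 t2
    using k that by (auto simp: geodesic_segment_def)
  define \<alpha> where "\<alpha> = (\<lambda>t. if t \<le> E then k t else g (r + (t - E)))"
  let ?I = "{0..E + (D - r)}"
  have \<alpha>Z: "\<alpha> t \<in> mspace Z" if "t \<in> ?I" for t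
    using that r by (auto simp: \<alpha>_def intro!: kZ gZ)
  have \<alpha>1: "mdist Z (\<alpha> t1) (\<alpha> t2) \<le> t2 - t1" if "t1 \<in> ?I" "t2 \<in> ?I" "t1 \<le> t2" for t1 t2
  proof -
    consider "t2 \<le> E" | "t1 \<le> E" "E < t2" | "E < t1" using that by linarith
    then show ?thesis
    proof cases
      case 1 then show ?thesis using kd[of t1 t2] that by (auto simp: \<alpha>_def)
    next
      case 3 then show ?thesis using gd[of "r + (t1 - E)" "r + (t2 - E)"] that r by (auto simp: \<alpha>_def)
    next
      case 2
      have "mdist Z (k t1) (g (r + (t2 - E))) \<le> mdist Z (k t1) (k E) + mdist Z (g r) (g (r + (t2 - E)))"
        using mdist_triangle[of "k t1" Z "k E" "g (r + (t2 - E))"] that 2 kZ gZ r E0 k(3) by auto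
      also have "\<dots> \<le> t2 - t1" using kd[of t1 E] gd[of r "r + (t2 - E)"] that 2 r E0 by auto
      finally show ?thesis using 2 by (simp add: \<alpha>_def)
    qed
  qed
  have c\<alpha>: "continuous_map (top_of_set ?I) (mtopology_of Z) \<alpha>"
  proof (rule nonexpansive_continuous_map[OF \<alpha>Z])
    show "mdist Z (\<alpha> t1) (\<alpha> t2) \<le> \<bar>t1 - t2\<bar>" if "t1 \<in> ?I" "t2 \<in> ?I" for t1 t2
      using \<alpha>1[OF that] \<alpha>1[OF that(2,1)] by (cases "t1 \<le> t2") (auto simp: mdist_commute)
  qed
  have cross: "False" if "t \<in> {0..E}" "r' \<in> {0..D}" "k t = g r'" "r' \<noteq> r" for t r'
  proof -
    have "mdist Z z (k t) = t" using kd[of 0 t] that E0 k(2) by auto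
    then have "E \<le> t" using min[OF that(2)] that(3) by (simp add: E_def)
    then have "t = E" using that by simp
    then have "g r = g r'" using that k by simp
    then show False using gd[OF r that(2)] gZ[OF r] that(2,4) by (simp add: mdist_self gZ)
  qed
  have inj\<alpha>: "inj_on \<alpha> ?I"
  proof (rule linorder_inj_onI)
    fix t1 t2 assume t: "t1 < t2" "t1 \<in> ?I" "t2 \<in> ?I"
    consider "t2 \<le> E" | "t1 \<le> E" "E < t2" | "E < t1" using t by linarith
    then show "\<alpha> t1 \<noteq> \<alpha> t2"
    proof cases
      case 1 then show ?thesis using kd[of t1 t2] t kZ[of t1] by (auto simp: \<alpha>_def mdist_self)
    next
      case 3 then show ?thesis
        using gd[of "r + (t1 - E)" "r + (t2 - E)"] gZ[of "r + (t1 - E)"] t r by (auto simp: \<alpha>_def mdist_self)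
    next
      case 2
      then show ?thesis using cross[of t1 "r + (t2 - E)"] t r by (auto simp: \<alpha>_def)
    qed
  qed auto
  obtain \<beta> where \<beta>: "geodesic_segment Z \<beta> (mdist Z z (g D))" "\<beta> 0 = z" "\<beta> (mdist Z z (g D)) = g D"
    by (rule geodesic_metric_segment[OF geo z gZ[OF D]])
  have "\<alpha> E \<in> \<beta> ` {0..mdist Z z (g D)}"
  proof (rule arc_subset_geodesic[OF tree c\<alpha> inj\<alpha> \<beta>(1)])
    show "\<alpha> 0 = \<beta> 0" "\<alpha> (E + (D - r)) = \<beta> (mdist Z z (g D))" using E0 r k \<beta> by (auto simp: \<alpha>_def)
  qed (use E0 r in auto)
  then obtain u where u: "g r = \<beta> u" "u \<in> {0..mdist Z z (g D)}"
    by (auto simp: \<alpha>_def k)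
  have "mdist Z (\<beta> 0) (\<beta> u) = \<bar>0 - u\<bar>" "mdist Z (\<beta> u) (\<beta> (mdist Z z (g D))) = \<bar>u - mdist Z z (g D)\<bar>"
    using \<beta>(1) u(2) unfolding geodesic_segment_def by auto
  then have "mdist Z z (g r) = u" "mdist Z (g r) (g D) = mdist Z z (g D) - u"
    using u \<beta> by auto
  then show ?thesis using gd[OF r D] r by auto
qed

lemma tree_projection:
  assumes tree: "metric_tree Z" and g: "geodesic_segment Z g D" and z: "z \<in> mspace Z"
  obtains r e where "r \<in> {0..D}" "e = mdist Z z (g r)"
    "mdist Z z (g 0) = e + r" "mdist Z z (g D) = e + (D - r)"
proof -
  have "continuous_map (top_of_set {0..D}) euclideanreal (\<lambda>r. mdist Z z (g r))"
    by (rule continuous_map_mdist) (use z geodesic_segment_continuous[OF g] in auto)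
  then have "continuous_on {0..D} (\<lambda>r. mdist Z z (g r))" by simp
  moreover have "{0..D} \<noteq> {}" using g by (auto simp: geodesic_segment_def)
  ultimately obtain r where r: "r \<in> {0..D}" "\<And>r'. r' \<in> {0..D} \<Longrightarrow> mdist Z z (g r) \<le> mdist Z z (g r')"
    using continuous_attains_inf[of "{0..D}" "\<lambda>r. mdist Z z (g r)"] by auto
  have "geodesic_segment Z (\<lambda>t. g (D - t)) D"
    using g by (auto simp: geodesic_segment_def abs_minus_commute)
  from tree_nearest_point_between[OF tree this z, of "D - r"]
  have "mdist Z z (g 0) = mdist Z z (g r) + r"
    using r by simp
  moreover have "mdist Z z (g D) = mdist Z z (g r) + (D - r)"
    by (rule tree_nearest_point_between[OF tree g z r(1)]) (use r in auto)
  ultimately show thesis using that r(1) by blast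
qed

text \<open>Project \<open>z\<close> and \<open>w\<close> to a geodesic from \<open>x\<close> to
\<open>y\<close>. The four distances from \<open>z\<close> and \<open>w\<close> to the ends are
determined by the feet of the projections, and \<open>d z w\<close> is at most the length of the
path through both feet.\<close>

lemma metric_tree_imp_four_point:
  assumes tree: "metric_tree Z"
  shows "four_point Z"
  unfolding four_point_def
proof (intro ballI)
  fix x y z w assume x: "x \<in> mspace Z" and y: "y \<in> mspace Z" and z: "z \<in> mspace Z" and w: "w \<in> mspace Z"
  have geo: "geodesic_metric Z" using tree by (simp add: metric_tree_def)
  obtain g where g: "geodesic_segment Z g (mdist Z x y)" "g 0 = x" "g (mdist Z x y) = y"
    by (rule geodesic_metric_segment[OF geo x y])
  obtain r e where r: "r \<in> {0..mdist Z x y}" "e = mdist Z z (g r)" "mdist Z z (g 0) = e + r"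
    "mdist Z z (g (mdist Z x y)) = e + (mdist Z x y - r)"
    by (rule tree_projection[OF tree g(1) z])
  obtain r' e' where r': "r' \<in> {0..mdist Z x y}" "e' = mdist Z w (g r')" "mdist Z w (g 0) = e' + r'"
    "mdist Z w (g (mdist Z x y)) = e' + (mdist Z x y - r')"
    by (rule tree_projection[OF tree g(1) w])
  have G: "g r \<in> mspace Z" "g r' \<in> mspace Z" "mdist Z (g r) (g r') = \<bar>r - r'\<bar>"
    using g(1) r(1) r'(1) by (auto simp: geodesic_segment_def)
  have "mdist Z z w \<le> e + \<bar>r - r'\<bar> + e'"
    using mdist_triangle[OF z G(1) w] mdist_triangle[OF G(1) G(2) w] G(3) r(2) r'(2)
    by (simp add: mdist_commute)
  moreover have "mdist Z x z = e + r" "mdist Z x w = e' + r'"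
    "mdist Z y z = e + (mdist Z x y - r)" "mdist Z y w = e' + (mdist Z x y - r')"
    using r(3,4) r'(3,4) g by (simp_all add: mdist_commute)
  ultimately show "mdist Z x y + mdist Z z w \<le> max (mdist Z x z + mdist Z y w) (mdist Z x w + mdist Z y z)"
    by (cases "r \<le> r'") auto
qed

section \<open>Connected four-point spaces are metric trees\<close>

lemma four_pointD:
  assumes "four_point Z" "x \<in> mspace Z" "y \<in> mspace Z" "z \<in> mspace Z" "w \<in> mspace Z"
  shows "mdist Z x y + mdist Z z w \<le> max (mdist Z x z + mdist Z y w) (mdist Z x w + mdist Z y z)"
  using assms by (simp add: four_point_def)

text \<open>Let \<open>t z\<close> be the foot of \<open>z\<close> on a hypothetical segment from
\<open>a\<close> to \<open>b\<close> and \<open>e z\<close> its height above that segment, both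
read off from \<open>d a z\<close> and \<open>d z b\<close>. The four-point condition makes
\<open>t\<close> constant on the ball of radius \<open>e z\<close> around \<open>z\<close>. If no
point of \<open>C\<close> had foot \<open>s\<close> and height \<open>0\<close>, the sets \<open>t
< s\<close> and \<open>t \<ge> s\<close> would separate \<open>C\<close>.\<close>

lemma four_point_connected_between:
  assumes 4: "four_point Z" and C: "connectedin (mtopology_of Z) C" and ab: "a \<in> C" "b \<in> C"
    and s: "0 \<le> s" "s \<le> mdist Z a b"
  obtains m where "m \<in> C" "mdist Z a m = s" "mdist Z m b = mdist Z a b - s"
proof (rule ccontr)
  let ?d = "mdist Z" let ?M = "mspace Z"
  define D where "D = ?d a b"
  assume "\<not> thesis"
  with that have no: "\<And>m. m \<in> C \<Longrightarrow> \<not> (?d a m = s \<and> ?d m b = D - s)"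
    unfolding D_def by blast
  have CM: "C \<subseteq> ?M" using connectedin_subset_topspace[OF C] by simp
  have aM: "a \<in> ?M" and bM: "b \<in> ?M" using ab CM by auto
  have s0: "0 < s" using no[OF ab(1)] s mdist_self[OF aM] by (auto simp: D_def less_le)
  have sD: "s < D" using no[OF ab(2)] s mdist_self[OF bM] by (auto simp: D_def less_le)
  define t where "t = (\<lambda>z. (?d a z + D - ?d z b) / 2)"
  define e where "e = (\<lambda>z. (?d a z + ?d z b - D) / 2)"
  have e0: "e z \<ge> 0" if "z \<in> ?M" for z
    using mdist_triangle[OF aM that bM] by (simp add: e_def D_def)
  have et: "?d a z = t z + e z" "?d z b = D - t z + e z" for z
    by (auto simp: t_def e_def field_simps)
  have lip: "\<bar>t z - t w\<bar> \<le> ?d z w" if "z \<in> ?M" "w \<in> ?M" for z w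
    using mdist_triangle[OF aM that] mdist_triangle[OF aM that(2) that(1)]
      mdist_triangle[OF that bM] mdist_triangle[OF that(2) that(1) bM] mdist_commute[of Z z w]
    by (simp add: t_def field_simps abs_le_iff)
  have const: "t w = t z" if zw: "z \<in> ?M" "w \<in> ?M" "?d z w < e z" for z w
  proof -
    note F1 = four_pointD[OF 4 aM zw(1) bM zw(2)]
    note F2 = four_pointD[OF 4 aM zw(2) bM zw(1)]
    have "?d w b \<ge> ?d z b - ?d z w" "?d a w \<ge> ?d a z - ?d z w"
      using mdist_triangle[OF zw(1) zw(2) bM] mdist_triangle[OF aM zw(2) zw(1)] mdist_commute[of Z z w]
      by auto
    then have "?d a z + ?d w b > D + ?d z w" "?d a w + ?d z b > D + ?d z w"
      using zw(3) by (auto simp: e_def)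
    then have "?d a z + ?d w b = ?d a w + ?d z b"
      using F1 F2 mdist_commute[of Z b] mdist_commute[of Z z w] by (auto simp: D_def)
    then show ?thesis by (simp add: t_def)
  qed
  define U where "U = {z \<in> ?M. t z < s}"
  define V where "V = {z \<in> ?M. t z > s \<or> t z = s \<and> e z > 0}"
  have "openin (mtopology_of Z) U"
    unfolding openin_mtopology_of
  proof (intro conjI ballI)
    fix z assume z: "z \<in> U"
    show "\<exists>r>0. \<forall>y\<in>?M. ?d z y < r \<longrightarrow> y \<in> U"
      by (rule exI[of _ "s - t z"]) (use z lip[of z] in \<open>fastforce simp: U_def\<close>)
  qed (auto simp: U_def)
  moreover have "openin (mtopology_of Z) V"
    unfolding openin_mtopology_of
  proof (intro conjI ballI)
    fix z assume z: "z \<in> V"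
    show "\<exists>r>0. \<forall>y\<in>?M. ?d z y < r \<longrightarrow> y \<in> V"
    proof (cases "t z > s")
      case True
      then show ?thesis
        by (intro exI[of _ "t z - s"]) (use z lip[of z] in \<open>fastforce simp: V_def\<close>)
    next
      case False
      then have z': "t z = s" "e z > 0" "z \<in> ?M" using z by (auto simp: V_def)
      have "y \<in> V" if "y \<in> ?M" "?d z y < e z" for y
      proof -
        have "t y = s" using const[OF z'(3) that] z' by simp
        moreover have "e y > 0"
          using mdist_triangle[OF aM that(1) z'(3)] that(2) et(1)[of z] et(1)[of y] z' calculation
            mdist_commute[of Z z y] by auto
        ultimately show ?thesis using that by (simp add: V_def)
      qed
      then show ?thesis using z'(2) by blast
    qed
  qed (auto simp: V_def)
  moreover have "C \<subseteq> U \<union> V"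
  proof
    fix z assume z: "z \<in> C"
    then have "z \<in> ?M" using CM by auto
    then show "z \<in> U \<union> V" using no[OF z] e0[of z] et[of z] by (auto simp: U_def V_def less_le)
  qed
  moreover have "U \<inter> V \<inter> C = {}" by (auto simp: U_def V_def)
  moreover have "a \<in> U \<inter> C" using ab s0 aM by (simp add: U_def t_def D_def mdist_self)
  moreover have "b \<in> V \<inter> C" using ab sD bM by (simp add: V_def t_def D_def mdist_self)
  ultimately show False using connectedinD[OF C, of U V] by blast
qed

lemma four_point_between_dist:
  assumes 4: "four_point Z" and M: "a \<in> mspace Z" "b \<in> mspace Z" "m \<in> mspace Z" "m' \<in> mspace Z"
    and m: "mdist Z a m = s" "mdist Z m b = mdist Z a b - s"
    and m': "mdist Z a m' = s'" "mdist Z m' b = mdist Z a b - s'"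
  shows "mdist Z m m' = \<bar>s - s'\<bar>"
  using four_pointD[OF 4 M] mdist_triangle[OF M(1) M(3) M(4)] mdist_triangle[OF M(1) M(4) M(3)]
    m m' mdist_commute[of Z b m] mdist_commute[of Z b m'] mdist_commute[of Z m m']
  by (auto simp: max_def abs_if split: if_splits)

text \<open>The points at the prescribed distances from \<open>a\<close> and \<open>b\<close>,
which exist by connectedness, form an isometric copy of an interval.\<close>

lemma four_point_connected_geodesic:
  assumes 4: "four_point Z" and conn: "connected_space (mtopology_of Z)"
  shows "geodesic_metric Z"
  unfolding geodesic_metric_def
proof (intro ballI)
  fix a b assume aM: "a \<in> mspace Z" and bM: "b \<in> mspace Z"
  define D where "D = mdist Z a b"
  have D0: "D \<ge> 0" by (simp add: D_def)
  have C: "connectedin (mtopology_of Z) (mspace Z)"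
    using conn connectedin_topspace[of "mtopology_of Z"] by simp
  have "\<exists>m. m \<in> mspace Z \<and> mdist Z a m = r * D \<and> mdist Z m b = D - r * D" if "r \<in> {0..1}" for r
  proof -
    have "0 \<le> r * D" "r * D \<le> mdist Z a b"
      using that D0 mult_right_mono[of r 1 D] by (auto simp: D_def)
    then show ?thesis
      using four_point_connected_between[OF 4 C aM bM, of "r * D"] unfolding D_def by metis
  qed
  then obtain \<gamma> where \<gamma>: "\<And>r. r \<in> {0..1} \<Longrightarrow>
      \<gamma> r \<in> mspace Z \<and> mdist Z a (\<gamma> r) = r * D \<and> mdist Z (\<gamma> r) b = D - r * D"
    by metis
  have dist: "mdist Z (\<gamma> r) (\<gamma> s) = \<bar>r - s\<bar> * D" if "r \<in> {0..1}" "s \<in> {0..1}" for r s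
  proof -
    have "mdist Z (\<gamma> r) (\<gamma> s) = \<bar>r * D - s * D\<bar>"
      by (rule four_point_between_dist[OF 4 aM bM]) (use \<gamma> that in \<open>auto simp: D_def\<close>)
    also have "\<dots> = \<bar>r - s\<bar> * D" using D0 by (simp add: abs_mult flip: left_diff_distrib)
    finally show ?thesis .
  qed
  have ends: "\<gamma> 0 = a" "\<gamma> 1 = b"
    using \<gamma>[of 0] \<gamma>[of 1] aM bM by auto
  have "continuous_map (top_of_set {0..1}) (mtopology_of Z) \<gamma>"
    unfolding continuous_map_def
  proof (intro conjI allI impI)
    show "\<gamma> \<in> topspace (top_of_set {0..1}) \<rightarrow> topspace (mtopology_of Z)" using \<gamma> by auto
    fix U assume U: "openin (mtopology_of Z) U"
    have "\<exists>e>0. \<forall>r'\<in>{0..1}. dist r' r < e \<longrightarrow> \<gamma> r' \<in> U" if r: "r \<in> {0..1}" "\<gamma> r \<in> U" for r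
    proof -
      obtain e where e: "e > 0" "\<And>y. y \<in> mspace Z \<Longrightarrow> mdist Z (\<gamma> r) y < e \<Longrightarrow> y \<in> U"
        using U r unfolding openin_mtopology_of by blast
      have "\<gamma> r' \<in> U" if r': "r' \<in> {0..1}" "dist r' r < e / (D + 1)" for r'
      proof -
        have "\<bar>r - r'\<bar> * (D + 1) < e"
          using r'(2) D0 by (simp add: dist_real_def abs_minus_commute field_simps)
        then have "\<bar>r - r'\<bar> * D < e" by (simp add: algebra_simps)
        then show ?thesis using e(2)[of "\<gamma> r'"] \<gamma>[OF r'(1)] dist[OF r(1) r'(1)] by simp
      qed
      then show ?thesis using e(1) D0 by (intro exI[of _ "e / (D + 1)"]) auto
    qed
    then show "openin (top_of_set {0..1}) {x \<in> topspace (top_of_set {0..1}). \<gamma> x \<in> U}"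
      unfolding openin_euclidean_subtopology_iff by (auto simp del: atLeastAtMost_iff)
  qed
  moreover have "curve_length Z \<gamma> = ennreal D"
  proof (rule antisym)
    show "curve_length Z \<gamma> \<le> ennreal D"
      unfolding curve_length_def
    proof (rule SUP_least, clarify)
      fix N and t :: "nat \<Rightarrow> real" assume t: "mono_on {..N} t" "t ` {..N} \<subseteq> {0..1}"
      have "(\<Sum>i<N. ennreal (mdist Z (\<gamma> (t i)) (\<gamma> (t (Suc i))))) = (\<Sum>i<N. ennreal ((t (Suc i) - t i) * D))"
      proof (rule sum.cong[OF refl])
        fix i assume i: "i \<in> {..<N}"
        then have "t i \<le> t (Suc i)" "t i \<in> {0..1}" "t (Suc i) \<in> {0..1}"
          using t by (auto intro!: mono_onD[OF t(1)] simp: image_subset_iff Suc_le_eq)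
        then show "ennreal (mdist Z (\<gamma> (t i)) (\<gamma> (t (Suc i)))) = ennreal ((t (Suc i) - t i) * D)"
          using dist[of "t i" "t (Suc i)"] by (simp add: abs_if)
      qed
      also have "\<dots> = ennreal (\<Sum>i<N. (t (Suc i) - t i) * D)"
      proof (rule sum_ennreal)
        fix i assume "i \<in> {..<N}"
        then have "t i \<le> t (Suc i)" by (auto intro!: mono_onD[OF t(1)])
        then show "0 \<le> (t (Suc i) - t i) * D" using D0 by simp
      qed
      also have "(\<Sum>i<N. (t (Suc i) - t i) * D) = (t N - t 0) * D"
        by (simp add: sum_lessThan_telescope flip: sum_distrib_right)
      also have "ennreal \<dots> \<le> ennreal D"
      proof (rule ennreal_leI)
        have "t N \<in> {0..1}" "t 0 \<in> {0..1}" using t(2) by blast+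
        then have "t N - t 0 \<le> 1" by simp
        then show "(t N - t 0) * D \<le> D" using D0 mult_right_mono[of "t N - t 0" 1 D] by simp
      qed
      finally show "(\<Sum>i<N. ennreal (mdist Z (\<gamma> (t i)) (\<gamma> (t (Suc i))))) \<le> ennreal D" .
    qed
    show "ennreal D \<le> curve_length Z \<gamma>"
      unfolding curve_length_def
      by (rule SUP_upper2[of "(1, \<lambda>i. real i)"]) (auto simp: mono_on_def ends D_def)
  qed
  ultimately show "\<exists>\<gamma>. pathin (mtopology_of Z) \<gamma> \<and> \<gamma> 0 = a \<and> \<gamma> 1 = b \<and>
        curve_length Z \<gamma> = ennreal (mdist Z a b)"
    using ends by (auto simp: pathin_def D_def)
qed

text \<open>Both half circles are connected sets that join \<open>a\<close> to \<open>b\<close>,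
so both contain the midpoint of \<open>a\<close> and \<open>b\<close>. The midpoint is unique, but
the half circles meet only in \<open>a\<close> and \<open>b\<close>.\<close>

lemma four_point_no_circle:
  assumes 4: "four_point Z" and S: "S \<subseteq> mspace Z"
    and homeo: "subtopology (mtopology_of Z) S homeomorphic_space top_of_set (sphere (0 :: complex) 1)"
  shows False
proof -
  let ?C = "top_of_set (sphere (0 :: complex) 1)"
  obtain f where f: "homeomorphic_map ?C (subtopology (mtopology_of Z) S) f"
    using homeo homeomorphic_space_sym homeomorphic_space by blast
  have cf: "continuous_map ?C (mtopology_of Z) f"
    using homeomorphic_imp_continuous_map[OF f] by (simp add: continuous_map_in_subtopology)
  have inj: "inj_on f (sphere 0 1)"
    using homeomorphic_imp_injective_map[OF f] by simp
  have conn: "connectedin (mtopology_of Z) (f ` cis ` I)" if "connected I" for I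
  proof (rule connectedin_continuous_map_image[OF cf])
    have "connected (cis ` I)"
      by (intro connected_continuous_image that) (auto intro!: continuous_intros simp: cis_conv_exp)
    then show "connectedin ?C (cis ` I)"
      by (auto simp: connectedin_subtopology)
  qed
  define a where "a = f 1" define b where "b = f (-1)"
  have M: "f z \<in> mspace Z" if "cmod z = 1" for z
    using cf that by (auto simp: continuous_map_def)
  have aM: "a \<in> mspace Z" and bM: "b \<in> mspace Z" using M by (auto simp: a_def b_def)
  have "a \<noteq> b"
  proof
    assume "a = b"
    then have "(1::complex) = -1" using inj_onD[OF inj, of 1 "-1"] by (simp add: a_def b_def)
    then show False by simp
  qed
  then have D: "mdist Z a b > 0" using aM bM by (simp add: less_le)
  have cis_ends: "cis 0 = 1" "cis pi = -1" "cis (-pi) = -1" by (auto simp: complex_eq_iff)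
  have ab1: "a \<in> f ` cis ` {0..pi}" "b \<in> f ` cis ` {0..pi}"
    unfolding a_def b_def
    by (rule imageI, rule image_eqI[where x=0], simp_all)
      (rule imageI, rule image_eqI[where x=pi], simp_all add: cis_ends)
  have ab2: "a \<in> f ` cis ` {-pi..0}" "b \<in> f ` cis ` {-pi..0}"
    unfolding a_def b_def
    by (rule imageI, rule image_eqI[where x=0], simp_all)
      (rule imageI, rule image_eqI[where x="-pi"], simp_all only: cis_ends, simp_all)
  have s: "0 \<le> mdist Z a b / 2" "mdist Z a b / 2 \<le> mdist Z a b" using D by auto
  obtain m where m: "m \<in> f ` cis ` {0..pi}" "mdist Z a m = mdist Z a b / 2"
     "mdist Z m b = mdist Z a b - mdist Z a b / 2"
    by (rule four_point_connected_between[OF 4 conn ab1 s]) auto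
  obtain m' where m': "m' \<in> f ` cis ` {-pi..0}" "mdist Z a m' = mdist Z a b / 2"
     "mdist Z m' b = mdist Z a b - mdist Z a b / 2"
    by (rule four_point_connected_between[OF 4 conn ab2 s]) auto
  have mM: "m \<in> mspace Z" "m' \<in> mspace Z" using m m' M by auto
  have "m = m'"
    using four_point_between_dist[OF 4 aM bM mM m(2,3) m'(2,3)] mM by simp
  then obtain u v where uv: "u \<in> {0..pi}" "v \<in> {-pi..0}" "m = f (cis u)" "f (cis u) = f (cis v)"
    using m(1) m'(1) by auto
  then have "cis u = cis v" using inj by (auto dest: inj_onD)
  then have "sin u = sin v" by (simp add: complex_eq_iff)
  moreover have "sin u \<ge> 0" using uv by (simp add: sin_ge_zero)
  moreover have "sin v \<le> 0" using uv sin_ge_zero[of "- v"] by simp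
  ultimately have s0: "sin u = 0" by linarith
  then have "cos u = 1 \<or> cos u = -1" using sin_cos_squared_add3[of u] by (simp add: square_eq_1_iff)
  then have "cis u = 1 \<or> cis u = -1" using s0 by (auto simp: complex_eq_iff)
  then have "m = a \<or> m = b" using uv by (auto simp: a_def b_def)
  then show False using m D aM bM by (auto simp: mdist_self)
qed

lemma four_point_connected_imp_metric_tree:
  assumes "four_point Z" "connected_space (mtopology_of Z)"
  shows "metric_tree Z"
  unfolding metric_tree_def
  using four_point_connected_geodesic[OF assms] four_point_no_circle[OF assms(1)] by blast

section \<open>Directional derivatives of Lipschitz maps almost everywhere\<close>

text \<open>By translation invariance the measure of \<open>E\<close> is the average over
\<open>t\<close> of the measures of \<open>E - t w\<close>; Fubini's theorem turns this into an
integral of measures of lines intersected with \<open>E\<close>.\<close>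

lemma null_sets_of_null_lines:
  fixes E :: "'a::euclidean_space set"
  assumes E[measurable]: "E \<in> sets borel" and lines: "\<And>x. negligible {t::real. x + t *\<^sub>R w \<in> E}"
  shows "E \<in> null_sets lborel"
proof -
  have P: "pair_sigma_finite (lborel :: 'a measure) (lborel :: real measure)"
    by (simp add: pair_sigma_finite_def sigma_finite_lborel)
  have shift: "(\<integral>\<^sup>+x. indicator E (x + v) \<partial>lborel) = emeasure lborel E" for v :: 'a
  proof -
    have "emeasure lborel E = (\<integral>\<^sup>+x. indicator E x \<partial>distr lborel borel ((+) v))"
      by (simp add: lborel_distr_plus)
    also have "\<dots> = (\<integral>\<^sup>+x. indicator E (v + x) \<partial>lborel)"
      by (subst nn_integral_distr) auto
    finally show ?thesis by (simp add: add.commute)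
  qed
  have "emeasure lborel E = (\<integral>\<^sup>+t. emeasure lborel E * indicator {0..1::real} t \<partial>lborel)"
    by (simp add: nn_integral_cmult)
  also have "\<dots> = (\<integral>\<^sup>+t. (\<integral>\<^sup>+x. indicator E (x + t *\<^sub>R w) * indicator {0..1::real} t \<partial>lborel) \<partial>lborel)"
    by (rule nn_integral_cong, subst nn_integral_multc) (auto simp: shift)
  also have "\<dots> = (\<integral>\<^sup>+x. (\<integral>\<^sup>+t. indicator E (x + t *\<^sub>R w) * indicator {0..1::real} t \<partial>lborel) \<partial>lborel)"
    by (rule pair_sigma_finite.Fubini'[OF P]) measurable
  also have "\<dots> = (\<integral>\<^sup>+x. 0 \<partial>(lborel :: 'a measure))"
  proof (rule nn_integral_cong)
    fix x :: 'a
    have m: "{t::real. x + t *\<^sub>R w \<in> E} \<in> sets borel" by measurable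
    have "{t::real. x + t *\<^sub>R w \<in> E} \<in> null_sets lborel"
      using lines[of x] m by (auto simp: negligible_iff_null_sets null_sets_def)
    then have "AE t in lborel. t \<notin> {t::real. x + t *\<^sub>R w \<in> E}" by (rule AE_not_in)
    then have "AE t in lborel. indicator E (x + t *\<^sub>R w) * indicator {0..1::real} t = (0::ennreal)"
      by eventually_elim auto
    then show "(\<integral>\<^sup>+t. indicator E (x + t *\<^sub>R w) * indicator {0..1::real} t \<partial>lborel) = 0"
      by (subst nn_integral_0_iff_AE) auto
  qed
  finally show ?thesis by (auto simp: null_sets_def)
qed

text \<open>A countable form of the Cauchy criterion. It makes the set of points at which a
difference quotient converges a Borel set, as needed for Fubini's theorem.\<close>

lemma limit_at_0_iff_rational_Cauchy:
  fixes q :: "real \<Rightarrow> real"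
  assumes cont: "\<And>h. h \<noteq> 0 \<Longrightarrow> isCont q h"
  shows "(\<exists>l. (q \<longlongrightarrow> l) (at 0)) \<longleftrightarrow>
    (\<forall>k::nat. \<exists>m::nat. \<forall>r r'::rat. r \<noteq> 0 \<and> \<bar>real_of_rat r\<bar> < 1 / (real m + 1) \<and> r' \<noteq> 0 \<and> \<bar>real_of_rat r'\<bar> < 1 / (real m + 1)
       \<longrightarrow> \<bar>q (of_rat r) - q (of_rat r')\<bar> \<le> 1 / (real k + 1))" (is "?L \<longleftrightarrow> ?R")
proof
  assume ?L
  then obtain l where l: "(q \<longlongrightarrow> l) (at 0)" by blast
  show ?R
  proof
    fix k :: nat
    define c where "c = 1 / (real k + 1)"
    have c2: "c / 2 > 0" by (simp add: c_def)
    then obtain d where d: "d > 0" "\<And>h. h \<noteq> 0 \<Longrightarrow> \<bar>h\<bar> < d \<Longrightarrow> \<bar>q h - l\<bar> < c / 2"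
      using LIM_D[OF l c2] by auto
    obtain m where "inverse (real (Suc m)) < d"
      using reals_Archimedean[OF d(1)] by blast
    then have m: "1 / (real m + 1) < d" by (simp add: inverse_eq_divide add.commute)
    have "\<bar>q (of_rat r) - q (of_rat r')\<bar> \<le> 1 / (real k + 1)"
      if "r \<noteq> 0" "\<bar>real_of_rat r\<bar> < 1 / (real m + 1)" "r' \<noteq> 0" "\<bar>real_of_rat r'\<bar> < 1 / (real m + 1)" for r r' :: rat
    proof -
      have "\<bar>q (of_rat r) - l\<bar> < c / 2"
        by (rule d(2)) (use that m in \<open>simp_all del: abs_of_rat\<close>)
      moreover have "\<bar>q (of_rat r') - l\<bar> < c / 2"
        by (rule d(2)) (use that m in \<open>simp_all del: abs_of_rat\<close>)
      ultimately show ?thesis unfolding c_def[symmetric] by linarith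
    qed
    then show "\<exists>m::nat. \<forall>r r'::rat. r \<noteq> 0 \<and> \<bar>real_of_rat r\<bar> < 1 / (real m + 1) \<and> r' \<noteq> 0 \<and> \<bar>real_of_rat r'\<bar> < 1 / (real m + 1)
       \<longrightarrow> \<bar>q (of_rat r) - q (of_rat r')\<bar> \<le> 1 / (real k + 1)" by (intro exI[of _ m] allI impI) blast
  qed
next
  assume R: ?R
  have approx: "\<exists>r::rat. r \<noteq> 0 \<and> \<bar>real_of_rat r\<bar> < b \<and> \<bar>q (of_rat r) - q h\<bar> < e"
    if h: "h \<noteq> 0" "\<bar>h\<bar> < b" and e: "e > 0" for h b e
  proof -
    obtain d where d: "d > 0" "\<And>y. \<bar>y - h\<bar> < d \<Longrightarrow> \<bar>q y - q h\<bar> < e"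
      using cont[OF h(1)] e unfolding continuous_at_eps_delta dist_real_def by blast
    define d' where "d' = min d (min \<bar>h\<bar> (b - \<bar>h\<bar>))"
    have "d' > 0" using d h by (auto simp: d'_def)
    then obtain y where y: "y \<in> \<rat>" "h < y" "y < h + d'"
      using Rats_dense_in_real[of h "h + d'"] by auto
    then obtain r where r: "y = of_rat r" by (auto elim: Rats_cases)
    have "\<bar>y - h\<bar> < d'" using y by auto
    then have "\<bar>y - h\<bar> < d" "\<bar>y - h\<bar> < \<bar>h\<bar>" "\<bar>y - h\<bar> < b - \<bar>h\<bar>" by (auto simp: d'_def)
    then have "y \<noteq> 0" "\<bar>y\<bar> < b" "\<bar>q y - q h\<bar> < e" using d(2)[of y] by auto
    then show ?thesis using r by (intro exI[of _ r]) auto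
  qed
  have C: "\<exists>m::nat. \<forall>h h'. h \<noteq> 0 \<and> \<bar>h\<bar> < 1 / (real m + 1) \<and> h' \<noteq> 0 \<and> \<bar>h'\<bar> < 1 / (real m + 1) \<longrightarrow> \<bar>q h - q h'\<bar> < e"
    if e: "e > 0" for e
  proof -
    have "e / 3 > 0" using e by simp
    then obtain k :: nat where "inverse (real (Suc k)) < e / 3"
      using reals_Archimedean by blast
    then have k: "1 / (real k + 1) < e / 3" by (simp add: inverse_eq_divide add.commute)
    obtain m :: nat where m: "\<forall>r r'::rat. r \<noteq> 0 \<and> \<bar>real_of_rat r\<bar> < 1 / (real m + 1) \<and> r' \<noteq> 0 \<and> \<bar>real_of_rat r'\<bar> < 1 / (real m + 1)
       \<longrightarrow> \<bar>q (of_rat r) - q (of_rat r')\<bar> \<le> 1 / (real k + 1)"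
      using R[rule_format, of k] by (elim exE) (rule that)
    have "\<bar>q h - q h'\<bar> < e"
      if h: "h \<noteq> 0" "\<bar>h\<bar> < 1 / (real m + 1)" "h' \<noteq> 0" "\<bar>h'\<bar> < 1 / (real m + 1)" for h h'
    proof -
      have e3: "e / 3 > 0" using e by simp
      obtain r where r: "r \<noteq> 0" "\<bar>real_of_rat r\<bar> < 1 / (real m + 1)" "\<bar>q (of_rat r) - q h\<bar> < e / 3"
        using approx[OF h(1,2) e3] by blast
      obtain r' where r': "r' \<noteq> 0" "\<bar>real_of_rat r'\<bar> < 1 / (real m + 1)" "\<bar>q (of_rat r') - q h'\<bar> < e / 3"
        using approx[OF h(3,4) e3] by blast
      have "\<bar>q (of_rat r) - q (of_rat r')\<bar> \<le> 1 / (real k + 1)"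
        using m[rule_format, of r r'] r(1,2) r'(1,2) by simp
      then show ?thesis using r(3) r'(3) k by linarith
    qed
    then show ?thesis by blast
  qed
  define t where "t = (\<lambda>j::nat. 1 / (real j + 2))"
  have t: "t j \<noteq> 0" "\<bar>t j\<bar> < 1 / (real m + 1)" if "j \<ge> m" for j m
    using that by (auto simp: t_def field_simps)
  have "Cauchy (\<lambda>j. q (t j))"
  proof (rule metric_CauchyI)
    fix e :: real assume "e > 0"
    obtain m :: nat where "\<forall>h h'. h \<noteq> 0 \<and> \<bar>h\<bar> < 1 / (real m + 1) \<and> h' \<noteq> 0 \<and> \<bar>h'\<bar> < 1 / (real m + 1) \<longrightarrow> \<bar>q h - q h'\<bar> < e"
      using C[OF \<open>e > 0\<close>] by (elim exE) (rule that)
    then show "\<exists>N. \<forall>i\<ge>N. \<forall>j\<ge>N. dist (q (t i)) (q (t j)) < e"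
      using t by (intro exI[of _ m]) (auto simp: dist_real_def)
  qed
  then obtain l where l: "(\<lambda>j. q (t j)) \<longlonglongrightarrow> l"
    using Cauchy_convergent convergent_def by blast
  have "(q \<longlongrightarrow> l) (at 0)"
  proof (rule LIM_I)
    fix e :: real assume e: "e > 0"
    then have "e / 2 > 0" by simp
    obtain m :: nat where m: "\<forall>h h'. h \<noteq> 0 \<and> \<bar>h\<bar> < 1 / (real m + 1) \<and> h' \<noteq> 0 \<and> \<bar>h'\<bar> < 1 / (real m + 1) \<longrightarrow> \<bar>q h - q h'\<bar> < e / 2"
      using C[OF \<open>e / 2 > 0\<close>] by (elim exE) (rule that)
    obtain N where N: "\<And>j. j \<ge> N \<Longrightarrow> \<bar>q (t j) - l\<bar> < e / 2"
      using LIMSEQ_D[OF l \<open>e / 2 > 0\<close>] by auto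
    have "\<bar>q h - l\<bar> < e" if "h \<noteq> 0" "\<bar>h\<bar> < 1 / (real m + 1)" for h
    proof -
      have "\<bar>q h - q (t (max m N))\<bar> < e / 2"
        using m[rule_format, of h "t (max m N)"] that t[of m "max m N"] by simp
      moreover have "\<bar>q (t (max m N)) - l\<bar> < e / 2" using N[of "max m N"] by simp
      ultimately show ?thesis by linarith
    qed
    then show "\<exists>s>0. \<forall>x. x \<noteq> 0 \<and> norm (x - 0) < s \<longrightarrow> norm (q x - l) < e"
      by (intro exI[of _ "1 / (real m + 1)"]) auto
  qed
  then show ?L by blast
qed

locale lipschitz_into =
  fixes M :: "'b metric" and F :: "'a::euclidean_space \<Rightarrow> 'b" and L :: real
  assumes in_space [simp]: "F x \<in> mspace M"
    and lip: "mdist M (F x) (F y) \<le> L * norm (x - y)"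
begin

lemma L_nonneg: "0 \<le> L"
proof -
  have "0 \<le> L * norm (One - 0 :: 'a)" using order_trans[OF mdist_nonneg lip] by blast
  then show ?thesis by (simp add: zero_le_mult_iff)
qed

lemma tri: "mdist M (F x) (F z) \<le> mdist M (F x) (F y) + mdist M (F y) (F z)"
  by (rule mdist_triangle) auto

lemma mdist_diff_le: "\<bar>mdist M (F x) (F y) - mdist M (F x') (F y')\<bar> \<le> L * norm (x - x') + L * norm (y - y')"
  using tri[of x y x'] tri[of x' y y'] tri[of x' y' x] tri[of x y' y] lip[of x x'] lip[of y y']
  by (auto simp: mdist_commute abs_le_iff)

lemma continuous_mdist:
  assumes "continuous_on S f" "continuous_on S g"
  shows "continuous_on S (\<lambda>x. mdist M (F (f x)) (F (g x)))"
proof -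
  have "continuous_on UNIV (\<lambda>p. mdist M (F (fst p)) (F (snd p)))"
  proof (rule lipschitz_on_continuous_on[of "2 * L"], rule lipschitz_onI)
    fix p p' :: "'a \<times> 'a"
    have "\<bar>mdist M (F (fst p)) (F (snd p)) - mdist M (F (fst p')) (F (snd p'))\<bar>
       \<le> L * norm (fst p - fst p') + L * norm (snd p - snd p')" by (rule mdist_diff_le)
    also have "\<dots> \<le> L * norm (p - p') + L * norm (p - p')"
      using norm_fst_le[of "fst (p - p')" "snd (p - p')"] norm_snd_le[of "snd (p - p')" "fst (p - p')"] L_nonneg
      by (intro add_mono mult_left_mono) (auto simp: minus_prod_def)
    finally show "dist (mdist M (F (fst p)) (F (snd p))) (mdist M (F (fst p')) (F (snd p'))) \<le> 2 * L * dist p p'"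
      by (simp add: dist_norm)
  qed (use L_nonneg in simp)
  from continuous_on_compose2[OF this continuous_on_Pair[OF assms]] show ?thesis by simp
qed

lemma directional_speed_exists_AE:
  "AE x in lborel. \<exists>l. ((\<lambda>h. mdist M (F (x + h *\<^sub>R w)) (F x) / \<bar>h\<bar>) \<longlongrightarrow> l) (at 0)"
proof -
  define q where "q = (\<lambda>x h. mdist M (F (x + h *\<^sub>R w)) (F x) / \<bar>h\<bar>)"
  define G where "G = {x. \<exists>l. (q x \<longlongrightarrow> l) (at 0)}"
  have cont: "isCont (q x) h" if "h \<noteq> 0" for x h
  proof -
    have "continuous_on (- {0}) (q x)" unfolding q_def
      by (intro continuous_on_divide continuous_mdist continuous_intros) auto
    then show ?thesis using that by (simp add: continuous_on_eq_continuous_at open_Compl)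
  qed
  have qm[measurable]: "(\<lambda>x. q x h) \<in> borel_measurable borel" for h
    by (rule borel_measurable_continuous_onI, unfold q_def divide_inverse)
       (intro continuous_on_mult continuous_mdist continuous_intros)
  have "G = {x. \<forall>k::nat. \<exists>m::nat. \<forall>r r'::rat. r \<noteq> 0 \<and> \<bar>real_of_rat r\<bar> < 1 / (real m + 1) \<and> r' \<noteq> 0 \<and> \<bar>real_of_rat r'\<bar> < 1 / (real m + 1)
       \<longrightarrow> \<bar>q x (of_rat r) - q x (of_rat r')\<bar> \<le> 1 / (real k + 1)}"
    unfolding G_def by (subst limit_at_0_iff_rational_Cauchy[OF cont]) auto
  also have "\<dots> \<in> sets borel" by measurable
  finally have G: "G \<in> sets borel" .
  have "- G \<in> null_sets lborel"
  proof (rule null_sets_of_null_lines)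
    show "- G \<in> sets borel" using G by auto
    fix x
    obtain N where N: "negligible N"
      "\<And>t. t \<notin> N \<Longrightarrow> \<exists>l. ((\<lambda>h. mdist M (F (x + (t + h) *\<^sub>R w)) (F (x + t *\<^sub>R w)) / \<bar>h\<bar>) \<longlongrightarrow> l) (at 0)"
    proof (rule metric_speed_exists_ae[of "\<lambda>t. F (x + t *\<^sub>R w)" M "L * norm w"])
      fix s t :: real
      have "mdist M (F (x + s *\<^sub>R w)) (F (x + t *\<^sub>R w)) \<le> L * norm ((x + s *\<^sub>R w) - (x + t *\<^sub>R w))" by (rule lip)
      also have "(x + s *\<^sub>R w) - (x + t *\<^sub>R w) = (s - t) *\<^sub>R w" by (simp add: algebra_simps)
      finally show "mdist M (F (x + s *\<^sub>R w)) (F (x + t *\<^sub>R w)) \<le> L * norm w * \<bar>s - t\<bar>"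
        by (simp add: mult_ac)
    qed auto
    have "{t. x + t *\<^sub>R w \<in> - G} \<subseteq> N"
      using N(2) by (auto simp: G_def q_def algebra_simps)
    then show "negligible {t. x + t *\<^sub>R w \<in> - G}" using N(1) by (rule negligible_subset[rotated])
  qed
  then have "AE x in lborel. x \<notin> - G" by (rule AE_not_in)
  then show ?thesis by eventually_elim (auto simp: G_def q_def)
qed

end

lemma real_lipschitz_into:
  fixes a :: "'a::euclidean_space \<Rightarrow> real"
  assumes "\<And>x y. \<bar>a x - a y\<bar> \<le> K * norm (x - y)"
  shows "lipschitz_into euclidean_metric a K"
  by standard (use assms in \<open>auto simp: dist_real_def\<close>)

text \<open>For a function that increases along \<open>w\<close> the distance quotient is the
difference quotient. A suitable linear function is added to reach this case.\<close>

lemma directional_derivative_exists_AE: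
  fixes a :: "'a::euclidean_space \<Rightarrow> real"
  assumes a: "\<And>x y. \<bar>a x - a y\<bar> \<le> K * norm (x - y)"
  shows "AE x in lborel. \<exists>l. ((\<lambda>h. (a (x + h *\<^sub>R w) - a x) / h) \<longlongrightarrow> l) (at 0)"
proof (cases "w = 0")
  case True
  then show ?thesis by (auto intro!: exI[of _ 0])
next
  case False
  have K0: "K \<ge> 0" using lipschitz_into.L_nonneg[OF real_lipschitz_into[OF a]] .
  \<comment> \<open>This slope makes \<open>g\<close> nondecreasing along \<open>w\<close>.\<close>
  define c where "c = K / norm w"
  define g where "g = (\<lambda>x. a x + c * (x \<bullet> w))"
  have c0: "c \<ge> 0" using K0 by (simp add: c_def)
  have g: "\<bar>g x - g y\<bar> \<le> (K + c * norm w) * norm (x - y)" for x y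
  proof -
    have "\<bar>(x - y) \<bullet> w\<bar> \<le> norm (x - y) * norm w" by (rule Cauchy_Schwarz_ineq2)
    then have "c * \<bar>(x - y) \<bullet> w\<bar> \<le> c * (norm (x - y) * norm w)" using c0 by (rule mult_left_mono)
    moreover have "g x - g y = (a x - a y) + c * ((x - y) \<bullet> w)" by (simp add: g_def algebra_simps)
    moreover have "\<bar>c * ((x - y) \<bullet> w)\<bar> = c * \<bar>(x - y) \<bullet> w\<bar>" using c0 by (simp add: abs_mult)
    ultimately show ?thesis using a[of x y] by (simp add: algebra_simps)
  qed
  have eq: "(a (x + h *\<^sub>R w) - a x) / h = mdist euclidean_metric (g (x + h *\<^sub>R w)) (g x) / \<bar>h\<bar> - K * norm w"
    if h: "h \<noteq> 0" for x h
  proof -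
    have cw: "c * (w \<bullet> w) = K * norm w" using False by (simp add: c_def dot_square_norm power2_eq_square)
    have d: "g (x + h *\<^sub>R w) - g x = (a (x + h *\<^sub>R w) - a x) + h * (K * norm w)"
      by (simp add: g_def algebra_simps flip: cw)
    have ab: "\<bar>a (x + h *\<^sub>R w) - a x\<bar> \<le> K * norm w * \<bar>h\<bar>"
      using a[of "x + h *\<^sub>R w" x] by (simp add: mult_ac)
    show ?thesis
    proof (cases "h > 0")
      case True
      then have "\<bar>g (x + h *\<^sub>R w) - g x\<bar> = (a (x + h *\<^sub>R w) - a x) + h * (K * norm w)"
        unfolding d using ab by (simp add: abs_le_iff mult_ac)
      then show ?thesis using True by (simp add: dist_real_def field_simps)
    next
      case False
      then have "\<bar>g (x + h *\<^sub>R w) - g x\<bar> = - ((a (x + h *\<^sub>R w) - a x) + h * (K * norm w))"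
        unfolding d using ab h by (simp add: abs_le_iff mult_ac)
      then show ?thesis using False h by (simp add: dist_real_def field_simps)
    qed
  qed
  from lipschitz_into.directional_speed_exists_AE[OF real_lipschitz_into[OF g], of w]
  show ?thesis
  proof eventually_elim
    case (elim x)
    then obtain l where l: "((\<lambda>h. mdist euclidean_metric (g (x + h *\<^sub>R w)) (g x) / \<bar>h\<bar>) \<longlongrightarrow> l) (at 0)" by blast
    from tendsto_diff[OF l tendsto_const[of "K * norm w"]]
    have "((\<lambda>h. (a (x + h *\<^sub>R w) - a x) / h) \<longlongrightarrow> l - K * norm w) (at 0)"
      by (rule Lim_transform_eventually) (auto simp: eventually_at_filter eq)
    then show ?case by blast
  qed
qed

section \<open>Local convergence in \<open>L\<^sup>1\<close> and translations\<close>

lemma cball_in_borel [measurable]: "cball c r \<in> sets borel"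
  by simp

text \<open>Convergence in \<open>L\<^sup>1\<close> on balls. Integrals with values in the
extended nonnegative reals spare all integrability conditions.\<close>

definition L1_conv :: "(nat \<Rightarrow> 'a::euclidean_space \<Rightarrow> real) \<Rightarrow> ('a \<Rightarrow> real) \<Rightarrow> bool" where
  "L1_conv q s \<longleftrightarrow> (\<forall>j. q j \<in> borel_measurable borel) \<and> s \<in> borel_measurable borel \<and>
    (\<forall>r. (\<lambda>j. \<integral>\<^sup>+x. ennreal \<bar>q j x - s x\<bar> * indicator (cball 0 r) x \<partial>lborel) \<longlonglongrightarrow> 0)"

lemma L1_convI_AE:
  fixes q :: "nat \<Rightarrow> 'a::euclidean_space \<Rightarrow> real"
  assumes [measurable]: "\<And>j. q j \<in> borel_measurable borel" "s \<in> borel_measurable borel"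
    and bound: "\<And>j x. \<bar>q j x\<bar> \<le> C" and lim: "AE x in lborel. (\<lambda>j. q j x) \<longlonglongrightarrow> s x"
  shows "L1_conv q s"
  unfolding L1_conv_def
proof (intro conjI allI)
  fix r :: real
  let ?B = "cball 0 r :: 'a set"
  have C0: "C \<ge> 0" using bound[of 0 0] by linarith
  have "(\<lambda>j. \<integral>\<^sup>+x. ennreal \<bar>q j x - s x\<bar> * indicator ?B x \<partial>lborel) \<longlonglongrightarrow> (\<integral>\<^sup>+x. 0 \<partial>(lborel :: 'a measure))"
  proof (rule nn_integral_dominated_convergence[where w = "\<lambda>x. ennreal (2 * C) * indicator ?B x"])
    show "AE x in lborel. ennreal \<bar>q j x - s x\<bar> * indicator ?B x \<le> ennreal (2 * C) * indicator ?B x" for j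
      using lim
    proof eventually_elim
      case (elim x)
      have "\<bar>s x\<bar> \<le> C"
        by (rule tendsto_upperbound[OF tendsto_rabs[OF elim]]) (use bound in auto)
      then have "\<bar>q j x - s x\<bar> \<le> 2 * C" using bound[of j x] by linarith
      then show ?case by (auto simp: indicator_def intro: ennreal_leI)
    qed
    show "(\<integral>\<^sup>+x. ennreal (2 * C) * indicator ?B x \<partial>lborel) < \<infinity>"
      using emeasure_bounded_finite[OF bounded_cball[of "0::'a" r]]
      by (simp add: nn_integral_cmult ennreal_mult_less_top)
    show "AE x in lborel. (\<lambda>j. ennreal \<bar>q j x - s x\<bar> * indicator ?B x) \<longlonglongrightarrow> 0"
      using lim
    proof eventually_elim
      case (elim x)
      have "(\<lambda>j. \<bar>q j x - s x\<bar>) \<longlonglongrightarrow> 0"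
        using tendsto_rabs[OF tendsto_diff[OF elim tendsto_const[of "s x"]]] by simp
      then have "(\<lambda>j. ennreal \<bar>q j x - s x\<bar>) \<longlonglongrightarrow> ennreal 0" by (rule tendsto_ennrealI)
      then show ?case by (auto simp: indicator_def)
    qed
  qed measurable
  then show "(\<lambda>j. \<integral>\<^sup>+x. ennreal \<bar>q j x - s x\<bar> * indicator ?B x \<partial>lborel) \<longlonglongrightarrow> 0" by simp
qed auto

lemma L1_conv_dominated:
  fixes p q Q :: "nat \<Rightarrow> 'a::euclidean_space \<Rightarrow> real"
  assumes p: "L1_conv p s" and q: "L1_conv q t"
    and [measurable]: "\<And>j. Q j \<in> borel_measurable borel" "S \<in> borel_measurable borel"
    and le: "\<And>j x. \<bar>Q j x - S x\<bar> \<le> \<bar>p j x - s x\<bar> + \<bar>q j x - t x\<bar>"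
  shows "L1_conv Q S"
  unfolding L1_conv_def
proof (intro conjI allI)
  fix r :: real
  have [measurable]: "\<And>j. p j \<in> borel_measurable borel" "s \<in> borel_measurable borel"
    "\<And>j. q j \<in> borel_measurable borel" "t \<in> borel_measurable borel"
    using p q by (auto simp: L1_conv_def)
  let ?I = "\<lambda>q s j. \<integral>\<^sup>+x. ennreal \<bar>q j x - s x\<bar> * indicator (cball 0 r :: 'a set) x \<partial>lborel"
  have le': "?I Q S j \<le> ?I p s j + ?I q t j" for j
  proof -
    have "?I Q S j \<le> (\<integral>\<^sup>+x. ennreal \<bar>p j x - s x\<bar> * indicator (cball 0 r :: 'a set) x +
        ennreal \<bar>q j x - t x\<bar> * indicator (cball 0 r :: 'a set) x \<partial>lborel)"
      by (rule nn_integral_mono) (use le in \<open>auto simp: indicator_def simp flip: ennreal_plus intro: ennreal_leI\<close>)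
    also have "\<dots> = ?I p s j + ?I q t j" by (rule nn_integral_add) measurable
    finally show ?thesis .
  qed
  have "(\<lambda>j. ?I p s j + ?I q t j) \<longlonglongrightarrow> 0 + 0"
    using p q by (intro tendsto_add) (auto simp: L1_conv_def)
  then have "(\<lambda>j. ?I p s j + ?I q t j) \<longlonglongrightarrow> 0" by simp
  then show "?I Q S \<longlonglongrightarrow> 0"
    by (rule tendsto_sandwich[OF _ _ tendsto_const, rotated -1]) (auto simp: le')
qed auto

lemma L1_conv_measurable:
  assumes "L1_conv q s" shows "q j \<in> borel_measurable borel" "s \<in> borel_measurable borel"
  using assms by (auto simp: L1_conv_def)

lemma L1_conv_add:
  assumes "L1_conv p s" "L1_conv q t"
  shows "L1_conv (\<lambda>j x. p j x + q j x) (\<lambda>x. s x + t x)"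
  using L1_conv_measurable[OF assms(1)] L1_conv_measurable[OF assms(2)]
  by (intro L1_conv_dominated[OF assms]) (auto intro!: borel_measurable_add)

lemma L1_conv_max:
  assumes "L1_conv p s" "L1_conv q t"
  shows "L1_conv (\<lambda>j x. max (p j x) (q j x)) (\<lambda>x. max (s x) (t x))"
  using L1_conv_measurable[OF assms(1)] L1_conv_measurable[OF assms(2)]
  by (intro L1_conv_dominated[OF assms]) (auto intro!: borel_measurable_max simp: max_def)

text \<open>Pointwise inequalities between the approximants survive in the limit. All almost
everywhere relations between directional derivatives are obtained from this lemma.\<close>

lemma L1_conv_le_AE:
  fixes p q :: "nat \<Rightarrow> 'a::euclidean_space \<Rightarrow> real"
  assumes p: "L1_conv p s" and q: "L1_conv q t" and le: "\<And>j x. p j x \<le> q j x"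
  shows "AE x in lborel. s x \<le> t x"
proof -
  have [measurable]: "\<And>j. p j \<in> borel_measurable borel" "s \<in> borel_measurable borel"
    "\<And>j. q j \<in> borel_measurable borel" "t \<in> borel_measurable borel"
    using p q by (auto simp: L1_conv_def)
  have "AE x in lborel. x \<in> cball 0 (real n) \<longrightarrow> s x \<le> t x" for n
  proof -
    let ?I = "\<lambda>q s j. \<integral>\<^sup>+x. ennreal \<bar>q j x - s x\<bar> * indicator (cball 0 (real n) :: 'a set) x \<partial>lborel"
    let ?J = "\<integral>\<^sup>+x. ennreal (max 0 (s x - t x)) * indicator (cball 0 (real n) :: 'a set) x \<partial>lborel"
    have le': "?J \<le> ?I p s j + ?I q t j" for j
    proof -
      have "?J \<le> (\<integral>\<^sup>+x. ennreal \<bar>p j x - s x\<bar> * indicator (cball 0 (real n) :: 'a set) x +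
          ennreal \<bar>q j x - t x\<bar> * indicator (cball 0 (real n) :: 'a set) x \<partial>lborel)"
      proof (rule nn_integral_mono)
        fix x
        have "max 0 (s x - t x) \<le> \<bar>p j x - s x\<bar> + \<bar>q j x - t x\<bar>" using le[of j x] by (auto simp: max_def)
        then show "ennreal (max 0 (s x - t x)) * indicator (cball 0 (real n)) x
          \<le> ennreal \<bar>p j x - s x\<bar> * indicator (cball 0 (real n)) x + ennreal \<bar>q j x - t x\<bar> * indicator (cball 0 (real n)) x"
          by (auto simp: indicator_def simp flip: ennreal_plus intro: ennreal_leI)
      qed
      also have "\<dots> = ?I p s j + ?I q t j" by (rule nn_integral_add) measurable
      finally show ?thesis .
    qed
    have "(\<lambda>j. ?I p s j + ?I q t j) \<longlonglongrightarrow> 0 + 0"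
      using p q by (intro tendsto_add) (auto simp: L1_conv_def)
    then have "?J \<le> 0 + 0" by (rule LIMSEQ_le_const) (use le' in auto)
    then have "AE x in lborel. ennreal (max 0 (s x - t x)) * indicator (cball 0 (real n) :: 'a set) x = 0"
      by (subst nn_integral_0_iff_AE[symmetric]) (simp_all del: mult_eq_0_iff)
    then show ?thesis
      by eventually_elim (auto simp: indicator_def ennreal_eq_0_iff max_def split: if_splits)
  qed
  then have "AE x in lborel. \<forall>n::nat. x \<in> cball 0 (real n) \<longrightarrow> s x \<le> t x"
    unfolding AE_all_countable by blast
  then show ?thesis
  proof eventually_elim
    case (elim x)
    obtain n where "norm x \<le> real n" using real_arch_simple by blast
    then show ?case using elim by auto
  qed
qed

lemma nn_integral_shift:
  fixes f :: "'a::euclidean_space \<Rightarrow> ennreal"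
  assumes [measurable]: "f \<in> borel_measurable borel"
  shows "(\<integral>\<^sup>+x. f (x + v) \<partial>lborel) = (\<integral>\<^sup>+x. f x \<partial>lborel)"
proof -
  have "(\<integral>\<^sup>+x. f x \<partial>lborel) = (\<integral>\<^sup>+x. f x \<partial>distr lborel borel ((+) v))"
    by (simp add: lborel_distr_plus)
  also have "\<dots> = (\<integral>\<^sup>+x. f (v + x) \<partial>lborel)"
    by (subst nn_integral_distr) auto
  finally show ?thesis by (simp add: add.commute)
qed

text \<open>Translation is continuous in \<open>L\<^sup>1\<close>. The continuous functions by
which \<open>s\<close> is approximated in the usual proof are here the \<open>q k\<close>
themselves: compare \<open>q j (x + v)\<close> with \<open>q k (x + v)\<close>, this with \<open>q
k x\<close>, and that with \<open>s x\<close>.\<close>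

lemma L1_conv_shift_uniform:
  fixes q :: "nat \<Rightarrow> 'a::euclidean_space \<Rightarrow> real"
  assumes q: "L1_conv q s" and lip: "\<And>k x y. \<bar>q k x - q k y\<bar> \<le> A k * norm (x - y)" and d: "0 < d"
  obtains \<delta> J where "\<delta> > 0" "\<And>j v. J \<le> j \<Longrightarrow> norm v < \<delta> \<Longrightarrow>
     (\<integral>\<^sup>+x. ennreal \<bar>q j (x + v) - s x\<bar> * indicator (cball 0 r) x \<partial>lborel) < d"
proof -
  have [measurable]: "\<And>j. q j \<in> borel_measurable borel" "s \<in> borel_measurable borel"
    using q by (auto simp: L1_conv_def)
  let ?B = "cball 0 r :: 'a set" and ?B' = "cball 0 (r + 1) :: 'a set"
  let ?I = "\<lambda>B f. \<integral>\<^sup>+x. ennreal \<bar>f x\<bar> * indicator (B :: 'a set) x \<partial>lborel"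
  let ?e = "\<lambda>k. ?I ?B' (\<lambda>x. q k x - s x)"
  have e: "?e \<longlonglongrightarrow> 0" using q by (auto simp: L1_conv_def)
  have tri: "?I ?B (\<lambda>x. q j (x + v) - s x)
     \<le> ?e j + ?e k + (ennreal (A k * norm v) * emeasure lborel ?B + ?e k)" if nv: "norm v \<le> 1" for j k v
  proof -
    define c where "c = A k * norm v"
    define f1 where "f1 = (\<lambda>x. ennreal \<bar>q j (x + v) - s (x + v)\<bar> * indicator ?B' (x + v))"
    define f2 where "f2 = (\<lambda>x. ennreal \<bar>q k (x + v) - s (x + v)\<bar> * indicator ?B' (x + v))"
    define f3 where "f3 = (\<lambda>x. ennreal c * indicator ?B x)"
    define f4 where "f4 = (\<lambda>x. ennreal \<bar>q k x - s x\<bar> * indicator ?B' x)"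
    have "?I ?B (\<lambda>x. q j (x + v) - s x) \<le> (\<integral>\<^sup>+x. (f1 x + f2 x) + (f3 x + f4 x) \<partial>lborel)"
    proof (rule nn_integral_mono)
      fix x
      show "ennreal \<bar>q j (x + v) - s x\<bar> * indicator ?B x \<le> (f1 x + f2 x) + (f3 x + f4 x)"
      proof (cases "x \<in> ?B")
        case True
        then have "norm (x + v) \<le> r + 1" using norm_triangle_ineq[of x v] nv by simp
        then have "x + v \<in> ?B'" "x \<in> ?B'" using True by auto
        moreover have qk: "\<bar>q k (x + v) - q k x\<bar> \<le> c"
          using lip[of k "x + v" x] by (simp add: c_def)
        have ab: "\<bar>q j (x + v) - s x\<bar> \<le> (\<bar>q j (x + v) - s (x + v)\<bar> + \<bar>q k (x + v) - s (x + v)\<bar>)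
            + (c + \<bar>q k x - s x\<bar>)" "0 \<le> c"
          using qk by linarith+
        have "ennreal \<bar>q j (x + v) - s x\<bar> \<le> (ennreal \<bar>q j (x + v) - s (x + v)\<bar> + ennreal \<bar>q k (x + v) - s (x + v)\<bar>)
            + (ennreal c + ennreal \<bar>q k x - s x\<bar>)"
          using ennreal_leI[OF ab(1)] ab(2) by (simp add: ennreal_plus)
        ultimately show ?thesis using True by (simp add: f1_def f2_def f3_def f4_def del: mem_cball)
      qed (simp add: indicator_def)
    qed
    also have "\<dots> = (\<integral>\<^sup>+x. f1 x + f2 x \<partial>lborel) + (\<integral>\<^sup>+x. f3 x + f4 x \<partial>lborel)"
      unfolding f1_def f2_def f3_def f4_def by (rule nn_integral_add) measurable
    also have "(\<integral>\<^sup>+x. f1 x + f2 x \<partial>lborel) = (\<integral>\<^sup>+x. f1 x \<partial>lborel) + (\<integral>\<^sup>+x. f2 x \<partial>lborel)"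
      unfolding f1_def f2_def by (rule nn_integral_add) measurable
    also have "(\<integral>\<^sup>+x. f3 x + f4 x \<partial>lborel) = (\<integral>\<^sup>+x. f3 x \<partial>lborel) + ?e k"
      unfolding f3_def f4_def by (rule nn_integral_add) measurable
    also have "(\<integral>\<^sup>+x. f1 x \<partial>lborel) = ?e j"
      unfolding f1_def by (rule nn_integral_shift) measurable
    also have "(\<integral>\<^sup>+x. f2 x \<partial>lborel) = ?e k"
      unfolding f2_def by (rule nn_integral_shift) measurable
    also have "(\<integral>\<^sup>+x. f3 x \<partial>lborel) = ennreal c * emeasure lborel ?B"
      unfolding f3_def by (rule nn_integral_cmult_indicator) auto
    finally show ?thesis unfolding c_def .
  qed
  obtain d' where d': "0 < d'" "d' < d" using dense[OF d] by blast
  have "((\<lambda>k. 0 + ?e k + (0 + ?e k)) \<longlongrightarrow> 0 + 0 + (0 + 0)) sequentially"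
    by (intro tendsto_add e tendsto_const)
  then have "((\<lambda>k. 0 + ?e k + (0 + ?e k)) \<longlongrightarrow> 0) sequentially" by simp
  from order_tendstoD(2)[OF this d] obtain k where k: "0 + ?e k + (0 + ?e k) < d"
    by (auto simp: eventually_sequentially)
  have "(\<lambda>n. 0 + ?e k + (emeasure lborel ?B * ennreal (1 / Suc n) + ?e k)) \<longlonglongrightarrow> 0 + ?e k + (emeasure lborel ?B * 0 + ?e k)"
  proof (intro tendsto_add tendsto_const ennreal_tendsto_cmult)
    show "emeasure lborel ?B < top" using emeasure_bounded_finite[OF bounded_cball[of "0::'a" r]] by simp
    have "(\<lambda>j. ennreal (1 / Suc j)) \<longlonglongrightarrow> ennreal 0"
      using LIMSEQ_inverse_real_of_nat by (intro tendsto_ennrealI) (simp add: inverse_eq_divide)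
    then show "(\<lambda>j. ennreal (1 / Suc j)) \<longlonglongrightarrow> 0" by simp
  qed
  then have "\<forall>\<^sub>F n in sequentially. 0 + ?e k + (emeasure lborel ?B * ennreal (1 / Suc n) + ?e k) < d"
    by (rule order_tendstoD(2)) (use k in simp)
  then obtain n where n: "0 + ?e k + (emeasure lborel ?B * ennreal (1 / Suc n) + ?e k) < d"
    by (auto simp: eventually_sequentially)
  have "(\<lambda>j. ?e j + ?e k + (emeasure lborel ?B * ennreal (1 / Suc n) + ?e k)) \<longlonglongrightarrow> 0 + ?e k + (emeasure lborel ?B * ennreal (1 / Suc n) + ?e k)"
    by (intro tendsto_add e tendsto_const)
  then have "\<forall>\<^sub>F j in sequentially. ?e j + ?e k + (emeasure lborel ?B * ennreal (1 / Suc n) + ?e k) < d"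
    by (rule order_tendstoD(2)[OF _ n])
  then obtain J where J: "\<And>j. j \<ge> J \<Longrightarrow> ?e j + ?e k + (emeasure lborel ?B * ennreal (1 / Suc n) + ?e k) < d"
    by (auto simp: eventually_sequentially)
  define \<delta> where "\<delta> = min 1 (1 / (real (Suc n) * (\<bar>A k\<bar> + 1)))"
  have "\<delta> > 0" by (simp add: \<delta>_def)
  moreover have "?I ?B (\<lambda>x. q j (x + v) - s x) < d" if j: "j \<ge> J" and v: "norm v < \<delta>" for j v
  proof -
    have "norm v \<le> 1 / (real (Suc n) * (\<bar>A k\<bar> + 1))" using v by (simp add: \<delta>_def)
    then have "(\<bar>A k\<bar> + 1) * norm v \<le> (\<bar>A k\<bar> + 1) * (1 / (real (Suc n) * (\<bar>A k\<bar> + 1)))"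
      by (rule mult_left_mono) simp
    also have "\<dots> = 1 / Suc n"
    proof -
      have "B * (1 / (C * B)) = 1 / C" if "B > 0" "C > 0" for B C :: real using that by simp
      then show ?thesis by (rule) auto
    qed
    finally have "(\<bar>A k\<bar> + 1) * norm v \<le> 1 / Suc n" .
    moreover have "A k * norm v \<le> (\<bar>A k\<bar> + 1) * norm v" by (rule mult_right_mono) auto
    ultimately have "A k * norm v \<le> 1 / Suc n" by linarith
    then have "ennreal (A k * norm v) * emeasure lborel ?B \<le> emeasure lborel ?B * ennreal (1 / Suc n)"
      by (subst mult.commute) (intro mult_left_mono ennreal_leI, auto)
    then have le: "?e j + ?e k + (ennreal (A k * norm v) * emeasure lborel ?B + ?e k)
       \<le> ?e j + ?e k + (emeasure lborel ?B * ennreal (1 / Suc n) + ?e k)"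
      by (intro add_mono order_refl)
    have nv: "norm v \<le> 1" using v by (simp add: \<delta>_def)
    show ?thesis using order_trans[OF tri[OF nv] le] J[OF j] by (rule le_less_trans)
  qed
  ultimately show thesis by (rule that)
qed

lemma L1_conv_shift:
  fixes q :: "nat \<Rightarrow> 'a::euclidean_space \<Rightarrow> real"
  assumes q: "L1_conv q s" and lip: "\<And>k x y. \<bar>q k x - q k y\<bar> \<le> A k * norm (x - y)"
  shows "L1_conv (\<lambda>j x. q j (x + (1/2)^j *\<^sub>R v)) s"
  unfolding L1_conv_def
proof (intro conjI allI)
  have [measurable]: "\<And>j. q j \<in> borel_measurable borel" "s \<in> borel_measurable borel"
    using q by (auto simp: L1_conv_def)
  fix r :: real
  let ?I = "\<lambda>j. \<integral>\<^sup>+x. ennreal \<bar>q j (x + (1/2)^j *\<^sub>R v) - s x\<bar> * indicator (cball 0 r :: 'a set) x \<partial>lborel"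
  show "?I \<longlonglongrightarrow> 0"
  proof (rule order_tendstoI)
    fix d :: ennreal assume d: "0 < d"
    obtain \<delta> J where J: "\<delta> > 0" "\<And>j v. J \<le> j \<Longrightarrow> norm v < \<delta> \<Longrightarrow>
       (\<integral>\<^sup>+x. ennreal \<bar>q j (x + v) - s x\<bar> * indicator (cball 0 r) x \<partial>lborel) < d"
      using L1_conv_shift_uniform[OF q lip d] by blast
    have "(\<lambda>j. (1/2)^j *\<^sub>R v) \<longlonglongrightarrow> 0 *\<^sub>R v"
      by (intro tendsto_scaleR tendsto_const LIMSEQ_realpow_zero) auto
    then have "\<forall>\<^sub>F j in sequentially. norm ((1/2)^j *\<^sub>R v) < \<delta>"
      using J(1) by (intro order_tendstoD(2)[OF tendsto_norm_zero]) simp_all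
    then show "\<forall>\<^sub>F j in sequentially. ?I j < d"
      using eventually_ge_at_top[of J] by eventually_elim (rule J(2))
  qed simp
  show "(\<lambda>x. q j (x + (1/2)^j *\<^sub>R v)) \<in> borel_measurable borel" for j by measurable
  show "s \<in> borel_measurable borel" by measurable
qed

section \<open>Seminorms and metric derivatives\<close>

lemma seminorm_zero: "is_seminorm \<sigma> \<Longrightarrow> \<sigma> 0 = 0"
  unfolding is_seminorm_def by (metis abs_zero mult_zero_left scale_zero_left)

lemma seminorm_triangle: "is_seminorm \<sigma> \<Longrightarrow> \<sigma> (u + v) \<le> \<sigma> u + \<sigma> v"
  by (simp add: is_seminorm_def)

lemma seminorm_scale: "is_seminorm \<sigma> \<Longrightarrow> \<sigma> (c *\<^sub>R v) = \<bar>c\<bar> * \<sigma> v"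
  by (simp add: is_seminorm_def)

lemma seminorm_minus: "is_seminorm \<sigma> \<Longrightarrow> \<sigma> (- v) = \<sigma> v"
  using seminorm_scale[of \<sigma> "-1" v] by simp

lemma seminorm_nonneg:
  assumes "is_seminorm \<sigma>" shows "0 \<le> \<sigma> v"
  using seminorm_triangle[OF assms, of v "- v"] seminorm_zero[OF assms] seminorm_minus[OF assms, of v] by simp

lemma seminorm_diff_le:
  assumes "is_seminorm \<sigma>" shows "\<bar>\<sigma> u - \<sigma> v\<bar> \<le> \<sigma> (u - v)"
  using seminorm_triangle[OF assms, of "u - v" v] seminorm_triangle[OF assms, of "v - u" u]
    seminorm_minus[OF assms, of "u - v"] by (simp add: abs_le_iff)

lemma seminorm_bounded:
  fixes \<sigma> :: "'a::euclidean_space \<Rightarrow> real"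
  assumes "is_seminorm \<sigma>"
  obtains C where "\<And>v. \<sigma> v \<le> C * norm v"
proof
  fix v :: 'a
  have sum: "\<sigma> (\<Sum>b\<in>B. f b) \<le> (\<Sum>b\<in>B. \<sigma> (f b))" if "finite B" for B and f :: "'a \<Rightarrow> 'a"
    using that
  proof induct
    case (insert b B)
    then show ?case using seminorm_triangle[OF assms, of "f b" "sum f B"] by simp
  qed (simp add: seminorm_zero[OF assms])
  have "\<sigma> v = \<sigma> (\<Sum>b\<in>Basis. (v \<bullet> b) *\<^sub>R b)" by (simp add: euclidean_representation)
  also have "\<dots> \<le> (\<Sum>b\<in>Basis. \<sigma> ((v \<bullet> b) *\<^sub>R b))" by (rule sum) simp
  also have "\<dots> \<le> (\<Sum>b\<in>Basis. norm v * \<sigma> b)"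
    by (rule sum_mono) (auto simp: seminorm_scale[OF assms] Basis_le_norm intro!: mult_right_mono seminorm_nonneg[OF assms])
  also have "\<dots> = (\<Sum>b\<in>Basis. \<sigma> b) * norm v" by (simp add: sum_distrib_left mult.commute)
  finally show "\<sigma> v \<le> (\<Sum>b\<in>Basis. \<sigma> b) * norm v" .
qed

lemma continuous_on_seminorm:
  fixes \<sigma> :: "'a::euclidean_space \<Rightarrow> real"
  assumes "is_seminorm \<sigma>"
  shows "continuous_on S \<sigma>"
proof -
  obtain C where C: "\<And>v. \<sigma> v \<le> C * norm v" using seminorm_bounded[OF assms] by blast
  have "\<bar>\<sigma> u - \<sigma> v\<bar> \<le> \<bar>C\<bar> * norm (u - v)" for u v
  proof -
    have "\<bar>\<sigma> u - \<sigma> v\<bar> \<le> C * norm (u - v)" using seminorm_diff_le[OF assms] C by (rule order_trans)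
    also have "\<dots> \<le> \<bar>C\<bar> * norm (u - v)" by (rule mult_right_mono) auto
    finally show ?thesis .
  qed
  then show ?thesis
    by (intro lipschitz_on_continuous_on[of "\<bar>C\<bar>"] lipschitz_onI) (auto simp: dist_norm)
qed

text \<open>The limit along a ray is the value of the metric derivative in that direction. This
gives uniqueness and is how rank information is read off.\<close>

lemma metric_derivative_directional:
  assumes \<sigma>: "has_metric_derivative X \<Omega> f x \<sigma>" and "open \<Omega>" "x \<in> \<Omega>" and fx: "f x \<in> mspace X"
  shows "((\<lambda>h. mdist X (f (x + h *\<^sub>R w)) (f x) / \<bar>h\<bar>) \<longlongrightarrow> \<sigma> w) (at 0)"
proof (cases "w = 0")
  case True
  then show ?thesis using fx seminorm_zero[of \<sigma>] \<sigma> by (simp add: has_metric_derivative_def mdist_self)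
next
  case False
  have sn: "is_seminorm \<sigma>" using \<sigma> by (simp add: has_metric_derivative_def)
  have lim: "((\<lambda>y. (mdist X (f y) (f x) - \<sigma> (y - x)) / norm (y - x)) \<longlongrightarrow> 0) (at x)"
    using \<sigma> unfolding has_metric_derivative_def at_within_open[OF assms(3,2)] by blast
  have "filterlim (\<lambda>h. x + h *\<^sub>R w) (at x) (at 0)"
  proof (rule filterlim_atI)
    have "((\<lambda>h. x + h *\<^sub>R w) \<longlongrightarrow> x + 0 *\<^sub>R w) (at 0)" by (intro tendsto_intros)
    then show "((\<lambda>h. x + h *\<^sub>R w) \<longlongrightarrow> x) (at 0)" by simp
    show "\<forall>\<^sub>F h in at 0. x + h *\<^sub>R w \<noteq> x" using False by (auto simp: eventually_at_filter)
  qed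
  from filterlim_compose[OF lim this]
  have "((\<lambda>h. (mdist X (f (x + h *\<^sub>R w)) (f x) - \<sigma> (h *\<^sub>R w)) / norm (h *\<^sub>R w) * norm w + \<sigma> w) \<longlongrightarrow> 0 * norm w + \<sigma> w) (at 0)"
    by (intro tendsto_intros) simp
  then have "((\<lambda>h. (mdist X (f (x + h *\<^sub>R w)) (f x) - \<sigma> (h *\<^sub>R w)) / norm (h *\<^sub>R w) * norm w + \<sigma> w) \<longlongrightarrow> \<sigma> w) (at 0)"
    by simp
  then show ?thesis
    by (rule Lim_transform_eventually)
       (use False in \<open>auto simp: eventually_at_filter seminorm_scale[OF sn] field_simps\<close>)
qed

lemma metric_derivative_unique:
  assumes "has_metric_derivative X \<Omega> f x \<sigma>" "has_metric_derivative X \<Omega> f x \<tau>"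
    and "open \<Omega>" "x \<in> \<Omega>" "f x \<in> mspace X"
  shows "\<sigma> = \<tau>"
proof
  fix w
  show "\<sigma> w = \<tau> w"
    using metric_derivative_directional[OF assms(1,3-5), of w] metric_derivative_directional[OF assms(2-5), of w]
    by (rule tendsto_unique[rotated]) simp
qed

lemma md_eq:
  assumes "has_metric_derivative X \<Omega> f x \<sigma>" "open \<Omega>" "x \<in> \<Omega>" "f x \<in> mspace X"
  shows "md X \<Omega> f x = \<sigma>"
  unfolding md_def by (rule the_equality) (use assms metric_derivative_unique in blast)+

section \<open>Almost everywhere metric differentiability\<close>

context lipschitz_into
begin

text \<open>The step sizes are powers of two, so that the quotients of consecutive steps fit
together when a segment is bisected.\<close>

definition speed_quot :: "'a \<Rightarrow> nat \<Rightarrow> 'a \<Rightarrow> real" where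
  "speed_quot w j x = mdist M (F (x + (1/2)^j *\<^sub>R w)) (F x) * 2^j"

definition speed :: "'a \<Rightarrow> 'a \<Rightarrow> real" where
  "speed w x = lim (\<lambda>j. speed_quot w j x)"

lemma speed_quot_measurable [measurable]: "speed_quot w j \<in> borel_measurable borel"
  unfolding speed_quot_def
  by (intro borel_measurable_continuous_onI continuous_on_mult continuous_mdist continuous_intros)

lemma speed_measurable [measurable]: "speed w \<in> borel_measurable borel"
  unfolding speed_def by (rule borel_measurable_lim_metric) (rule speed_quot_measurable)

lemma speed_quot_nonneg: "0 \<le> speed_quot w j x"
  by (simp add: speed_quot_def)

lemma speed_quot_le: "\<bar>speed_quot w j x\<bar> \<le> L * norm w"
proof -
  have "mdist M (F (x + (1/2)^j *\<^sub>R w)) (F x) \<le> L * ((1/2)^j * norm w)"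
    using lip[of "x + (1/2)^j *\<^sub>R w" x] by simp
  then have "mdist M (F (x + (1/2)^j *\<^sub>R w)) (F x) * 2^j \<le> L * ((1/2)^j * norm w) * 2^j"
    by (rule mult_right_mono) simp
  also have "\<dots> = L * norm w" by (simp add: power_divide)
  finally show ?thesis using speed_quot_nonneg[of w j x] by (simp add: speed_quot_def)
qed

lemma speed_quot_lipschitz: "\<bar>speed_quot w j x - speed_quot w j y\<bar> \<le> (2 * L * 2^j) * norm (x - y)"
proof -
  have "\<bar>speed_quot w j x - speed_quot w j y\<bar>
     = \<bar>mdist M (F (x + (1/2)^j *\<^sub>R w)) (F x) - mdist M (F (y + (1/2)^j *\<^sub>R w)) (F y)\<bar> * 2^j"
    by (simp add: speed_quot_def abs_mult flip: left_diff_distrib)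
  also have "\<dots> \<le> (L * norm (x - y) + L * norm (x - y)) * 2^j"
    using mdist_diff_le[of "x + (1/2)^j *\<^sub>R w" x "y + (1/2)^j *\<^sub>R w" y] by (intro mult_right_mono) auto
  finally show ?thesis by (simp add: algebra_simps)
qed

lemma speed_quot_tendsto:
  assumes "((\<lambda>h. mdist M (F (x + h *\<^sub>R w)) (F x) / \<bar>h\<bar>) \<longlongrightarrow> l) (at 0)"
  shows "(\<lambda>j. speed_quot w j x) \<longlonglongrightarrow> l"
proof -
  have "filterlim (\<lambda>j. (1/2::real)^j) (at 0) sequentially"
    by (rule filterlim_atI) (auto intro!: LIMSEQ_realpow_zero)
  from filterlim_compose[OF assms this] show ?thesis
    by (simp add: speed_quot_def power_divide)
qed

lemma speed_tendsto_AE: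
  "AE x in lborel. ((\<lambda>h. mdist M (F (x + h *\<^sub>R w)) (F x) / \<bar>h\<bar>) \<longlongrightarrow> speed w x) (at 0)"
  using directional_speed_exists_AE[of w]
proof eventually_elim
  case (elim x)
  then obtain l where l: "((\<lambda>h. mdist M (F (x + h *\<^sub>R w)) (F x) / \<bar>h\<bar>) \<longlongrightarrow> l) (at 0)" by blast
  have "speed w x = l" unfolding speed_def by (rule limI) (rule speed_quot_tendsto[OF l])
  then show ?case using l by simp
qed

lemma L1_conv_speed_quot: "L1_conv (speed_quot w) (speed w)"
proof (rule L1_convI_AE)
  show "AE x in lborel. (\<lambda>j. speed_quot w j x) \<longlonglongrightarrow> speed w x"
    using speed_tendsto_AE[of w] by eventually_elim (rule speed_quot_tendsto)
qed (auto intro: speed_quot_le)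

lemma L1_conv_speed_quot_shift: "L1_conv (\<lambda>j x. speed_quot w j (x + (1/2)^j *\<^sub>R v)) (speed w)"
  by (rule L1_conv_shift[OF L1_conv_speed_quot]) (rule speed_quot_lipschitz)

lemma speed_triangle_AE: "AE x in lborel. speed (v + w) x \<le> speed v x + speed w x"
proof (rule L1_conv_le_AE[OF L1_conv_speed_quot L1_conv_add[OF L1_conv_speed_quot_shift[of v w] L1_conv_speed_quot[of w]]])
  fix j x
  let ?t = "(1/2::real)^j"
  have "mdist M (F (x + ?t *\<^sub>R (v + w))) (F x)
     \<le> mdist M (F (x + ?t *\<^sub>R w + ?t *\<^sub>R v)) (F (x + ?t *\<^sub>R w)) + mdist M (F (x + ?t *\<^sub>R w)) (F x)"
    using tri[of "x + ?t *\<^sub>R (v + w)" x "x + ?t *\<^sub>R w"] by (simp add: algebra_simps)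
  then have "mdist M (F (x + ?t *\<^sub>R (v + w))) (F x) * 2^j
     \<le> (mdist M (F (x + ?t *\<^sub>R w + ?t *\<^sub>R v)) (F (x + ?t *\<^sub>R w)) + mdist M (F (x + ?t *\<^sub>R w)) (F x)) * 2^j"
    by (rule mult_right_mono) simp
  then show "speed_quot (v + w) j x \<le> speed_quot v j (x + ?t *\<^sub>R w) + speed_quot w j x"
    unfolding speed_quot_def by (simp only: distrib_right)
qed

text \<open>The quotients are Lipschitz in the direction, uniformly in \<open>h\<close>. Therefore
convergence for a dense set of directions gives convergence for all directions, the seminorm
properties extend by density, and compactness of the unit sphere makes the convergence
uniform.\<close>

lemma metric_derivative_from_directions:
  assumes dense: "\<And>v e. 0 < e \<Longrightarrow> \<exists>d\<in>D. norm (d - v) < e"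
    and lims: "\<And>w. w \<in> D \<Longrightarrow> ((\<lambda>h. mdist M (F (x + h *\<^sub>R w)) (F x) / \<bar>h\<bar>) \<longlongrightarrow> s w) (at 0)"
    and sums: "\<And>u v. u \<in> D \<Longrightarrow> v \<in> D \<Longrightarrow> \<exists>l \<le> s u + s v.
        ((\<lambda>h. mdist M (F (x + h *\<^sub>R (u + v))) (F x) / \<bar>h\<bar>) \<longlongrightarrow> l) (at 0)"
  shows "\<exists>\<sigma>. has_metric_derivative M UNIV F x \<sigma>"
proof -
  define Q where "Q = (\<lambda>v h. mdist M (F (x + h *\<^sub>R v)) (F x) / \<bar>h\<bar>)"
  have Qlip: "\<bar>Q v h - Q w h\<bar> \<le> L * norm (v - w)" if "h \<noteq> 0" for v w h
  proof -
    have "\<bar>Q v h - Q w h\<bar> = \<bar>mdist M (F (x + h *\<^sub>R v)) (F x) - mdist M (F (x + h *\<^sub>R w)) (F x)\<bar> / \<bar>h\<bar>"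
      by (simp add: Q_def flip: diff_divide_distrib)
    also have "\<dots> \<le> (L * norm (h *\<^sub>R (v - w)) + 0) / \<bar>h\<bar>"
      using mdist_diff_le[of "x + h *\<^sub>R v" x "x + h *\<^sub>R w" x]
      by (intro divide_right_mono) (auto simp: scaleR_diff_right)
    also have "\<dots> = L * norm (v - w)" using that by simp
    finally show ?thesis .
  qed
  have lim_lip: "\<bar>l - l'\<bar> \<le> L * norm (v - w)" if l: "(Q v \<longlongrightarrow> l) (at 0)" "(Q w \<longlongrightarrow> l') (at 0)" for v w l l'
  proof (rule tendsto_upperbound[OF tendsto_rabs[OF tendsto_diff[OF l]]])
    show "\<forall>\<^sub>F h in at 0. \<bar>Q v h - Q w h\<bar> \<le> L * norm (v - w)"
      using Qlip by (auto simp: eventually_at_filter)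
  qed simp
  have lims': "(Q w \<longlongrightarrow> s w) (at 0)" if "w \<in> D" for w using lims[OF that] by (simp add: Q_def)
  have "\<exists>l. (Q v \<longlongrightarrow> l) (at 0)" for v
  proof -
    have "\<forall>n. \<exists>d\<in>D. norm (d - v) < 1 / (real n + 1)" using dense by simp
    then obtain d where d: "\<And>n. d n \<in> D" "\<And>n. norm (d n - v) < 1 / (real n + 1)" by metis
    have "(\<lambda>n. d n - v) \<longlonglongrightarrow> 0"
      by (rule LIMSEQ_norm_0) (use d(2) in \<open>simp add: add.commute\<close>)
    then have dv: "d \<longlonglongrightarrow> v" by (simp add: LIM_zero_iff)
    have "Cauchy (\<lambda>n. s (d n))"
    proof (rule metric_CauchyI)
      fix e :: real assume e: "e > 0"
      then have "e / (L + 1) > 0" using L_nonneg by simp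
      then obtain N where N: "\<And>m n. m \<ge> N \<Longrightarrow> n \<ge> N \<Longrightarrow> dist (d m) (d n) < e / (L + 1)"
        using LIMSEQ_imp_Cauchy[OF dv] unfolding Cauchy_def by meson
      have "dist (s (d m)) (s (d n)) < e" if "m \<ge> N" "n \<ge> N" for m n
      proof -
        have "dist (s (d m)) (s (d n)) \<le> L * norm (d m - d n)"
          using lim_lip[OF lims'[OF d(1)] lims'[OF d(1)]] by (simp add: dist_real_def)
        also have "\<dots> \<le> (L + 1) * norm (d m - d n)" by (simp add: algebra_simps)
        also have "\<dots> < e" using N[OF that] L_nonneg by (simp add: dist_norm field_simps)
        finally show ?thesis .
      qed
      then show "\<exists>N. \<forall>m\<ge>N. \<forall>n\<ge>N. dist (s (d m)) (s (d n)) < e" by blast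
    qed
    then obtain l where l: "(\<lambda>n. s (d n)) \<longlonglongrightarrow> l" using Cauchy_convergent convergent_def by blast
    have "(Q v \<longlongrightarrow> l) (at 0)"
    proof (rule LIM_I)
      fix e :: real assume "e > 0"
      then have e3: "e / 3 > 0" "e / (3 * (L + 1)) > 0" using L_nonneg by auto
      have "\<forall>\<^sub>F n in sequentially. dist (s (d n)) l < e / 3 \<and> dist (d n) v < e / (3 * (L + 1))"
        using tendstoD[OF l e3(1)] tendstoD[OF dv e3(2)] by eventually_elim auto
      then obtain n where n: "dist (s (d n)) l < e / 3" "dist (d n) v < e / (3 * (L + 1))"
        by (auto simp: eventually_sequentially)
      have Ln: "L * norm (v - d n) \<le> e / 3"
      proof -
        have "L * norm (v - d n) \<le> (L + 1) * norm (v - d n)" by (simp add: algebra_simps)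
        also have "\<dots> \<le> e / 3" using n(2) L_nonneg by (simp add: dist_norm norm_minus_commute field_simps)
        finally show ?thesis .
      qed
      obtain r where r: "r > 0" "\<And>h. h \<noteq> 0 \<Longrightarrow> \<bar>h\<bar> < r \<Longrightarrow> \<bar>Q (d n) h - s (d n)\<bar> < e / 3"
        using LIM_D[OF lims'[OF d(1)] e3(1), of n] by auto
      have "\<bar>Q v h - l\<bar> < e" if "h \<noteq> 0" "\<bar>h\<bar> < r" for h
        using r(2)[OF that] Qlip[OF that(1), of v "d n"] Ln n(1) unfolding dist_real_def by linarith
      then show "\<exists>r>0. \<forall>h. h \<noteq> 0 \<and> norm (h - 0) < r \<longrightarrow> norm (Q v h - l) < e"
        using r(1) by (intro exI[of _ r]) auto
    qed
    then show ?thesis by blast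
  qed
  then obtain \<sigma> where \<sigma>: "\<And>v. (Q v \<longlongrightarrow> \<sigma> v) (at 0)" by metis
  have \<sigma>lip: "\<bar>\<sigma> u - \<sigma> v\<bar> \<le> L * norm (u - v)" for u v by (rule lim_lip[OF \<sigma> \<sigma>])
  have \<sigma>D: "\<sigma> w = s w" if "w \<in> D" for w by (rule tendsto_unique[OF _ \<sigma> lims'[OF that]]) simp
  have "\<sigma> (c *\<^sub>R v) = \<bar>c\<bar> * \<sigma> v" for c v
  proof (cases "c = 0")
    case True
    have "(Q 0 \<longlongrightarrow> 0) (at 0)" by (simp add: Q_def mdist_self)
    then show ?thesis using True tendsto_unique[OF _ \<sigma>[of 0]] by simp
  next
    case False
    have "filterlim (\<lambda>h. h * c) (at 0) (at 0)"
    proof (rule filterlim_atI)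
      have "((\<lambda>h. h * c) \<longlongrightarrow> 0 * c) (at 0)" by (intro tendsto_intros)
      then show "((\<lambda>h. h * c) \<longlongrightarrow> 0) (at 0)" by simp
    qed (use False in \<open>auto simp: eventually_at_filter\<close>)
    from tendsto_mult[OF tendsto_const[of "\<bar>c\<bar>"] filterlim_compose[OF \<sigma>[of v] this]]
    have "(Q (c *\<^sub>R v) \<longlongrightarrow> \<bar>c\<bar> * \<sigma> v) (at 0)"
      by (rule Lim_transform_eventually) (use False in \<open>auto simp: eventually_at_filter Q_def abs_mult field_simps\<close>)
    then show ?thesis by (rule tendsto_unique[OF _ \<sigma>, rotated]) simp
  qed
  moreover have "\<sigma> (u + v) \<le> \<sigma> u + \<sigma> v" for u v
  proof (rule field_le_epsilon)
    fix e :: real assume e: "e > 0"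
    have e': "e / (4 * (L + 1)) > 0" using e L_nonneg by simp
    obtain u' where u': "u' \<in> D" "norm (u' - u) < e / (4 * (L + 1))" using dense[OF e'] by blast
    obtain v' where v': "v' \<in> D" "norm (v' - v) < e / (4 * (L + 1))" using dense[OF e'] by blast
    have small: "L * y \<le> e / 4" if "y < e / (4 * (L + 1))" "y \<ge> 0" for y
    proof -
      have "L * y \<le> (L + 1) * y" using that by (simp add: algebra_simps)
      also have "\<dots> \<le> e / 4" using that L_nonneg by (simp add: field_simps)
      finally show ?thesis .
    qed
    obtain l where l: "l \<le> s u' + s v'" "(Q (u' + v') \<longlongrightarrow> l) (at 0)"
      using sums[OF u'(1) v'(1)] by (auto simp: Q_def)
    have "\<sigma> (u' + v') = l" by (rule tendsto_unique[OF _ \<sigma> l(2)]) simp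
    moreover have "\<bar>\<sigma> (u + v) - \<sigma> (u' + v')\<bar> \<le> L * norm (u' - u) + L * norm (v' - v)"
    proof -
      have "\<bar>\<sigma> (u + v) - \<sigma> (u' + v')\<bar> \<le> L * norm ((u + v) - (u' + v'))" by (rule \<sigma>lip)
      also have "\<dots> \<le> L * (norm (u' - u) + norm (v' - v))"
        using norm_triangle_ineq[of "u - u'" "v - v'"] L_nonneg
        by (intro mult_left_mono) (auto simp: norm_minus_commute algebra_simps)
      finally show ?thesis by (simp add: algebra_simps)
    qed
    ultimately show "\<sigma> (u + v) \<le> \<sigma> u + \<sigma> v + e"
      using l(1) \<sigma>D[OF u'(1)] \<sigma>D[OF v'(1)] small[OF u'(2)] small[OF v'(2)] \<sigma>lip[of u' u] \<sigma>lip[of v' v]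
      by (simp add: abs_le_iff)
  qed
  ultimately have sn: "is_seminorm \<sigma>" by (simp add: is_seminorm_def)
  have "((\<lambda>y. (mdist M (F y) (F x) - \<sigma> (y - x)) / norm (y - x)) \<longlongrightarrow> 0) (at x)"
  proof (rule LIM_I)
    fix e :: real assume e: "e > 0"
    define e1 where "e1 = e / (3 * (L + 1))"
    have e1: "e1 > 0" using e L_nonneg by (simp add: e1_def)
    have Le1: "L * e1 \<le> e / 3"
    proof -
      have "L * e1 \<le> (L + 1) * e1" using e1 by simp
      also have "\<dots> = e / 3" using L_nonneg by (simp add: e1_def field_simps)
      finally show ?thesis .
    qed
    have "compact (sphere 0 1 :: 'a set)" by simp
    then obtain K where K: "finite K" "sphere 0 1 \<subseteq> (\<Union>v\<in>K. ball v e1 :: 'a set)"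
      using e1 unfolding compact_eq_totally_bounded by blast
    have "\<forall>\<^sub>F h in at 0. \<forall>v\<in>K. \<bar>Q v h - \<sigma> v\<bar> < e / 3"
      using \<sigma> e tendstoD[OF \<sigma>, of "e / 3"] by (intro eventually_ball_finite[OF K(1)]) (auto simp: dist_real_def)
    then obtain r where r: "r > 0" "\<And>h v. h \<noteq> 0 \<Longrightarrow> \<bar>h\<bar> < r \<Longrightarrow> v \<in> K \<Longrightarrow> \<bar>Q v h - \<sigma> v\<bar> < e / 3"
      by (auto simp: eventually_at dist_real_def)
    have "\<bar>(mdist M (F y) (F x) - \<sigma> (y - x)) / norm (y - x)\<bar> < e" if y: "y \<noteq> x" "norm (y - x) < r" for y
    proof -
      define h where "h = norm (y - x)"
      define v where "v = (y - x) /\<^sub>R h"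
      have h: "h > 0" "h < r" using y by (auto simp: h_def)
      have hv: "y - x = h *\<^sub>R v" "y = x + h *\<^sub>R v" "norm v = 1" using h by (auto simp: v_def h_def)
      then have "v \<in> sphere 0 1" by simp
      then obtain w where w: "w \<in> K" "norm (w - v) < e1" using K(2) by (auto simp: dist_norm)
      have "L * norm (w - v) \<le> e / 3" using w(2) Le1 L_nonneg mult_left_mono[of "norm (w - v)" e1 L] by linarith
      moreover have "(mdist M (F y) (F x) - \<sigma> (y - x)) / norm (y - x) = Q v h - \<sigma> v"
        using h unfolding hv(1) seminorm_scale[OF sn] by (simp add: hv Q_def field_simps)
      ultimately show ?thesis
        using r(2)[of h w] h w(1) Qlip[of h w v] \<sigma>lip[of w v] unfolding abs_if by (simp split: if_splits)
    qed
    then show "\<exists>r>0. \<forall>y. y \<noteq> x \<and> norm (y - x) < r \<longrightarrow> norm ((mdist M (F y) (F x) - \<sigma> (y - x)) / norm (y - x) - 0) < e"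
      using r(1) by (intro exI[of _ r]) auto
  qed
  then show ?thesis using sn by (auto simp: has_metric_derivative_def)
qed

lemma countable_dense_directions:
  obtains D :: "'a set" where "countable D" "\<And>v e. 0 < e \<Longrightarrow> \<exists>d\<in>D. norm (d - v) < e"
proof -
  obtain D :: "'a set" where D: "countable D" "\<And>X. open X \<Longrightarrow> X \<noteq> {} \<Longrightarrow> \<exists>d\<in>D. d \<in> X"
    using countable_dense_exists by blast
  have "\<exists>d\<in>D. norm (d - v) < e" if "e > 0" for v e
    using D(2)[of "ball v e"] that by (auto simp: dist_norm norm_minus_commute)
  with D(1) show thesis by (rule that)
qed

theorem metric_derivative_exists_AE:
  "AE x in lborel. \<exists>\<sigma>. has_metric_derivative M UNIV F x \<sigma>"
proof -
  obtain D :: "'a set" where D: "countable D" "\<And>v e. 0 < e \<Longrightarrow> \<exists>d\<in>D. norm (d - v) < e"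
    using countable_dense_directions by blast
  have "AE x in lborel. \<forall>w\<in>D. ((\<lambda>h. mdist M (F (x + h *\<^sub>R w)) (F x) / \<bar>h\<bar>) \<longlongrightarrow> speed w x) (at 0)"
    using D(1) speed_tendsto_AE by (simp add: AE_ball_countable)
  moreover have "AE x in lborel. \<forall>u\<in>D. \<forall>v\<in>D. ((\<lambda>h. mdist M (F (x + h *\<^sub>R (u + v))) (F x) / \<bar>h\<bar>) \<longlongrightarrow> speed (u + v) x) (at 0)"
    using D(1) speed_tendsto_AE by (simp add: AE_ball_countable)
  moreover have "AE x in lborel. \<forall>u\<in>D. \<forall>v\<in>D. speed (u + v) x \<le> speed u x + speed v x"
    using D(1) speed_triangle_AE by (simp add: AE_ball_countable)
  ultimately show ?thesis
  proof eventually_elim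
    case (elim x)
    show ?case
    proof (rule metric_derivative_from_directions[OF D(2), where s = "\<lambda>w. speed w x"])
      show "\<exists>l\<le>speed u x + speed v x. ((\<lambda>h. mdist M (F (x + h *\<^sub>R (u + v))) (F x) / \<bar>h\<bar>) \<longlongrightarrow> l) (at 0)"
        if "u \<in> D" "v \<in> D" for u v
        using elim(2,3) that by blast
    qed (use elim(1) in auto)
  qed
qed

text \<open>The four-point condition for the corners of the parallelogram \<open>x, x + t u, x + t
u + t v, x + t v\<close>, with the diagonals on the left-hand side.\<close>

lemma four_point_speed_quot_AE:
  assumes 4: "\<And>x y z w. mdist M (F x) (F y) + mdist M (F z) (F w)
      \<le> max (mdist M (F x) (F z) + mdist M (F y) (F w)) (mdist M (F x) (F w) + mdist M (F y) (F z))"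
  shows "AE x in lborel. speed (u + v) x + speed (u - v) x \<le> max (speed u x + speed u x) (speed v x + speed v x)"
proof (rule L1_conv_le_AE[OF L1_conv_add[OF L1_conv_speed_quot L1_conv_speed_quot_shift[of "u - v" v]]
      L1_conv_max[OF L1_conv_add[OF L1_conv_speed_quot[of u] L1_conv_speed_quot_shift[of u v]]
        L1_conv_add[OF L1_conv_speed_quot[of v] L1_conv_speed_quot_shift[of v u]]]])
  fix j x
  let ?t = "(1/2::real)^j"
  have e: "x + ?t *\<^sub>R (u + v) = x + ?t *\<^sub>R v + ?t *\<^sub>R u" "x + ?t *\<^sub>R v + ?t *\<^sub>R (u - v) = x + ?t *\<^sub>R u"
    "x + ?t *\<^sub>R u + ?t *\<^sub>R v = x + ?t *\<^sub>R v + ?t *\<^sub>R u"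
    by (auto simp: algebra_simps)
  have "mdist M (F (x + ?t *\<^sub>R (u + v))) (F x) + mdist M (F (x + ?t *\<^sub>R u)) (F (x + ?t *\<^sub>R v))
     \<le> max (mdist M (F (x + ?t *\<^sub>R u)) (F x) + mdist M (F (x + ?t *\<^sub>R v + ?t *\<^sub>R u)) (F (x + ?t *\<^sub>R v)))
         (mdist M (F (x + ?t *\<^sub>R v)) (F x) + mdist M (F (x + ?t *\<^sub>R v + ?t *\<^sub>R u)) (F (x + ?t *\<^sub>R u)))"
    using 4[of "x + ?t *\<^sub>R (u + v)" x "x + ?t *\<^sub>R u" "x + ?t *\<^sub>R v"] unfolding e
    by (simp add: mdist_commute max.commute add.commute)
  then have "(mdist M (F (x + ?t *\<^sub>R (u + v))) (F x) + mdist M (F (x + ?t *\<^sub>R u)) (F (x + ?t *\<^sub>R v))) * 2^j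
     \<le> max (mdist M (F (x + ?t *\<^sub>R u)) (F x) + mdist M (F (x + ?t *\<^sub>R v + ?t *\<^sub>R u)) (F (x + ?t *\<^sub>R v)))
         (mdist M (F (x + ?t *\<^sub>R v)) (F x) + mdist M (F (x + ?t *\<^sub>R v + ?t *\<^sub>R u)) (F (x + ?t *\<^sub>R u))) * 2^j"
    by (rule mult_right_mono) simp
  then show "speed_quot (u + v) j x + speed_quot (u - v) j (x + ?t *\<^sub>R v)
     \<le> max (speed_quot u j x + speed_quot u j (x + ?t *\<^sub>R v)) (speed_quot v j x + speed_quot v j (x + ?t *\<^sub>R u))"
    unfolding speed_quot_def e by (simp add: distrib_right max_mult_distrib_right)
qed

lemma four_point_metric_derivative_AE:
  assumes 4: "\<And>x y z w. mdist M (F x) (F y) + mdist M (F z) (F w)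
      \<le> max (mdist M (F x) (F z) + mdist M (F y) (F w)) (mdist M (F x) (F w) + mdist M (F y) (F z))"
  shows "AE x in lborel. \<forall>\<sigma>. has_metric_derivative M UNIV F x \<sigma> \<longrightarrow>
     (\<forall>u v. \<sigma> (u + v) + \<sigma> (u - v) \<le> max (2 * \<sigma> u) (2 * \<sigma> v))"
proof -
  obtain D :: "'a set" where D: "countable D" "\<And>v e. 0 < e \<Longrightarrow> \<exists>d\<in>D. norm (d - v) < e"
    using countable_dense_directions by blast
  let ?P = "\<lambda>x w. ((\<lambda>h. mdist M (F (x + h *\<^sub>R w)) (F x) / \<bar>h\<bar>) \<longlongrightarrow> speed w x) (at 0)"
  have "AE x in lborel. \<forall>w\<in>D. ?P x w"
    using D(1) speed_tendsto_AE by (simp add: AE_ball_countable)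
  moreover have "AE x in lborel. \<forall>u\<in>D. \<forall>v\<in>D. ?P x (u + v)"
    using D(1) speed_tendsto_AE by (simp add: AE_ball_countable)
  moreover have "AE x in lborel. \<forall>u\<in>D. \<forall>v\<in>D. ?P x (u - v)"
    using D(1) speed_tendsto_AE by (simp add: AE_ball_countable)
  moreover have "AE x in lborel. \<forall>u\<in>D. \<forall>v\<in>D.
      speed (u + v) x + speed (u - v) x \<le> max (speed u x + speed u x) (speed v x + speed v x)"
    using D(1) four_point_speed_quot_AE[OF 4] by (simp add: AE_ball_countable)
  ultimately show ?thesis
  proof eventually_elim
    case (elim x)
    show ?case
    proof (intro allI impI)
      fix \<sigma> u v assume \<sigma>: "has_metric_derivative M UNIV F x \<sigma>"
      have sn: "is_seminorm \<sigma>" using \<sigma> by (simp add: has_metric_derivative_def)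
      have eq: "speed w x = \<sigma> w" if "?P x w" for w
        using metric_derivative_directional[OF \<sigma>, of w] that by (intro tendsto_unique[OF _ that]) auto
      define g where "g = (\<lambda>(u, v). \<sigma> (u + v) + \<sigma> (u - v) - max (2 * \<sigma> u) (2 * \<sigma> v))"
      have gD: "g p \<le> 0" if "p \<in> D \<times> D" for p
      proof -
        obtain u v where p: "p = (u, v)" "u \<in> D" "v \<in> D" using \<open>p \<in> D \<times> D\<close> by blast
        have "speed (u + v) x + speed (u - v) x \<le> max (speed u x + speed u x) (speed v x + speed v x)"
          using elim(4) p by blast
        moreover have "speed (u + v) x = \<sigma> (u + v)" "speed (u - v) x = \<sigma> (u - v)" "speed u x = \<sigma> u" "speed v x = \<sigma> v"
          using elim(1-3) p by (auto intro!: eq)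
        ultimately show ?thesis by (simp add: g_def p(1))
      qed
      have cont: "continuous_on (closure (D \<times> D)) g"
        unfolding g_def case_prod_unfold
        by (intro continuous_intros continuous_on_compose2[OF continuous_on_seminorm[OF sn, of UNIV]]) auto
      have "w \<in> closure D" for w
        unfolding closure_approachable dist_norm using D(2) by blast
      then have "(u, v) \<in> closure (D \<times> D)" by (simp add: closure_Times)
      from continuous_le_on_closure[OF cont this gD]
      show "\<sigma> (u + v) + \<sigma> (u - v) \<le> max (2 * \<sigma> u) (2 * \<sigma> v)" by (simp add: g_def)
    qed
  qed
qed

end

section \<open>The rank of a seminorm\<close>

text \<open>Rotate \<open>r\<close> in the plane of \<open>p\<close> and \<open>q\<close> from
\<open>p\<close> to \<open>-p\<close>. At some moment \<open>\<sigma> (p + r) = \<sigma> (p -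
r)\<close>; call this value \<open>m\<close>. Applied to the half sum and half difference of
\<open>p\<close> and \<open>r\<close>, the hypothesis gives \<open>\<sigma> p + \<sigma> r \<le>
m\<close>; applied to \<open>p\<close> and \<open>r\<close>, it gives \<open>m \<le> max (\<sigma>
p) (\<sigma> r)\<close>. So one of \<open>\<sigma> p\<close> and \<open>\<sigma> r\<close>
vanishes.\<close>

lemma four_point_seminorm_degenerate:
  fixes \<sigma> :: "'a::euclidean_space \<Rightarrow> real"
  assumes sn: "is_seminorm \<sigma>" and 4: "\<And>u v. \<sigma> (u + v) + \<sigma> (u - v) \<le> max (2 * \<sigma> u) (2 * \<sigma> v)"
  obtains \<alpha> \<beta> where "(\<alpha>, \<beta>) \<noteq> (0, 0)" "\<sigma> (\<alpha> *\<^sub>R p + \<beta> *\<^sub>R q) = 0"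
proof (cases "\<sigma> p = 0")
  case True
  then show thesis using that[of 1 0] by simp
next
  case False
  then have p0: "\<sigma> p > 0" using seminorm_nonneg[OF sn, of p] by simp
  define r where "r = (\<lambda>t. cos t *\<^sub>R p + sin t *\<^sub>R q)"
  define g where "g = (\<lambda>t. \<sigma> (p + r t) - \<sigma> (p - r t))"
  have cont: "continuous_on {0..pi} g"
    unfolding g_def r_def
    by (intro continuous_intros continuous_on_compose2[OF continuous_on_seminorm[OF sn, of UNIV]]) auto
  have "\<sigma> (p + p) = 2 * \<sigma> p" using seminorm_scale[OF sn, of 2 p] by (simp add: scaleR_2)
  then have "g 0 = 2 * \<sigma> p" "g pi = - (2 * \<sigma> p)"
    using seminorm_zero[OF sn] by (auto simp: g_def r_def)
  then obtain t where t: "0 \<le> t" "t \<le> pi" "g t = 0"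
    using IVT2'[of g pi 0 0] cont p0 by auto
  define m where "m = \<sigma> (p + r t)"
  have m: "m = \<sigma> (p - r t)" using t by (simp add: g_def m_def)
  let ?h = "(1/2::real)"
  have "\<sigma> p + \<sigma> (r t) \<le> m"
  proof -
    have "?h *\<^sub>R (p + r t) + ?h *\<^sub>R (p - r t) = p" "?h *\<^sub>R (p + r t) - ?h *\<^sub>R (p - r t) = r t"
      by (simp_all add: algebra_simps flip: scaleR_add_left)
    then show ?thesis
      using 4[of "?h *\<^sub>R (p + r t)" "?h *\<^sub>R (p - r t)"] by (simp add: seminorm_scale[OF sn] m flip: m_def)
  qed
  moreover have "2 * m \<le> max (2 * \<sigma> p) (2 * \<sigma> (r t))" using 4[of p "r t"] by (simp add: m flip: m_def)
  ultimately have "\<sigma> (r t) = 0" using p0 seminorm_nonneg[OF sn, of "r t"] by (auto simp: max_def split: if_splits)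
  moreover have "(cos t, sin t) \<noteq> (0, 0)" using sin_zero_abs_cos_one[of t] by auto
  ultimately show thesis using that by (simp add: r_def)
qed

lemma subspace_seminorm_kernel:
  assumes "is_seminorm \<sigma>" shows "subspace {v. \<sigma> v = 0}"
proof (rule subspaceI)
  fix x y assume "x \<in> {v. \<sigma> v = 0}" "y \<in> {v. \<sigma> v = 0}"
  then show "x + y \<in> {v. \<sigma> v = 0}"
    using seminorm_triangle[OF assms, of x y] seminorm_nonneg[OF assms, of "x + y"] by simp
qed (auto simp: seminorm_zero[OF assms] seminorm_scale[OF assms])

text \<open>Rank at most one means that the kernel meets every plane nontrivially.\<close>

lemma seminorm_rank_le_one_iff:
  fixes \<sigma> :: "'a::euclidean_space \<Rightarrow> real"
  assumes sn: "is_seminorm \<sigma>"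
  shows "seminorm_rank \<sigma> \<le> 1 \<longleftrightarrow> (\<forall>p q. \<exists>\<alpha> \<beta>. (\<alpha>, \<beta>) \<noteq> (0, 0) \<and> \<sigma> (\<alpha> *\<^sub>R p + \<beta> *\<^sub>R q) = 0)"
proof -
  let ?K = "{v. \<sigma> v = 0}" let ?W = "{y \<in> UNIV. \<forall>x\<in>?K. orthogonal x y}"
  have K: "subspace ?K" by (rule subspace_seminorm_kernel[OF sn])
  have dims: "dim ?W + dim ?K = DIM('a)"
    using dim_subspace_orthogonal_to_vectors[OF K subspace_UNIV] by simp
  have r: "seminorm_rank \<sigma> = dim ?W" using dims by (simp add: seminorm_rank_def)
  have W: "subspace ?W" using subspace_orthogonal_to_vectors[of ?K] by simp
  show ?thesis
  proof
    assume "seminorm_rank \<sigma> \<le> 1"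
    then have dK: "dim ?K + 1 \<ge> DIM('a)" using dims r by simp
    show "\<forall>p q. \<exists>\<alpha> \<beta>. (\<alpha>, \<beta>) \<noteq> (0, 0) \<and> \<sigma> (\<alpha> *\<^sub>R p + \<beta> *\<^sub>R q) = 0"
    proof (intro allI)
      fix p q :: 'a
      show "\<exists>\<alpha> \<beta>. (\<alpha>, \<beta>) \<noteq> (0, 0) \<and> \<sigma> (\<alpha> *\<^sub>R p + \<beta> *\<^sub>R q) = 0"
      proof (cases "p \<in> span {q}")
        case True
        then obtain k where "p = k *\<^sub>R q" by (auto simp: span_singleton)
        then have "1 *\<^sub>R p + (- k) *\<^sub>R q = 0" by simp
        then have "\<sigma> (1 *\<^sub>R p + (- k) *\<^sub>R q) = 0" using seminorm_zero[OF sn] by metis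
        then show ?thesis by (intro exI[of _ 1] exI[of _ "-k"]) auto
      next
        case np: False
        show ?thesis
        proof (cases "q = 0")
          case True
          then show ?thesis by (intro exI[of _ 0] exI[of _ 1]) (auto simp: seminorm_zero[OF sn])
        next
          case False
          then have ind: "independent {p, q}" "p \<noteq> q"
            using np by (auto simp: independent_insert span_base)
          have "dim (span {p, q}) = 2"
            using dim_eq_card_independent[OF ind(1)] ind(2) by simp
          moreover have "dim {x + y |x y. x \<in> span {p, q} \<and> y \<in> ?K} + dim (span {p, q} \<inter> ?K) = dim (span {p, q}) + dim ?K"
            by (rule dim_sums_Int[OF subspace_span K])
          moreover have "dim {x + y |x y. x \<in> span {p, q} \<and> y \<in> ?K} \<le> DIM('a)" by (rule dim_subset_UNIV)
          ultimately have "dim (span {p, q} \<inter> ?K) \<noteq> 0" using dK by linarith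
          then obtain z where z: "z \<in> span {p, q}" "z \<in> ?K" "z \<noteq> 0" by (auto simp: dim_eq_0)
          then obtain \<alpha> where "z - \<alpha> *\<^sub>R p \<in> span {q}" using span_breakdown_eq by blast
          then obtain \<beta> where "z - \<alpha> *\<^sub>R p = \<beta> *\<^sub>R q" using span_singleton by blast
          then have "z = \<alpha> *\<^sub>R p + \<beta> *\<^sub>R q" by (simp add: algebra_simps)
          then show ?thesis using z by (intro exI[of _ \<alpha>] exI[of _ \<beta>]) auto
        qed
      qed
    qed
  next
    assume R: "\<forall>p q. \<exists>\<alpha> \<beta>. (\<alpha>, \<beta>) \<noteq> (0, 0) \<and> \<sigma> (\<alpha> *\<^sub>R p + \<beta> *\<^sub>R q) = 0"
    show "seminorm_rank \<sigma> \<le> 1"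
    proof (rule ccontr)
      assume "\<not> seminorm_rank \<sigma> \<le> 1"
      then have d2: "dim ?W \<ge> 2" using r by simp
      obtain B where B: "B \<subseteq> ?W" "independent B" "card B = dim ?W"
        by (rule basis_exists[of ?W])
      have fB: "finite B" using B(2) by (rule independent_imp_finite)
      have "\<not> card B \<le> Suc 0" using d2 B(3) by linarith
      then obtain p q where p: "p \<in> B" and q: "q \<in> B" "q \<noteq> p" using card_le_Suc0_iff_eq[OF fB] by blast
      have ind: "independent {p, q}" by (rule independent_mono[OF B(2)]) (use p q in auto)
      obtain \<alpha> \<beta> where ab: "(\<alpha>, \<beta>) \<noteq> (0, 0)" "\<sigma> (\<alpha> *\<^sub>R p + \<beta> *\<^sub>R q) = 0" using R by blast
      let ?z = "\<alpha> *\<^sub>R p + \<beta> *\<^sub>R q"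
      have "p \<in> ?W" "q \<in> ?W" using p q B(1) by auto
      then have "?z \<in> ?W" using W by (intro subspace_add subspace_mul) 
      then have "orthogonal ?z ?z" using ab(2) by simp
      then have z0: "?z = 0" by (simp only: orthogonal_self)
      show False
      proof (cases "\<alpha> = 0")
        case True
        then have "q = 0" using z0 ab(1) by simp
        then show False using ind dependent_zero[of "{p, q}"] by simp
      next
        case False
        then have "\<alpha> *\<^sub>R p = \<alpha> *\<^sub>R ((- \<beta> / \<alpha>) *\<^sub>R q)" using z0 by (simp add: add_eq_0_iff)
        then have "p = (- \<beta> / \<alpha>) *\<^sub>R q" using False by (simp only: scaleR_cancel_left) simp
        moreover have "(- \<beta> / \<alpha>) *\<^sub>R q \<in> span {q}" by (intro span_mul span_base) simp
        ultimately have "p \<in> span {q}" by simp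
        then show False using ind q(2) by (auto simp: independent_insert)
      qed
    qed
  qed
qed

section \<open>Line integrals of Lipschitz functions and Stokes' theorem\<close>

text \<open>The sum of \<open>f\<close> over the \<open>2^N\<close> consecutive pieces of the
segment from \<open>x\<close> to \<open>y\<close>.\<close>

fun dyadic_sum :: "('a::real_vector \<Rightarrow> 'a \<Rightarrow> real) \<Rightarrow> nat \<Rightarrow> 'a \<Rightarrow> 'a \<Rightarrow> real" where
  "dyadic_sum f 0 x y = f x y"
| "dyadic_sum f (Suc N) x y = dyadic_sum f N x (midpoint x y) + dyadic_sum f N (midpoint x y) y"

lemma dyadic_sum_commute:
  assumes "\<And>x y. f y x = f x y"
  shows "dyadic_sum f N y x = dyadic_sum f N x y"
proof (induction N arbitrary: x y)
  case (Suc N)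
  show ?case
    unfolding dyadic_sum.simps midpoint_sym[of y x] Suc.IH[of y "midpoint x y"] Suc.IH[of "midpoint x y" x]
    by simp
qed (use assms in simp)

lemma dyadic_sum_antisym:
  assumes "\<And>x y. f y x = - f x y"
  shows "dyadic_sum f N y x = - dyadic_sum f N x y"
proof (induction N arbitrary: x y)
  case 0
  show ?case using assms[of y x] by simp
next
  case (Suc N)
  show ?case
    unfolding dyadic_sum.simps midpoint_sym[of y x] Suc.IH[of y "midpoint x y"] Suc.IH[of "midpoint x y" x]
    by simp
qed

lemma continuous_dyadic_sum:
  fixes f :: "'a::real_normed_vector \<Rightarrow> 'a \<Rightarrow> real" and g h :: "'b::topological_space \<Rightarrow> 'a"
  assumes f: "\<And>g h :: 'b \<Rightarrow> 'a. continuous_on S g \<Longrightarrow> continuous_on S h \<Longrightarrow> continuous_on S (\<lambda>p. f (g p) (h p))"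
    and g: "continuous_on S g" and h: "continuous_on S h"
  shows "continuous_on S (\<lambda>p. dyadic_sum f N (g p) (h p))"
  using g h
proof (induction N arbitrary: g h)
  case (Suc N)
  have "continuous_on S (\<lambda>p. midpoint (g p) (h p))"
    unfolding midpoint_def by (intro continuous_intros Suc.prems)
  then show ?case by (auto intro!: continuous_on_add Suc.IH Suc.prems)
qed (simp add: f)

text \<open>The trapezoidal approximation of \<open>\<integral> a db\<close> over a segment. It is
antisymmetric, so inner edges of a subdivision cancel exactly, and around a triangle it gives the
signed area of the image triangle under \<open>(a,b)\<close>.\<close>

definition trapezoid :: "('a \<Rightarrow> real) \<Rightarrow> ('a \<Rightarrow> real) \<Rightarrow> 'a \<Rightarrow> 'a \<Rightarrow> real" where
  "trapezoid a b x y = (a x + a y) / 2 * (b y - b x)"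

lemma trapezoid_antisym: "trapezoid a b y x = - trapezoid a b x y"
  unfolding trapezoid_def times_divide_eq_left minus_divide_left
  by (rule arg_cong[where f = "\<lambda>t. t / 2"]) (simp add: algebra_simps)

lemma dyadic_trapezoid_antisym:
  "dyadic_sum (trapezoid a b) N y x = - dyadic_sum (trapezoid a b) N x y"
  by (rule dyadic_sum_antisym) (rule trapezoid_antisym)

definition boundary_sum :: "('a::real_vector \<Rightarrow> real) \<Rightarrow> ('a \<Rightarrow> real) \<Rightarrow> nat \<Rightarrow> 'a \<Rightarrow> 'a \<Rightarrow> 'a \<Rightarrow> real" where
  "boundary_sum a b N x y z = dyadic_sum (trapezoid a b) N x y + dyadic_sum (trapezoid a b) N y z
     + dyadic_sum (trapezoid a b) N z x"

lemma boundary_sum_0: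
  "boundary_sum a b 0 x y z = ((a y - a x) * (b z - b x) - (a z - a x) * (b y - b x)) / 2"
  unfolding boundary_sum_def trapezoid_def dyadic_sum.simps times_divide_eq_left add_divide_distrib[symmetric]
  by (rule arg_cong[where f = "\<lambda>t. t / 2"]) (simp add: algebra_simps)

text \<open>A triangle is cut into four by the midpoints of its sides; the edges of the middle
triangle cancel.\<close>

lemma boundary_sum_Suc:
  "boundary_sum a b (Suc N) x y z = boundary_sum a b N x (midpoint x y) (midpoint x z)
     + boundary_sum a b N (midpoint x y) y (midpoint y z)
     + boundary_sum a b N (midpoint x z) (midpoint y z) z
     + boundary_sum a b N (midpoint y z) (midpoint x z) (midpoint x y)"
  unfolding boundary_sum_def dyadic_sum.simps midpoint_sym[of z x] midpoint_sym[of z y]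
    dyadic_trapezoid_antisym[of a b N "midpoint x z" "midpoint x y"]
    dyadic_trapezoid_antisym[of a b N "midpoint x y" "midpoint y z"]
    dyadic_trapezoid_antisym[of a b N "midpoint y z" "midpoint x z"]
  by simp

locale lipschitz_pair =
  fixes a b :: "'a::euclidean_space \<Rightarrow> real" and K :: real
  assumes a_lip: "\<bar>a x - a y\<bar> \<le> K * norm (x - y)" and b_lip: "\<bar>b x - b y\<bar> \<le> K * norm (x - y)"
begin

abbreviation "trapezoid_sum \<equiv> dyadic_sum (trapezoid a b)"
abbreviation "bsum \<equiv> boundary_sum a b"

lemma K_nonneg: "0 \<le> K"
  using lipschitz_into.L_nonneg[OF real_lipschitz_into[OF a_lip]] .

lemma continuous_a: "continuous_on S a"
  by (rule lipschitz_on_continuous_on[of K], rule lipschitz_onI) (auto simp: a_lip dist_norm K_nonneg)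

lemma continuous_b: "continuous_on S b"
  by (rule lipschitz_on_continuous_on[of K], rule lipschitz_onI) (auto simp: b_lip dist_norm K_nonneg)

lemma continuous_trapezoid_sum:
  assumes "continuous_on S g" "continuous_on S h"
  shows "continuous_on S (\<lambda>p. trapezoid_sum N (g p) (h p))"
proof (rule continuous_dyadic_sum[OF _ assms])
  fix g h :: "'b \<Rightarrow> 'a" assume g: "continuous_on S g" "continuous_on S h"
  note [continuous_intros] = continuous_on_compose2[OF continuous_a[of UNIV]] continuous_on_compose2[OF continuous_b[of UNIV]]
  show "continuous_on S (\<lambda>p. trapezoid a b (g p) (h p))"
    unfolding trapezoid_def by (intro continuous_intros g) auto
qed

lemma bsum_0_le: "\<bar>bsum 0 x y z\<bar> \<le> K\<^sup>2 * norm (y - x) * norm (z - x)"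
proof -
  have P: "\<bar>(a p - a x) * (b q - b x)\<bar> \<le> K\<^sup>2 * norm (p - x) * norm (q - x)" for p q
  proof -
    have "\<bar>(a p - a x) * (b q - b x)\<bar> \<le> (K * norm (p - x)) * (K * norm (q - x))"
      unfolding abs_mult by (intro mult_mono a_lip b_lip) (auto simp: K_nonneg)
    then show ?thesis by (simp add: power2_eq_square mult_ac)
  qed
  have "\<bar>(a y - a x) * (b z - b x) - (a z - a x) * (b y - b x)\<bar> \<le> 2 * (K\<^sup>2 * norm (y - x) * norm (z - x))"
    using P[of y z] P[of z y] by (simp add: mult_ac)
  then show ?thesis by (simp add: boundary_sum_0 mult_ac)
qed

text \<open>One bisection changes the trapezoidal sum by the area of a triangle of size
\<open>O(|x - y|\<^sup>2)\<close>, and the number of pieces doubles while their squared length is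
divided by four.\<close>

lemma trapezoid_sum_Suc_diff: "\<bar>trapezoid_sum (Suc N) x y - trapezoid_sum N x y\<bar> \<le> K\<^sup>2 * (norm (x - y))\<^sup>2 / 2^N"
proof (induction N arbitrary: x y)
  case 0
  have "trapezoid_sum (Suc 0) x y - trapezoid_sum 0 x y = bsum 0 x (midpoint x y) y"
    by (simp add: boundary_sum_def trapezoid_antisym[of a b x y])
  then have "\<bar>trapezoid_sum (Suc 0) x y - trapezoid_sum 0 x y\<bar> \<le> K\<^sup>2 * norm (midpoint x y - x) * norm (y - x)"
    using bsum_0_le by simp
  also have "\<dots> \<le> K\<^sup>2 * norm (x - y) * norm (x - y)"
  proof -
    have "norm (midpoint x y - x) = dist x y / 2" by (metis dist_midpoint(2) dist_norm dist_commute dist_midpoint(1))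
    then have "norm (midpoint x y - x) \<le> norm (x - y)" using norm_ge_zero[of "x - y"] unfolding dist_norm by linarith
    then show ?thesis by (simp add: norm_minus_commute mult_mono)
  qed
  finally show ?case by (simp add: power2_eq_square mult.assoc)
next
  case (Suc N)
  let ?m = "midpoint x y"
  have n: "norm (x - ?m) = norm (x - y) / 2" "norm (?m - y) = norm (x - y) / 2"
    using dist_midpoint(1)[of x y] dist_midpoint(4)[of x y] by (auto simp: dist_norm)
  have "\<bar>trapezoid_sum (Suc (Suc N)) x y - trapezoid_sum (Suc N) x y\<bar>
      \<le> \<bar>trapezoid_sum (Suc N) x ?m - trapezoid_sum N x ?m\<bar> + \<bar>trapezoid_sum (Suc N) ?m y - trapezoid_sum N ?m y\<bar>"
    unfolding dyadic_sum.simps(2)[of _ "Suc N" x y] dyadic_sum.simps(2)[of _ N x y] by linarith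
  also have "\<dots> \<le> K\<^sup>2 * (norm (x - ?m))\<^sup>2 / 2^N + K\<^sup>2 * (norm (?m - y))\<^sup>2 / 2^N"
    by (intro add_mono Suc.IH)
  also have "\<dots> = K\<^sup>2 * (norm (x - y))\<^sup>2 / 2^Suc N"
    unfolding n by (simp add: power2_eq_square field_simps)
  finally show ?case .
qed

text \<open>The line integral \<open>\<integral> a db\<close> along the segment from
\<open>x\<close> to \<open>y\<close>.\<close>

definition line_int :: "'a \<Rightarrow> 'a \<Rightarrow> real" where
  "line_int x y = lim (\<lambda>N. trapezoid_sum N x y)"

lemma trapezoid_sum_tendsto: "(\<lambda>N. trapezoid_sum N x y) \<longlonglongrightarrow> line_int x y"
  and trapezoid_sum_line_int: "\<bar>trapezoid_sum N x y - line_int x y\<bar> \<le> 2 * K\<^sup>2 * (norm (x - y))\<^sup>2 / 2^N"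
proof -
  define c where "c = K\<^sup>2 * (norm (x - y))\<^sup>2"
  have c0: "c \<ge> 0" by (simp add: c_def)
  have step: "\<bar>trapezoid_sum (N + k) x y - trapezoid_sum N x y\<bar> \<le> 2 * c / 2^N - 2 * c / 2^(N + k)" for N k
  proof (induction k)
    case (Suc k)
    have "\<bar>trapezoid_sum (Suc (N + k)) x y - trapezoid_sum (N + k) x y\<bar> \<le> c / 2^(N + k)"
      using trapezoid_sum_Suc_diff[of "N + k" x y] by (simp add: c_def)
    moreover have "2 * c / 2^(N + Suc k) = c / 2^(N + k)" by simp
    moreover have "2 * c / 2^(N + k) = c / 2^(N + k) + c / 2^(N + k)" by simp
    ultimately show ?case using Suc.IH unfolding add_Suc_right by linarith
  qed simp
  have step': "\<bar>trapezoid_sum (N + k) x y - trapezoid_sum N x y\<bar> \<le> 2 * c / 2^N" for N k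
    using step[of N k] c0 by (smt (verit) divide_nonneg_pos zero_less_power)
  have "Cauchy (\<lambda>N. trapezoid_sum N x y)"
  proof (rule metric_CauchyI)
    fix e :: real assume e: "e > 0"
    have "(\<lambda>N. 4 * c * (1/2)^N) \<longlonglongrightarrow> 4 * c * 0" by (intro tendsto_mult tendsto_const LIMSEQ_realpow_zero) auto
    then have "\<forall>\<^sub>F N in sequentially. 4 * c * (1/2)^N < e" using e by (intro order_tendstoD(2)) auto
    then obtain N where N: "4 * c * (1/2)^N < e" by (auto simp: eventually_sequentially)
    have "dist (trapezoid_sum m x y) (trapezoid_sum n x y) < e" if "m \<ge> N" "n \<ge> N" for m n
      using step'[of N "m - N"] step'[of N "n - N"] that N
      by (simp add: dist_real_def power_divide)
    then show "\<exists>N. \<forall>m\<ge>N. \<forall>n\<ge>N. dist (trapezoid_sum m x y) (trapezoid_sum n x y) < e" by blast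
  qed
  then show lim: "(\<lambda>N. trapezoid_sum N x y) \<longlonglongrightarrow> line_int x y"
    unfolding line_int_def by (simp add: Cauchy_convergent_iff convergent_LIMSEQ_iff)
  show "\<bar>trapezoid_sum N x y - line_int x y\<bar> \<le> 2 * K\<^sup>2 * (norm (x - y))\<^sup>2 / 2^N"
  proof -
    have "(\<lambda>k. trapezoid_sum (k + N) x y) \<longlonglongrightarrow> line_int x y" using lim by (rule LIMSEQ_ignore_initial_segment)
    from tendsto_rabs[OF tendsto_diff[OF tendsto_const[of "trapezoid_sum N x y"] this]]
    have "\<bar>trapezoid_sum N x y - line_int x y\<bar> \<le> 2 * c / 2^N"
      by (rule tendsto_upperbound) (use step'[of N] in \<open>auto simp: abs_minus_commute add.commute\<close>)
    then show ?thesis by (simp add: c_def mult.assoc)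
  qed
qed

lemma line_int_antisym: "line_int y x = - line_int x y"
proof (rule LIMSEQ_unique[OF trapezoid_sum_tendsto])
  show "(\<lambda>N. trapezoid_sum N y x) \<longlonglongrightarrow> - line_int x y"
    using tendsto_minus[OF trapezoid_sum_tendsto[of x y]] by (simp only: dyadic_trapezoid_antisym[of a b _ y x])
qed

lemma continuous_line_int:
  fixes g h :: "'c::topological_space \<Rightarrow> 'a"
  assumes g: "continuous_on S g" "continuous_on S h" and bdd: "\<And>p. p \<in> S \<Longrightarrow> norm (g p - h p) \<le> R"
  shows "continuous_on S (\<lambda>p. line_int (g p) (h p))"
proof (rule uniform_limit_theorem[where F = sequentially and f = "\<lambda>N p. trapezoid_sum N (g p) (h p)"])
  show "uniform_limit S (\<lambda>N p. trapezoid_sum N (g p) (h p)) (\<lambda>p. line_int (g p) (h p)) sequentially"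
  proof (rule uniform_limitI)
    fix e :: real assume e: "e > 0"
    have "(\<lambda>N. 2 * K\<^sup>2 * R\<^sup>2 * (1/2)^N) \<longlonglongrightarrow> 2 * K\<^sup>2 * R\<^sup>2 * 0"
      by (intro tendsto_mult tendsto_const LIMSEQ_realpow_zero) auto
    then have "\<forall>\<^sub>F N in sequentially. 2 * K\<^sup>2 * R\<^sup>2 * (1/2)^N < e" using e by (intro order_tendstoD(2)) auto
    then show "\<forall>\<^sub>F N in sequentially. \<forall>p\<in>S. dist (trapezoid_sum N (g p) (h p)) (line_int (g p) (h p)) < e"
    proof eventually_elim
      case (elim N)
      show ?case
      proof
        fix p assume p: "p \<in> S"
        have "(norm (g p - h p))\<^sup>2 \<le> R\<^sup>2" using bdd[OF p] by (intro power_mono) auto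
        then have "2 * K\<^sup>2 * (norm (g p - h p))\<^sup>2 / 2^N \<le> 2 * K\<^sup>2 * R\<^sup>2 / 2^N"
          by (intro divide_right_mono mult_left_mono) auto
        then show "dist (trapezoid_sum N (g p) (h p)) (line_int (g p) (h p)) < e"
          using trapezoid_sum_line_int[of N "g p" "h p"] elim by (simp add: dist_real_def power_divide)
      qed
    qed
  qed
qed (auto intro!: always_eventually continuous_trapezoid_sum g)

lemma bsum_tendsto: "(\<lambda>N. bsum N x y z) \<longlonglongrightarrow> line_int x y + line_int y z + line_int z x"
  unfolding boundary_sum_def by (intro tendsto_add trapezoid_sum_tendsto)

lemma bsum_measurable: "(\<lambda>x. bsum N x (x + u) (x + v)) \<in> borel_measurable borel"
  unfolding boundary_sum_def
  by (intro borel_measurable_continuous_onI continuous_on_add[OF continuous_on_add] continuous_trapezoid_sum continuous_intros)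

text \<open>After \<open>N\<close> subdivisions the boundary sum of a triangle is the sum over
\<open>4^N\<close> small triangles, which are translates of \<open>\<plusminus> 2^-N\<close> times
the original one. Integrated over the base point, all of them are bounded by the same two
integrals over \<open>U\<close>.\<close>

lemma nn_integral_bsum_le:
  assumes U: "convex U" "U \<in> sets borel"
    and V: "V \<in> sets borel" "\<And>x. x \<in> V \<Longrightarrow> x \<in> U \<and> x + u \<in> U \<and> x + v \<in> U"
    and E: "\<And>u v. E u v = (\<integral>\<^sup>+x. ennreal \<bar>bsum 0 x (x + u) (x + v)\<bar> * indicator U x \<partial>lborel)"
  shows "(\<integral>\<^sup>+x. ennreal \<bar>bsum N x (x + u) (x + v)\<bar> * indicator V x \<partial>lborel)
    \<le> 4^N * (E ((1/2)^N *\<^sub>R u) ((1/2)^N *\<^sub>R v) + E ((1/2)^N *\<^sub>R (- u)) ((1/2)^N *\<^sub>R (- v)))"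
  using V
proof (induction N arbitrary: V u v)
  case 0
  have "(\<integral>\<^sup>+x. ennreal \<bar>bsum 0 x (x + u) (x + v)\<bar> * indicator V x \<partial>lborel) \<le> E u v"
    unfolding E by (rule nn_integral_mono) (use 0 in \<open>auto simp: indicator_def\<close>)
  also have "\<dots> \<le> E u v + E (- u) (- v)" by (simp add: add_increasing2)
  finally show ?case by simp
next
  case (Suc N)
  note [measurable] = Suc.prems(1) U(2) bsum_measurable
  define u2 where "u2 = (1/2::real) *\<^sub>R u" define v2 where "v2 = (1/2::real) *\<^sub>R v"
  let ?J = "\<lambda>w p q. \<integral>\<^sup>+x. ennreal \<bar>bsum N (x + w) (x + w + p) (x + w + q)\<bar> * indicator V x \<partial>lborel"
  let ?R = "4^N * (E ((1/2)^Suc N *\<^sub>R u) ((1/2)^Suc N *\<^sub>R v) + E ((1/2)^Suc N *\<^sub>R (- u)) ((1/2)^Suc N *\<^sub>R (- v)))"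
  have mid: "midpoint p q \<in> U" if "p \<in> U" "q \<in> U" for p q
    using U(1) that by (metis convexD_alt convex_contains_segment midpoint_in_closed_segment subsetD)
  have m: "midpoint x (x + u) = x + u2" "midpoint x (x + v) = x + v2" "midpoint (x + u) (x + v) = x + (u2 + v2)"
    "x + u = x + u2 + u2" "x + v = x + v2 + v2" for x
    by (simp_all add: midpoint_def u2_def v2_def algebra_simps flip: scaleR_add_left)
  have inU: "x \<in> U" "x + u2 \<in> U" "x + v2 \<in> U" "x + (u2 + v2) \<in> U" "x + u \<in> U" "x + v \<in> U" if "x \<in> V" for x
    using Suc.prems(2)[OF that] mid[of x "x + u"] mid[of x "x + v"] mid[of "x + u" "x + v"] unfolding m(1-3) by auto
  have shift: "?J w p q \<le> 4^N * (E ((1/2)^N *\<^sub>R p) ((1/2)^N *\<^sub>R q) + E ((1/2)^N *\<^sub>R (- p)) ((1/2)^N *\<^sub>R (- q)))"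
    if "\<And>x. x \<in> V \<Longrightarrow> x + w \<in> U \<and> x + w + p \<in> U \<and> x + w + q \<in> U" for w p q
  proof -
    let ?V = "{x. x - w \<in> V}"
    have V': "?V \<in> sets borel" by measurable
    have "?J w p q = (\<integral>\<^sup>+x. (\<lambda>y. ennreal \<bar>bsum N y (y + p) (y + q)\<bar> * indicator ?V y) (x + w) \<partial>lborel)"
      by (simp add: indicator_def)
    also have "\<dots> = (\<integral>\<^sup>+x. ennreal \<bar>bsum N x (x + p) (x + q)\<bar> * indicator ?V x \<partial>lborel)"
      by (rule nn_integral_shift) (use V' in measurable)
    also have "\<dots> \<le> 4^N * (E ((1/2)^N *\<^sub>R p) ((1/2)^N *\<^sub>R q) + E ((1/2)^N *\<^sub>R (- p)) ((1/2)^N *\<^sub>R (- q)))"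
      by (rule Suc.IH[OF V']) (use that[of "_ - w"] in auto)
    finally show ?thesis .
  qed
  have eq: "bsum (Suc N) x (x + u) (x + v) = bsum N (x + 0) (x + 0 + u2) (x + 0 + v2) + bsum N (x + u2) (x + u2 + u2) (x + u2 + v2)
      + bsum N (x + v2) (x + v2 + u2) (x + v2 + v2) + bsum N (x + (u2 + v2)) (x + (u2 + v2) + - u2) (x + (u2 + v2) + - v2)" for x
  proof -
    have m': "x + 0 = x" "x + 0 + p = x + p" "x + u2 + v2 = x + (u2 + v2)" "x + v2 + u2 = x + (u2 + v2)"
      "x + (u2 + v2) + - u2 = x + v2" "x + (u2 + v2) + - v2 = x + u2" for p
      by (simp_all add: algebra_simps)
    show ?thesis
      unfolding boundary_sum_Suc m(1-3) m' m(4,5)[symmetric] by simp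
  qed
  have R1: "?J 0 u2 v2 \<le> ?R" "?J u2 u2 v2 \<le> ?R" "?J v2 u2 v2 \<le> ?R"
  proof -
    have R: "?R = 4^N * (E ((1/2)^N *\<^sub>R u2) ((1/2)^N *\<^sub>R v2) + E ((1/2)^N *\<^sub>R (- u2)) ((1/2)^N *\<^sub>R (- v2)))"
      by (simp add: u2_def v2_def mult.commute)
    have c: "x + u2 + v2 = x + (u2 + v2)" "x + v2 + u2 = x + (u2 + v2)" for x by (simp_all add: add_ac)
    show "?J 0 u2 v2 \<le> ?R" unfolding R by (rule shift) (use inU in simp)
    show "?J u2 u2 v2 \<le> ?R" unfolding R by (rule shift) (use inU in \<open>simp add: c m(4)[symmetric]\<close>)
    show "?J v2 u2 v2 \<le> ?R" unfolding R by (rule shift) (use inU in \<open>simp add: c m(5)[symmetric]\<close>)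
  qed
  have R2: "?J (u2 + v2) (- u2) (- v2) \<le> ?R"
  proof -
    have R: "?R = 4^N * (E ((1/2)^N *\<^sub>R (- u2)) ((1/2)^N *\<^sub>R (- v2)) + E ((1/2)^N *\<^sub>R (- (- u2))) ((1/2)^N *\<^sub>R (- (- v2))))"
      by (simp add: u2_def v2_def mult.commute add.commute)
    have c: "x + (u2 + v2) + - u2 = x + v2" "x + (u2 + v2) + - v2 = x + u2" for x by (simp_all add: algebra_simps)
    show ?thesis unfolding R by (rule shift) (use inU in \<open>simp only: c simp_thms\<close>)
  qed
  have "(\<integral>\<^sup>+x. ennreal \<bar>bsum (Suc N) x (x + u) (x + v)\<bar> * indicator V x \<partial>lborel)
     \<le> (\<integral>\<^sup>+x. ((ennreal \<bar>bsum N (x + 0) (x + 0 + u2) (x + 0 + v2)\<bar> * indicator V x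
          + ennreal \<bar>bsum N (x + u2) (x + u2 + u2) (x + u2 + v2)\<bar> * indicator V x)
        + ennreal \<bar>bsum N (x + v2) (x + v2 + u2) (x + v2 + v2)\<bar> * indicator V x)
        + ennreal \<bar>bsum N (x + (u2 + v2)) (x + (u2 + v2) + - u2) (x + (u2 + v2) + - v2)\<bar> * indicator V x \<partial>lborel)"
  proof (rule nn_integral_mono)
    fix x
    have "ennreal \<bar>p + q + r + s\<bar> \<le> ennreal \<bar>p\<bar> + ennreal \<bar>q\<bar> + ennreal \<bar>r\<bar> + ennreal \<bar>s\<bar>" for p q r s :: real
      by (simp flip: ennreal_plus add: ennreal_leI)
    then show "ennreal \<bar>bsum (Suc N) x (x + u) (x + v)\<bar> * indicator V x \<le> ((ennreal \<bar>bsum N (x + 0) (x + 0 + u2) (x + 0 + v2)\<bar> * indicator V x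
          + ennreal \<bar>bsum N (x + u2) (x + u2 + u2) (x + u2 + v2)\<bar> * indicator V x)
        + ennreal \<bar>bsum N (x + v2) (x + v2 + u2) (x + v2 + v2)\<bar> * indicator V x)
        + ennreal \<bar>bsum N (x + (u2 + v2)) (x + (u2 + v2) + - u2) (x + (u2 + v2) + - v2)\<bar> * indicator V x"
      unfolding eq by (cases "x \<in> V") auto
  qed
  also have "\<dots> = ?J 0 u2 v2 + ?J u2 u2 v2 + ?J v2 u2 v2 + ?J (u2 + v2) (- u2) (- v2)"
  proof -
    have meas: "(\<lambda>x. ennreal \<bar>bsum N (x + w) (x + w + p) (x + w + q)\<bar> * indicator V x) \<in> borel_measurable lborel" for w p q
    proof -
      have "(\<lambda>x. (\<lambda>y. bsum N y (y + p) (y + q)) (x + w)) \<in> borel_measurable borel"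
        by (rule measurable_compose[OF _ bsum_measurable]) measurable
      then show ?thesis by measurable
    qed
    show ?thesis by (simp only: nn_integral_add meas borel_measurable_add)
  qed
  also have "\<dots> \<le> ?R + ?R + ?R + ?R" by (intro add_mono R1 R2)
  also have "\<dots> = 4^Suc N * (E ((1/2)^Suc N *\<^sub>R u) ((1/2)^Suc N *\<^sub>R v) + E ((1/2)^Suc N *\<^sub>R (- u)) ((1/2)^Suc N *\<^sub>R (- v)))"
  proof -
    have "c + c + c + c = 4 * c" for c :: ennreal
      by (metis (no_types, opaque_lifting) add.assoc mult_2 numeral_Bit0 distrib_right)
    then show ?thesis by (simp add: mult.assoc)
  qed
  finally show ?case .
qed

text \<open>Stokes' theorem for functions with vanishing Jacobian. The hypothesis says that small
triangles at almost every point have image area \<open>o(4^-N)\<close>; summed over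
\<open>4^N\<close> triangles and averaged over translates this tends to zero. So the integral
around a triangle vanishes for almost every translate, then for every translate by continuity, and
on the closure of \<open>U\<close> by continuity again.\<close>

theorem line_int_triangle:
  assumes U: "convex U" "open U" "bounded U"
    and H: "\<And>u v. AE x in lborel. x \<in> U \<longrightarrow> (\<lambda>N. 4^N * bsum 0 x (x + (1/2)^N *\<^sub>R u) (x + (1/2)^N *\<^sub>R v)) \<longlonglongrightarrow> 0"
    and xyz: "x \<in> closure U" "y \<in> closure U" "z \<in> closure U"
  shows "line_int x y + line_int y z + line_int z x = 0"
proof -
  have Ub[measurable]: "U \<in> sets borel" using U(2) by simp
  define E where "E = (\<lambda>u v. \<integral>\<^sup>+x. ennreal \<bar>bsum 0 x (x + u) (x + v)\<bar> * indicator U x \<partial>lborel)"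
  note [measurable] = bsum_measurable
  have E: "(\<lambda>N. 4^N * E ((1/2)^N *\<^sub>R u) ((1/2)^N *\<^sub>R v)) \<longlonglongrightarrow> 0" for u v
  proof -
    define c where "c = K\<^sup>2 * norm u * norm v"
    let ?b = "\<lambda>N x. 4^N * bsum 0 x (x + (1/2)^N *\<^sub>R u) (x + (1/2)^N *\<^sub>R v)"
    have eq: "4^N * E ((1/2)^N *\<^sub>R u) ((1/2)^N *\<^sub>R v) = (\<integral>\<^sup>+x. ennreal \<bar>?b N x\<bar> * indicator U x \<partial>lborel)" for N
    proof -
      have "4^N * E ((1/2)^N *\<^sub>R u) ((1/2)^N *\<^sub>R v)
         = (\<integral>\<^sup>+x. 4^N * (ennreal \<bar>bsum 0 x (x + (1/2)^N *\<^sub>R u) (x + (1/2)^N *\<^sub>R v)\<bar> * indicator U x) \<partial>lborel)"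
        unfolding E_def by (rule nn_integral_cmult[symmetric]) measurable
      also have "\<dots> = (\<integral>\<^sup>+x. ennreal \<bar>?b N x\<bar> * indicator U x \<partial>lborel)"
      proof (rule nn_integral_cong)
        fix x
        have "(4::ennreal)^N = ennreal (4^N)" by (simp flip: ennreal_power)
        then show "4^N * (ennreal \<bar>bsum 0 x (x + (1/2)^N *\<^sub>R u) (x + (1/2)^N *\<^sub>R v)\<bar> * indicator U x) = ennreal \<bar>?b N x\<bar> * indicator U x"
          by (simp add: abs_mult ennreal_mult mult.assoc)
      qed
      finally show ?thesis .
    qed
    have bd: "\<bar>?b N x\<bar> \<le> c" for N x
    proof -
      have "\<bar>bsum 0 x (x + (1/2)^N *\<^sub>R u) (x + (1/2)^N *\<^sub>R v)\<bar> \<le> K\<^sup>2 * ((1/2)^N * norm u) * ((1/2)^N * norm v)"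
        using bsum_0_le[of x "x + (1/2)^N *\<^sub>R u" "x + (1/2)^N *\<^sub>R v"] by simp
      then have "4^N * \<bar>bsum 0 x (x + (1/2)^N *\<^sub>R u) (x + (1/2)^N *\<^sub>R v)\<bar> \<le> 4^N * (K\<^sup>2 * ((1/2)^N * norm u) * ((1/2)^N * norm v))"
        by (rule mult_left_mono) simp
      also have "\<dots> = ((4::real)^N * ((1/2)^N * (1/2)^N)) * c" by (simp add: c_def)
      also have "(4::real)^N * ((1/2)^N * (1/2)^N) = 1" by (simp flip: power_mult_distrib)
      finally show ?thesis by (simp add: abs_mult)
    qed
    have "(\<lambda>N. \<integral>\<^sup>+x. ennreal \<bar>?b N x\<bar> * indicator U x \<partial>lborel) \<longlonglongrightarrow> (\<integral>\<^sup>+x. 0 \<partial>(lborel :: 'a measure))"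
    proof (rule nn_integral_dominated_convergence[where w = "\<lambda>x. ennreal c * indicator U x"])
      show "AE x in lborel. ennreal \<bar>?b N x\<bar> * indicator U x \<le> ennreal c * indicator U x" for N
        using bd by (auto simp: indicator_def intro!: ennreal_leI)
      have "(\<integral>\<^sup>+x. ennreal c * indicator U x \<partial>lborel) = ennreal c * emeasure lborel U"
        by (rule nn_integral_cmult_indicator) simp
      then show "(\<integral>\<^sup>+x. ennreal c * indicator U x \<partial>lborel) < \<infinity>"
        using emeasure_bounded_finite[OF U(3)] by (simp add: ennreal_mult_less_top)
      show "AE x in lborel. (\<lambda>N. ennreal \<bar>?b N x\<bar> * indicator U x) \<longlonglongrightarrow> 0"
        using H[of u v]
      proof eventually_elim
        case (elim x)
        show ?case
        proof (cases "x \<in> U")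
          case True
          then have "(\<lambda>N. \<bar>?b N x\<bar>) \<longlonglongrightarrow> 0" using elim tendsto_rabs_zero by blast
          then have "(\<lambda>N. ennreal \<bar>?b N x\<bar>) \<longlonglongrightarrow> ennreal 0" by (rule tendsto_ennrealI)
          then show ?thesis using True by simp
        qed simp
      qed
    qed measurable
    then show ?thesis unfolding eq by simp
  qed
  define T where "T = (\<lambda>(x, y, z). line_int x y + line_int y z + line_int z x)"
  have inU: "T (x, y, z) = 0" if x: "x \<in> U" and y: "y \<in> U" and z: "z \<in> U" for x y z
  proof -
    define u where "u = y - x" define v where "v = z - x"
    define V where "V = U \<inter> (\<lambda>x. x + u) -` U \<inter> (\<lambda>x. x + v) -` U"
    have "open V" unfolding V_def by (intro open_Int open_vimage U continuous_intros)
    then have Vb[measurable]: "V \<in> sets borel" by simp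
    let ?I = "\<lambda>N. \<integral>\<^sup>+x. ennreal \<bar>bsum N x (x + u) (x + v)\<bar> * indicator V x \<partial>lborel"
    let ?R = "\<lambda>N. 4^N * (E ((1/2)^N *\<^sub>R u) ((1/2)^N *\<^sub>R v) + E ((1/2)^N *\<^sub>R (- u)) ((1/2)^N *\<^sub>R (- v)))"
    have "?I N \<le> ?R N" for N
      by (rule nn_integral_bsum_le[OF U(1) Ub Vb]) (auto simp: V_def E_def)
    moreover have R0: "?R \<longlonglongrightarrow> 0"
      using tendsto_add[OF E[of u v] E[of "- u" "- v"]] by (simp add: distrib_left)
    ultimately have "?I \<longlonglongrightarrow> 0"
      by (intro tendsto_sandwich[OF _ _ tendsto_const R0]) auto
    then have lim0: "liminf ?I = 0" by (simp add: lim_imp_Liminf)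
    define t where "t = (\<lambda>x. T (x, x + u, x + v))"
    have tl: "(\<lambda>N. bsum N x (x + u) (x + v)) \<longlonglongrightarrow> t x" for x
      unfolding t_def T_def using bsum_tendsto by simp
    have tm[measurable]: "t \<in> borel_measurable borel"
      by (rule borel_measurable_LIMSEQ_real[OF tl bsum_measurable])
    have "(\<integral>\<^sup>+x. ennreal \<bar>t x\<bar> * indicator V x \<partial>lborel)
        = (\<integral>\<^sup>+x. liminf (\<lambda>N. ennreal \<bar>bsum N x (x + u) (x + v)\<bar> * indicator V x) \<partial>lborel)"
    proof (rule nn_integral_cong)
      fix x
      have "(\<lambda>N. ennreal \<bar>bsum N x (x + u) (x + v)\<bar>) \<longlonglongrightarrow> ennreal \<bar>t x\<bar>"
        by (intro tendsto_ennrealI tendsto_rabs tl)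
      then have "(\<lambda>N. ennreal \<bar>bsum N x (x + u) (x + v)\<bar> * indicator V x) \<longlonglongrightarrow> ennreal \<bar>t x\<bar> * indicator V x"
        by (cases "x \<in> V") auto
      then show "ennreal \<bar>t x\<bar> * indicator V x = liminf (\<lambda>N. ennreal \<bar>bsum N x (x + u) (x + v)\<bar> * indicator V x)"
        by (simp add: lim_imp_Liminf)
    qed
    also have "\<dots> \<le> liminf ?I" by (rule nn_integral_liminf) measurable
    finally have "(\<integral>\<^sup>+x. ennreal \<bar>t x\<bar> * indicator V x \<partial>lborel) = 0" using lim0 by simp
    then have "AE x in lborel. ennreal \<bar>t x\<bar> * indicator V x = 0"
      by (subst nn_integral_0_iff_AE[symmetric]) (simp_all del: mult_eq_0_iff)
    then have ae: "AE x in lborel. x \<notin> {x \<in> V. t x \<noteq> 0}"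
      by eventually_elim (auto simp: ennreal_eq_0_iff split: split_indicator_asm)
    have "continuous_on V t"
      unfolding t_def T_def prod.case
      by (intro continuous_on_add continuous_line_int[where R = "norm u + norm v"] continuous_intros)
        (auto intro: norm_triangle_ineq4 simp: norm_minus_commute algebra_simps order_trans[OF norm_triangle_ineq4])
    then have op: "open {x \<in> V. t x \<noteq> 0}"
      using continuous_open_preimage[OF _ \<open>open V\<close>, of t "- {0}"] by (simp add: vimage_def Int_def open_Compl)
    then have "{x \<in> V. t x \<noteq> 0} \<in> null_sets lborel"
      using ae by (subst (asm) AE_iff_null_sets[symmetric]) auto
    then have "negligible {x \<in> V. t x \<noteq> 0}" by (simp add: negligible_iff_null_sets null_sets_completionI)
    then have "{x \<in> V. t x \<noteq> 0} = {}" using open_not_negligible[OF op] by blast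
    moreover have "x \<in> V" using x y z by (simp add: V_def u_def v_def)
    ultimately have "t x = 0" by blast
    then show ?thesis by (simp add: t_def u_def v_def)
  qed
  have "bounded (closure U)" by (rule bounded_closure[OF U(3)])
  then obtain R where R: "\<And>p. p \<in> closure U \<Longrightarrow> norm p \<le> R" by (auto simp: bounded_iff)
  have R2: "norm (p - q) \<le> 2 * R" if "p \<in> closure U" "q \<in> closure U" for p q
    using norm_triangle_ineq4[of p q] R[OF that(1)] R[OF that(2)] by linarith
  have cl: "closure (U \<times> U \<times> U) = closure U \<times> closure U \<times> closure U" by (simp add: closure_Times)
  have "continuous_on (closure (U \<times> U \<times> U)) T"
    unfolding cl T_def case_prod_unfold
    by (intro continuous_on_add continuous_line_int[where R = "2 * R"] continuous_intros) (auto intro!: R2)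
  then have "T (x, y, z) = 0"
    by (rule continuous_constant_on_closure) (use inU xyz in \<open>auto simp: cl\<close>)
  then show ?thesis by (simp add: T_def)
qed

end

section \<open>Length along segments and vanishing Jacobians\<close>

context lipschitz_into
begin

abbreviation "dyadic_len \<equiv> dyadic_sum (\<lambda>x y. mdist M (F x) (F y))"

lemma dyadic_len_Suc_ge: "dyadic_len N x y \<le> dyadic_len (Suc N) x y"
proof (induction N arbitrary: x y)
  case 0
  show ?case using tri by simp
next
  case (Suc N)
  show ?case
    using add_mono[OF Suc.IH[of x "midpoint x y"] Suc.IH[of "midpoint x y" y]]
    unfolding dyadic_sum.simps(2)[of _ "Suc N" x y] dyadic_sum.simps(2)[of _ N x y] .
qed

lemma dyadic_len_le: "dyadic_len N x y \<le> L * norm (x - y)"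
proof (induction N arbitrary: x y)
  case 0
  show ?case using lip by simp
next
  case (Suc N)
  have n: "norm (x - midpoint x y) = norm (x - y) / 2" "norm (midpoint x y - y) = norm (x - y) / 2"
    using dist_midpoint(1)[of x y] dist_midpoint(4)[of x y] by (auto simp: dist_norm)
  show ?case using Suc.IH[of x "midpoint x y"] Suc.IH[of "midpoint x y" y] unfolding n by simp
qed

lemma dyadic_len_incseq: "incseq (\<lambda>N. dyadic_len N x y)"
  by (rule incseq_SucI) (rule dyadic_len_Suc_ge)

text \<open>The length of the image of a segment under \<open>F\<close>. Dyadic subdivisions
suffice, and make the length additive under bisection by construction.\<close>

definition seg_len :: "'a \<Rightarrow> 'a \<Rightarrow> real" where
  "seg_len x y = (SUP N. dyadic_len N x y)"

lemma dyadic_len_tendsto_seg_len: "(\<lambda>N. dyadic_len N x y) \<longlonglongrightarrow> seg_len x y"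
  unfolding seg_len_def by (rule LIMSEQ_incseq_SUP[OF _ dyadic_len_incseq]) (use dyadic_len_le in \<open>auto intro!: bdd_aboveI\<close>)

lemma dyadic_len_le_seg_len: "dyadic_len N x y \<le> seg_len x y"
  by (rule incseq_le[OF dyadic_len_incseq dyadic_len_tendsto_seg_len])

lemma mdist_le_seg_len: "mdist M (F x) (F y) \<le> seg_len x y"
  using dyadic_len_le_seg_len[of 0] by simp

lemma seg_len_nonneg: "0 \<le> seg_len x y"
  using order_trans[OF mdist_nonneg mdist_le_seg_len] .

lemma seg_len_le: "seg_len x y \<le> L * norm (x - y)"
  by (rule LIMSEQ_le_const2[OF dyadic_len_tendsto_seg_len]) (use dyadic_len_le in auto)

lemma seg_len_midpoint: "seg_len x y = seg_len x (midpoint x y) + seg_len (midpoint x y) y"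
proof (rule LIMSEQ_unique)
  show "(\<lambda>N. dyadic_len (Suc N) x y) \<longlonglongrightarrow> seg_len x y" by (rule LIMSEQ_Suc[OF dyadic_len_tendsto_seg_len])
  show "(\<lambda>N. dyadic_len (Suc N) x y) \<longlonglongrightarrow> seg_len x (midpoint x y) + seg_len (midpoint x y) y"
    unfolding dyadic_sum.simps by (intro tendsto_add dyadic_len_tendsto_seg_len)
qed

lemma seg_len_commute: "seg_len y x = seg_len x y"
  unfolding seg_len_def by (subst dyadic_sum_commute) (auto simp: mdist_commute)

definition mean_length :: "'a \<Rightarrow> nat \<Rightarrow> 'a \<Rightarrow> real" where
  "mean_length w j x = seg_len x (x + (1/2)^j *\<^sub>R w) * 2^j"

lemma dyadic_len_measurable: "(\<lambda>x. dyadic_len N (x + u) (x + v)) \<in> borel_measurable borel"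
  by (rule borel_measurable_continuous_onI, rule continuous_dyadic_sum)
     (auto intro!: continuous_mdist continuous_intros)

lemma mean_length_measurable [measurable]: "mean_length w j \<in> borel_measurable borel"
proof -
  have "(\<lambda>x. dyadic_len N x (x + (1/2)^j *\<^sub>R w) * 2^j) \<in> borel_measurable borel" for N
    using dyadic_len_measurable[of N 0] by simp
  moreover have "(\<lambda>N. dyadic_len N x (x + (1/2)^j *\<^sub>R w) * 2^j) \<longlonglongrightarrow> mean_length w j x" for x
    unfolding mean_length_def by (intro tendsto_mult tendsto_const dyadic_len_tendsto_seg_len)
  ultimately show ?thesis by (rule borel_measurable_LIMSEQ_real[rotated])
qed

lemma mean_length_nonneg: "0 \<le> mean_length w j x"
  by (simp add: mean_length_def seg_len_nonneg)

text \<open>The \<open>N\<close>-th dyadic sum for the length of a short segment, once normalized,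
is the average of \<open>2^N\<close> speed quotients of step \<open>2^-(j+N)\<close> at base
points close to \<open>x\<close>. Each of them is close to the speed in \<open>L\<^sup>1\<close>
by the uniform translation lemma; the induction on \<open>N\<close> halves and doubles, and
Fatou's lemma passes to the length.\<close>

lemma L1_conv_mean_length: "L1_conv (mean_length w) (speed w)"
  unfolding L1_conv_def
proof (intro conjI allI)
  fix r :: real
  let ?B = "cball 0 r :: 'a set"
  let ?t = "\<lambda>j. (1/2::real)^j"
  let ?I = "\<lambda>j. \<integral>\<^sup>+x. ennreal \<bar>mean_length w j x - speed w x\<bar> * indicator ?B x \<partial>lborel"
  show "?I \<longlonglongrightarrow> 0"
  proof (rule order_tendstoI)
    fix d' :: ennreal assume "0 < d'"
    then obtain d :: ennreal where d: "0 < d" "d < d'" using dense by blast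
    obtain \<delta> J where J: "\<delta> > 0" "\<And>j v. J \<le> j \<Longrightarrow> norm v < \<delta> \<Longrightarrow>
       (\<integral>\<^sup>+x. ennreal \<bar>speed_quot w j (x + v) - speed w x\<bar> * indicator ?B x \<partial>lborel) < d"
      using L1_conv_shift_uniform[OF L1_conv_speed_quot speed_quot_lipschitz d(1)] by blast
    let ?G = "\<lambda>N j v x. dyadic_len N (x + v) (x + v + ?t j *\<^sub>R w) * 2^j"
    have Gm: "?G N j v \<in> borel_measurable borel" for N j v
      using dyadic_len_measurable[of N v "v + ?t j *\<^sub>R w"] by (simp add: add.assoc)
    have G: "(\<integral>\<^sup>+x. ennreal \<bar>?G N j v x - speed w x\<bar> * indicator ?B x \<partial>lborel) \<le> d"
      if "J \<le> j" "norm v + ?t j * norm w < \<delta>" for N j v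
      using that
    proof (induction N arbitrary: j v)
      case 0
      have "norm v < \<delta>" using 0 by (smt (verit) mult_nonneg_nonneg norm_ge_zero zero_le_power half_gt_zero)
      then show ?case using J(2)[OF 0(1), of v] by (simp add: speed_quot_def mdist_commute)
    next
      case (Suc N)
      let ?v = "v + ?t (Suc j) *\<^sub>R w"
      have tt: "?t j *\<^sub>R w = ?t (Suc j) *\<^sub>R w + ?t (Suc j) *\<^sub>R w"
        by (simp flip: scaleR_add_left)
      have mid: "midpoint (x + v) (x + v + ?t j *\<^sub>R w) = x + ?v" for x
        by (simp add: midpoint_def algebra_simps flip: scaleR_add_left)
      have Geq: "?G (Suc N) j v x = (?G N (Suc j) v x + ?G N (Suc j) ?v x) / 2" for x
      proof -
        have e: "x + v + ?t j *\<^sub>R w = x + ?v + ?t (Suc j) *\<^sub>R w" "x + ?v = x + v + ?t (Suc j) *\<^sub>R w"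
          unfolding tt by (simp_all only: add.assoc)
        have "?G (Suc N) j v x = (dyadic_len N (x + v) (x + ?v) + dyadic_len N (x + ?v) (x + ?v + ?t (Suc j) *\<^sub>R w)) * 2^j"
          unfolding dyadic_sum.simps mid unfolding e(1) ..
        also have "\<dots> = (dyadic_len N (x + v) (x + v + ?t (Suc j) *\<^sub>R w) + dyadic_len N (x + ?v) (x + ?v + ?t (Suc j) *\<^sub>R w)) * 2^j"
          unfolding e(2)[symmetric] ..
        finally have 1: "?G (Suc N) j v x = (dyadic_len N (x + v) (x + v + ?t (Suc j) *\<^sub>R w) + dyadic_len N (x + ?v) (x + ?v + ?t (Suc j) *\<^sub>R w)) * 2^j" .
        have "(X + Y) * 2^j = (X * 2^Suc j + Y * 2^Suc j) / 2" for X Y :: real by (simp add: algebra_simps)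
        then show ?thesis unfolding 1 .
      qed
      have IH1: "(\<integral>\<^sup>+x. ennreal \<bar>?G N (Suc j) v x - speed w x\<bar> * indicator ?B x \<partial>lborel) \<le> d"
      proof (rule Suc.IH)
        have "?t (Suc j) * norm w \<le> ?t j * norm w" by (intro mult_right_mono power_decreasing) auto
        then show "norm v + ?t (Suc j) * norm w < \<delta>" using Suc.prems(2) by linarith
      qed (use Suc.prems in simp)
      have IH2: "(\<integral>\<^sup>+x. ennreal \<bar>?G N (Suc j) ?v x - speed w x\<bar> * indicator ?B x \<partial>lborel) \<le> d"
      proof (rule Suc.IH)
        have "norm ?v \<le> norm v + ?t (Suc j) * norm w"
          using norm_triangle_ineq[of v "?t (Suc j) *\<^sub>R w"] by simp
        moreover have "?t (Suc j) * norm w + ?t (Suc j) * norm w = ?t j * norm w" by simp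
        ultimately show "norm ?v + ?t (Suc j) * norm w < \<delta>" using Suc.prems(2) by linarith
      qed (use Suc.prems in simp)
      note [measurable] = Gm
      have "(\<integral>\<^sup>+x. ennreal \<bar>?G (Suc N) j v x - speed w x\<bar> * indicator ?B x \<partial>lborel)
         \<le> (\<integral>\<^sup>+x. ennreal (1/2) * (ennreal \<bar>?G N (Suc j) v x - speed w x\<bar> * indicator ?B x
              + ennreal \<bar>?G N (Suc j) ?v x - speed w x\<bar> * indicator ?B x) \<partial>lborel)"
      proof (rule nn_integral_mono)
        fix x
        have "\<bar>?G (Suc N) j v x - speed w x\<bar> \<le> 1/2 * (\<bar>?G N (Suc j) v x - speed w x\<bar> + \<bar>?G N (Suc j) ?v x - speed w x\<bar>)"
          unfolding Geq by (simp add: abs_if field_simps)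
        then have "ennreal \<bar>?G (Suc N) j v x - speed w x\<bar>
           \<le> ennreal (1/2) * (ennreal \<bar>?G N (Suc j) v x - speed w x\<bar> + ennreal \<bar>?G N (Suc j) ?v x - speed w x\<bar>)"
          by (subst ennreal_plus[symmetric], simp, simp, subst ennreal_mult[symmetric]) (auto intro: ennreal_leI)
        then show "ennreal \<bar>?G (Suc N) j v x - speed w x\<bar> * indicator ?B x \<le> ennreal (1/2) * (ennreal \<bar>?G N (Suc j) v x - speed w x\<bar> * indicator ?B x
              + ennreal \<bar>?G N (Suc j) ?v x - speed w x\<bar> * indicator ?B x)"
          by (cases "x \<in> ?B") (auto simp del: dyadic_sum.simps)
      qed
      also have "\<dots> = ennreal (1/2) * ((\<integral>\<^sup>+x. ennreal \<bar>?G N (Suc j) v x - speed w x\<bar> * indicator ?B x \<partial>lborel)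
          + (\<integral>\<^sup>+x. ennreal \<bar>?G N (Suc j) ?v x - speed w x\<bar> * indicator ?B x \<partial>lborel))"
        by (subst nn_integral_cmult, measurable, subst nn_integral_add, measurable)
      also have "\<dots> \<le> ennreal (1/2) * (d + d)" by (intro mult_left_mono add_mono IH1 IH2) simp
      also have "\<dots> = d"
      proof -
        have "ennreal (1/2) * (d + d) = (ennreal (1/2) + ennreal (1/2)) * d" by (simp only: distrib_left distrib_right)
        also have "ennreal (1/2) + ennreal (1/2) = ennreal (1/2 + 1/2)" by (rule ennreal_plus[symmetric]) auto
        finally show ?thesis by simp
      qed
      finally show ?case .
    qed
    have "(\<lambda>j. ?t j * norm w) \<longlonglongrightarrow> 0 * norm w"
      by (intro tendsto_mult tendsto_const LIMSEQ_realpow_zero) auto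
    then have "\<forall>\<^sub>F j in sequentially. ?t j * norm w < \<delta>" using J(1) by (intro order_tendstoD(2)) auto
    then show "\<forall>\<^sub>F j in sequentially. ?I j < d'"
      using eventually_ge_at_top[of J]
    proof eventually_elim
      case (elim j)
      note [measurable] = Gm[where j = j and v = 0]
      have "?I j = (\<integral>\<^sup>+x. liminf (\<lambda>N. ennreal \<bar>?G N j 0 x - speed w x\<bar> * indicator ?B x) \<partial>lborel)"
      proof (rule nn_integral_cong)
        fix x
        have "(\<lambda>N. ennreal \<bar>?G N j 0 x - speed w x\<bar>) \<longlonglongrightarrow> ennreal \<bar>mean_length w j x - speed w x\<bar>"
          unfolding mean_length_def add_0_right
          by (intro tendsto_ennrealI tendsto_rabs tendsto_diff tendsto_mult dyadic_len_tendsto_seg_len tendsto_const)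
        then have "(\<lambda>N. ennreal \<bar>?G N j 0 x - speed w x\<bar> * indicator ?B x) \<longlonglongrightarrow> ennreal \<bar>mean_length w j x - speed w x\<bar> * indicator ?B x"
          by (cases "x \<in> ?B") auto
        then show "ennreal \<bar>mean_length w j x - speed w x\<bar> * indicator ?B x = liminf (\<lambda>N. ennreal \<bar>?G N j 0 x - speed w x\<bar> * indicator ?B x)"
          by (simp add: lim_imp_Liminf)
      qed
      also have "\<dots> \<le> liminf (\<lambda>N. \<integral>\<^sup>+x. ennreal \<bar>?G N j 0 x - speed w x\<bar> * indicator ?B x \<partial>lborel)"
        by (rule nn_integral_liminf) measurable
      also have "\<dots> \<le> liminf (\<lambda>N::nat. d)"
        by (rule Liminf_mono) (use G[OF elim(2), of 0] elim(1) in auto)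
      also have "\<dots> = d" by (simp add: Liminf_const)
      finally show ?case using d(2) by (rule le_less_trans)
    qed
  qed simp
qed auto

end

definition diff_quot :: "('a::euclidean_space \<Rightarrow> real) \<Rightarrow> 'a \<Rightarrow> nat \<Rightarrow> 'a \<Rightarrow> real" where
  "diff_quot a w j x = (a (x + (1/2)^j *\<^sub>R w) - a x) * 2^j"

definition dir_deriv :: "('a::euclidean_space \<Rightarrow> real) \<Rightarrow> 'a \<Rightarrow> 'a \<Rightarrow> real" where
  "dir_deriv a w x = lim (\<lambda>j. diff_quot a w j x)"

locale lipschitz_function =
  fixes a :: "'a::euclidean_space \<Rightarrow> real" and K :: real
  assumes lip: "\<bar>a x - a y\<bar> \<le> K * norm (x - y)"
begin

lemma K_nonneg: "0 \<le> K"
  using lipschitz_into.L_nonneg[OF real_lipschitz_into[OF lip]] .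

lemma continuous: "continuous_on S a"
  by (rule lipschitz_on_continuous_on[of K], rule lipschitz_onI) (auto simp: lip dist_norm K_nonneg)

lemma diff_quot_measurable [measurable]: "diff_quot a w j \<in> borel_measurable borel"
  unfolding diff_quot_def
  by (intro borel_measurable_continuous_onI continuous_on_mult continuous_on_diff
      continuous_on_compose2[OF continuous[of UNIV]] continuous_intros) auto

lemma dir_deriv_measurable [measurable]: "dir_deriv a w \<in> borel_measurable borel"
  unfolding dir_deriv_def by (rule borel_measurable_lim_metric) (rule diff_quot_measurable)

lemma diff_quot_le: "\<bar>diff_quot a w j x\<bar> \<le> K * norm w"
proof -
  have "\<bar>a (x + (1/2)^j *\<^sub>R w) - a x\<bar> \<le> K * ((1/2)^j * norm w)"
    using lip[of "x + (1/2)^j *\<^sub>R w" x] by simp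
  then have "\<bar>a (x + (1/2)^j *\<^sub>R w) - a x\<bar> * 2^j \<le> K * ((1/2)^j * norm w) * 2^j"
    by (rule mult_right_mono) simp
  also have "\<dots> = K * norm w" by (simp add: power_divide)
  finally show ?thesis by (simp add: diff_quot_def abs_mult)
qed

lemma diff_quot_lipschitz: "\<bar>diff_quot a w j x - diff_quot a w j y\<bar> \<le> (2 * K * 2^j) * norm (x - y)"
proof -
  have "\<bar>diff_quot a w j x - diff_quot a w j y\<bar> = \<bar>(a (x + (1/2)^j *\<^sub>R w) - a (y + (1/2)^j *\<^sub>R w)) - (a x - a y)\<bar> * 2^j"
  proof -
    have "diff_quot a w j x - diff_quot a w j y = ((a (x + (1/2)^j *\<^sub>R w) - a (y + (1/2)^j *\<^sub>R w)) - (a x - a y)) * 2^j"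
      by (simp add: diff_quot_def algebra_simps)
    then show ?thesis by (simp add: abs_mult)
  qed
  also have "\<dots> \<le> (K * norm (x - y) + K * norm (x - y)) * 2^j"
    using lip[of "x + (1/2)^j *\<^sub>R w" "y + (1/2)^j *\<^sub>R w"] lip[of x y] by (intro mult_right_mono) auto
  finally show ?thesis by (simp add: algebra_simps)
qed

lemma diff_quot_tendsto:
  assumes "((\<lambda>h. (a (x + h *\<^sub>R w) - a x) / h) \<longlongrightarrow> l) (at 0)"
  shows "(\<lambda>j. diff_quot a w j x) \<longlonglongrightarrow> l"
proof -
  have "filterlim (\<lambda>j. (1/2::real)^j) (at 0) sequentially"
    by (rule filterlim_atI) (auto intro!: LIMSEQ_realpow_zero)
  from filterlim_compose[OF assms this] show ?thesis by (simp add: diff_quot_def power_divide)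
qed

lemma dir_deriv_tendsto_AE: "AE x in lborel. ((\<lambda>h. (a (x + h *\<^sub>R w) - a x) / h) \<longlongrightarrow> dir_deriv a w x) (at 0)"
  using directional_derivative_exists_AE[OF lip, of w]
proof eventually_elim
  case (elim x)
  then obtain l where l: "((\<lambda>h. (a (x + h *\<^sub>R w) - a x) / h) \<longlongrightarrow> l) (at 0)" by blast
  have "dir_deriv a w x = l" unfolding dir_deriv_def by (rule limI) (rule diff_quot_tendsto[OF l])
  then show ?case using l by simp
qed

lemma L1_conv_diff_quot: "L1_conv (diff_quot a w) (dir_deriv a w)"
proof (rule L1_convI_AE)
  show "AE x in lborel. (\<lambda>j. diff_quot a w j x) \<longlonglongrightarrow> dir_deriv a w x"
    using dir_deriv_tendsto_AE[of w] by eventually_elim (rule diff_quot_tendsto)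
qed (auto intro: diff_quot_le)

lemma dir_deriv_add_AE: "AE x in lborel. dir_deriv a (u + v) x = dir_deriv a u x + dir_deriv a v x"
proof -
  have eq: "diff_quot a (u + v) j x = diff_quot a u j (x + (1/2)^j *\<^sub>R v) + diff_quot a v j x" for j x
    by (simp add: diff_quot_def algebra_simps)
  note sum = L1_conv_add[OF L1_conv_shift[OF L1_conv_diff_quot diff_quot_lipschitz, of u v] L1_conv_diff_quot[of v]]
  have "AE x in lborel. dir_deriv a (u + v) x \<le> dir_deriv a u x + dir_deriv a v x"
    by (rule L1_conv_le_AE[OF L1_conv_diff_quot sum]) (simp add: eq)
  moreover have "AE x in lborel. dir_deriv a u x + dir_deriv a v x \<le> dir_deriv a (u + v) x"
    by (rule L1_conv_le_AE[OF sum L1_conv_diff_quot]) (simp add: eq)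
  ultimately show ?thesis by eventually_elim simp
qed

lemma dir_deriv_scale:
  assumes "((\<lambda>h. (a (x + h *\<^sub>R w) - a x) / h) \<longlongrightarrow> dir_deriv a w x) (at 0)"
  shows "dir_deriv a (c *\<^sub>R w) x = c * dir_deriv a w x"
proof (cases "c = 0")
  case True
  have "diff_quot a 0 = (\<lambda>j x. 0)" by (intro ext) (simp add: diff_quot_def)
  then show ?thesis using True by (simp add: dir_deriv_def)
next
  case False
  have "filterlim (\<lambda>h. h * c) (at 0) (at 0)"
  proof (rule filterlim_atI)
    have "((\<lambda>h. h * c) \<longlongrightarrow> 0 * c) (at 0)" by (intro tendsto_intros)
    then show "((\<lambda>h. h * c) \<longlongrightarrow> 0) (at 0)" by simp
  qed (use False in \<open>auto simp: eventually_at_filter\<close>)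
  from tendsto_mult[OF tendsto_const[of c] filterlim_compose[OF assms this]]
  have "((\<lambda>h. (a (x + h *\<^sub>R (c *\<^sub>R w)) - a x) / h) \<longlongrightarrow> c * dir_deriv a w x) (at 0)"
    by (rule Lim_transform_eventually) (use False in \<open>auto simp: eventually_at_filter field_simps\<close>)
  then show ?thesis unfolding dir_deriv_def[of a "c *\<^sub>R w"] by (intro limI diff_quot_tendsto)
qed

lemma dir_deriv_linear_AE:
  "AE x in lborel. \<forall>\<alpha>\<in>\<rat>. \<forall>\<beta>\<in>\<rat>. dir_deriv a (\<alpha> *\<^sub>R u + \<beta> *\<^sub>R v) x = \<alpha> * dir_deriv a u x + \<beta> * dir_deriv a v x"
proof -
  have "AE x in lborel. \<forall>\<alpha>\<in>\<rat>. \<forall>\<beta>\<in>\<rat>. dir_deriv a (\<alpha> *\<^sub>R u + \<beta> *\<^sub>R v) x = dir_deriv a (\<alpha> *\<^sub>R u) x + dir_deriv a (\<beta> *\<^sub>R v) x"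
    unfolding AE_ball_countable[OF countable_rat] using dir_deriv_add_AE by blast
  then show ?thesis
    using dir_deriv_tendsto_AE[of u] dir_deriv_tendsto_AE[of v]
    by eventually_elim (simp add: dir_deriv_scale)
qed

end

context lipschitz_into
begin

text \<open>The difference quotients of \<open>a\<close> are bounded by \<open>K'\<close> times
the normalized length as long as both points lie in \<open>U\<close>; elsewhere they are replaced
by zero, which does not change the limit in the open set \<open>U\<close>.\<close>

lemma dir_deriv_le_speed_AE:
  assumes a: "lipschitz_function a K" and U: "open U" and K': "K' > 0"
    and aU: "\<And>x y. x \<in> U \<Longrightarrow> y \<in> U \<Longrightarrow> \<bar>a x - a y\<bar> \<le> K' * seg_len x y"
  shows "AE x in lborel. x \<in> U \<longrightarrow> \<bar>dir_deriv a w x\<bar> \<le> K' * speed w x"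
proof -
  interpret a: lipschitz_function a K by fact
  define U' where "U' = (\<lambda>j. U \<inter> (\<lambda>x. x + (1/2::real)^j *\<^sub>R w) -` U)"
  have U'o: "open (U' j)" for j unfolding U'_def by (intro open_Int open_vimage U continuous_intros)
  have [measurable]: "U \<in> sets borel" "\<And>j. U' j \<in> sets borel" using U U'o by auto
  note [measurable] = a.diff_quot_measurable a.dir_deriv_measurable
  \<comment> \<open>The quotients are cut off where the step leaves \<open>U\<close>.\<close>
  define p where "p = (\<lambda>j x. \<bar>diff_quot a w j x\<bar> / K' * indicator (U' j) x :: real)"
  have "L1_conv p (\<lambda>x. \<bar>dir_deriv a w x\<bar> / K' * indicator U x)"
  proof (rule L1_convI_AE[where C = "K * norm w / K'"])
    show "\<bar>p j x\<bar> \<le> K * norm w / K'" for j x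
      using a.diff_quot_le[of w j x] K' a.K_nonneg by (auto simp: p_def indicator_def divide_right_mono)
    show "AE x in lborel. (\<lambda>j. p j x) \<longlonglongrightarrow> \<bar>dir_deriv a w x\<bar> / K' * indicator U x"
      using a.dir_deriv_tendsto_AE[of w]
    proof eventually_elim
      case (elim x)
      have l: "(\<lambda>j. \<bar>diff_quot a w j x\<bar> / K') \<longlonglongrightarrow> \<bar>dir_deriv a w x\<bar> / K'"
        using K' by (intro tendsto_intros a.diff_quot_tendsto[OF elim]) auto
      show ?case
      proof (cases "x \<in> U")
        case True
        have "(\<lambda>j. x + (1/2::real)^j *\<^sub>R w) \<longlonglongrightarrow> x + 0 *\<^sub>R w"
          by (intro tendsto_add tendsto_scaleR tendsto_const LIMSEQ_realpow_zero) auto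
        then have "\<forall>\<^sub>F j in sequentially. x + (1/2::real)^j *\<^sub>R w \<in> U"
          using U True by (intro topological_tendstoD) auto
        then have "\<forall>\<^sub>F j in sequentially. \<bar>diff_quot a w j x\<bar> / K' = p j x"
          by eventually_elim (simp add: p_def U'_def True)
        from Lim_transform_eventually[OF l this] show ?thesis using True by simp
      next
        case False
        then show ?thesis by (simp add: p_def U'_def)
      qed
    qed
  qed (unfold p_def, measurable)
  then have "AE x in lborel. \<bar>dir_deriv a w x\<bar> / K' * indicator U x \<le> speed w x"
  proof (rule L1_conv_le_AE[OF _ L1_conv_mean_length])
    fix j x
    show "p j x \<le> mean_length w j x"
    proof (cases "x \<in> U' j")
      case True
      then have "\<bar>a (x + (1/2)^j *\<^sub>R w) - a x\<bar> \<le> K' * seg_len (x + (1/2)^j *\<^sub>R w) x"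
        by (intro aU) (auto simp: U'_def)
      then have "\<bar>a (x + (1/2)^j *\<^sub>R w) - a x\<bar> / K' \<le> seg_len x (x + (1/2)^j *\<^sub>R w)"
        using K' by (simp add: field_simps seg_len_commute)
      then have "\<bar>a (x + (1/2)^j *\<^sub>R w) - a x\<bar> / K' * 2^j \<le> seg_len x (x + (1/2)^j *\<^sub>R w) * 2^j"
        by (rule mult_right_mono) simp
      then show ?thesis using True by (simp add: p_def mean_length_def diff_quot_def abs_mult)
    qed (simp add: p_def mean_length_nonneg)
  qed
  then show ?thesis
    by eventually_elim (use K' in \<open>auto simp: field_simps\<close>)
qed

text \<open>At almost every point both derivatives are linear on the rational span of
\<open>u\<close> and \<open>v\<close> and bounded there by \<open>K' \<sigma>\<close>, hence on
the real span. A nontrivial combination of \<open>u\<close> and \<open>v\<close> in the kernel of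
\<open>\<sigma>\<close> is a common zero, so the derivatives are proportional.\<close>

lemma jacobian_vanishes_AE:
  assumes a: "lipschitz_function a K" and b: "lipschitz_function b K" and U: "open U" and K': "K' > 0"
    and aU: "\<And>x y. x \<in> U \<Longrightarrow> y \<in> U \<Longrightarrow> \<bar>a x - a y\<bar> \<le> K' * seg_len x y"
    and bU: "\<And>x y. x \<in> U \<Longrightarrow> y \<in> U \<Longrightarrow> \<bar>b x - b y\<bar> \<le> K' * seg_len x y"
    and rank: "AE x in lborel. x \<in> U \<longrightarrow> (\<exists>\<sigma>. has_metric_derivative M U F x \<sigma> \<and> seminorm_rank \<sigma> \<le> 1)"
  shows "AE x in lborel. x \<in> U \<longrightarrow>
      (\<lambda>N. 4^N * boundary_sum a b 0 x (x + (1/2)^N *\<^sub>R u) (x + (1/2)^N *\<^sub>R v)) \<longlonglongrightarrow> 0"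
proof -
  interpret a: lipschitz_function a K by fact
  interpret b: lipschitz_function b K by fact
  have "AE x in lborel. \<forall>\<alpha>\<in>\<rat>. \<forall>\<beta>\<in>\<rat>. x \<in> U \<longrightarrow> \<bar>dir_deriv a (\<alpha> *\<^sub>R u + \<beta> *\<^sub>R v) x\<bar> \<le> K' * speed (\<alpha> *\<^sub>R u + \<beta> *\<^sub>R v) x"
    unfolding AE_ball_countable[OF countable_rat] using dir_deriv_le_speed_AE[OF a U K' aU] by blast
  moreover have "AE x in lborel. \<forall>\<alpha>\<in>\<rat>. \<forall>\<beta>\<in>\<rat>. x \<in> U \<longrightarrow> \<bar>dir_deriv b (\<alpha> *\<^sub>R u + \<beta> *\<^sub>R v) x\<bar> \<le> K' * speed (\<alpha> *\<^sub>R u + \<beta> *\<^sub>R v) x"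
    unfolding AE_ball_countable[OF countable_rat] using dir_deriv_le_speed_AE[OF b U K' bU] by blast
  ultimately show ?thesis
    using a.dir_deriv_linear_AE[of u v] b.dir_deriv_linear_AE[of u v] rank
      a.dir_deriv_tendsto_AE[of u] a.dir_deriv_tendsto_AE[of v] b.dir_deriv_tendsto_AE[of u] b.dir_deriv_tendsto_AE[of v]
  proof eventually_elim
    case (elim x)
    show ?case
    proof
      assume x: "x \<in> U"
      then obtain \<sigma> where \<sigma>: "has_metric_derivative M U F x \<sigma>" "seminorm_rank \<sigma> \<le> 1" using elim(5) by blast
      have sn: "is_seminorm \<sigma>" using \<sigma> by (simp add: has_metric_derivative_def)
      have sp: "speed w x = \<sigma> w" for w
        unfolding speed_def
        by (rule limI, rule speed_quot_tendsto, rule metric_derivative_directional[OF \<sigma>(1) U x]) simp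
      have bound: "\<bar>\<alpha> * p + \<beta> * q\<bar> \<le> K' * \<sigma> (\<alpha> *\<^sub>R u + \<beta> *\<^sub>R v)"
        if "\<And>\<alpha> \<beta>. \<alpha> \<in> \<rat> \<Longrightarrow> \<beta> \<in> \<rat> \<Longrightarrow> \<bar>\<alpha> * p + \<beta> * q\<bar> \<le> K' * \<sigma> (\<alpha> *\<^sub>R u + \<beta> *\<^sub>R v)" for p q \<alpha> \<beta>
      proof -
        let ?g = "\<lambda>z::real \<times> real. \<bar>fst z * p + snd z * q\<bar> - K' * \<sigma> (fst z *\<^sub>R u + snd z *\<^sub>R v)"
        have cl: "closure (\<rat> \<times> \<rat>) = (UNIV :: (real \<times> real) set)" by (simp add: closure_Times Rats_closure_real)
        have "continuous_on (closure (\<rat> \<times> \<rat>)) ?g"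
          by (intro continuous_intros continuous_on_compose2[OF continuous_on_seminorm[OF sn, of UNIV]]) auto
        moreover have "(\<alpha>, \<beta>) \<in> closure (\<rat> \<times> \<rat>)" by (simp add: cl)
        moreover have "?g z \<le> 0" if "z \<in> \<rat> \<times> \<rat>" for z
          using \<open>\<And>\<alpha> \<beta>. \<alpha> \<in> \<rat> \<Longrightarrow> \<beta> \<in> \<rat> \<Longrightarrow> \<bar>\<alpha> * p + \<beta> * q\<bar> \<le> K' * \<sigma> (\<alpha> *\<^sub>R u + \<beta> *\<^sub>R v)\<close>[of "fst z" "snd z"] that
          by auto
        ultimately have "?g (\<alpha>, \<beta>) \<le> 0" by (rule continuous_le_on_closure)
        then show ?thesis by simp
      qed
      obtain \<alpha> \<beta> where ab: "(\<alpha>, \<beta>) \<noteq> (0, 0)" "\<sigma> (\<alpha> *\<^sub>R u + \<beta> *\<^sub>R v) = 0"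
        using \<sigma>(2) seminorm_rank_le_one_iff[OF sn] by blast
      define p1 where "p1 = dir_deriv a u x" define q1 where "q1 = dir_deriv a v x"
      define p2 where "p2 = dir_deriv b u x" define q2 where "q2 = dir_deriv b v x"
      have "\<bar>\<alpha> * p1 + \<beta> * q1\<bar> \<le> K' * \<sigma> (\<alpha> *\<^sub>R u + \<beta> *\<^sub>R v)"
        by (rule bound) (use elim(1,3) x in \<open>simp add: sp p1_def q1_def\<close>)
      then have e1: "\<alpha> * p1 + \<beta> * q1 = 0" using ab(2) by simp
      have "\<bar>\<alpha> * p2 + \<beta> * q2\<bar> \<le> K' * \<sigma> (\<alpha> *\<^sub>R u + \<beta> *\<^sub>R v)"
        by (rule bound) (use elim(2,4) x in \<open>simp add: sp p2_def q2_def\<close>)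
      then have e2: "\<alpha> * p2 + \<beta> * q2 = 0" using ab(2) by simp
      have det: "p1 * q2 - q1 * p2 = 0"
      proof (cases "\<alpha> = 0")
        case True
        then show ?thesis using e1 e2 ab(1) by simp
      next
        case False
        have "\<alpha> * (p1 * q2 - q1 * p2) = (\<alpha> * p1 + \<beta> * q1) * q2 - (\<alpha> * p2 + \<beta> * q2) * q1" by (simp add: algebra_simps)
        then show ?thesis using False e1 e2 by simp
      qed
      have eq: "4^N * boundary_sum a b 0 x (x + (1/2)^N *\<^sub>R u) (x + (1/2)^N *\<^sub>R v)
         = (diff_quot a u N x * diff_quot b v N x - diff_quot a v N x * diff_quot b u N x) / 2" for N
      proof -
        have "(4::real)^N = 2^N * 2^N" by (simp flip: power_mult_distrib)
        then show ?thesis by (simp add: boundary_sum_0 diff_quot_def algebra_simps)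
      qed
      have "(\<lambda>N. (diff_quot a u N x * diff_quot b v N x - diff_quot a v N x * diff_quot b u N x) / 2) \<longlonglongrightarrow> (p1 * q2 - q1 * p2) / 2"
        unfolding p1_def q1_def p2_def q2_def
        by (intro tendsto_intros a.diff_quot_tendsto b.diff_quot_tendsto elim) simp
      then show "(\<lambda>N. 4^N * boundary_sum a b 0 x (x + (1/2)^N *\<^sub>R u) (x + (1/2)^N *\<^sub>R v)) \<longlonglongrightarrow> 0"
        unfolding eq det by simp
    qed
  qed
qed

end

section \<open>The tree of superlevel components\<close>

text \<open>Polygons are given by vertex sequences; this inserts the midpoint of every
edge.\<close>

definition bisect :: "(nat \<Rightarrow> 'a::real_vector) \<Rightarrow> nat \<Rightarrow> 'a" where
  "bisect c i = (if even i then c (i div 2) else midpoint (c (i div 2)) (c (Suc (i div 2))))"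

lemma sum_bisect:
  fixes f :: "'a::real_vector \<Rightarrow> 'a \<Rightarrow> real"
  shows "(\<Sum>i<2 * m. f (bisect c i) (bisect c (Suc i)))
     = (\<Sum>i<m. f (c i) (midpoint (c i) (c (Suc i))) + f (midpoint (c i) (c (Suc i))) (c (Suc i)))"
proof (induction m)
  case (Suc m)
  have "{..<2 * Suc m} = insert (2 * m) (insert (Suc (2 * m)) {..<2 * m})" by auto
  then have "(\<Sum>i<2 * Suc m. f (bisect c i) (bisect c (Suc i))) = f (bisect c (2 * m)) (bisect c (Suc (2 * m)))
      + (f (bisect c (Suc (2 * m))) (bisect c (Suc (Suc (2 * m)))) + (\<Sum>i<2 * m. f (bisect c i) (bisect c (Suc i))))"
    by simp
  moreover have "bisect c (2 * m) = c m" "bisect c (Suc (2 * m)) = midpoint (c m) (c (Suc m))" "bisect c (Suc (Suc (2 * m))) = c (Suc m)"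
    by (auto simp: bisect_def)
  ultimately show ?case unfolding Suc.IH by (simp add: ac_simps)
qed simp

lemma sum_bisect_power:
  "(\<Sum>i<2^N * m. f ((bisect ^^ N) c i) ((bisect ^^ N) c (Suc i))) = (\<Sum>i<m. dyadic_sum f N (c i) (c (Suc i)))"
proof (induction N arbitrary: c m)
  case (Suc N)
  have "2^Suc N * m = 2^N * (2 * m)" by simp
  then have "(\<Sum>i<2^Suc N * m. f ((bisect ^^ Suc N) c i) ((bisect ^^ Suc N) c (Suc i)))
     = (\<Sum>i<2^N * (2 * m). f ((bisect ^^ N) (bisect c) i) ((bisect ^^ N) (bisect c) (Suc i)))"
    by (simp only: funpow_Suc_right o_apply)
  also have "\<dots> = (\<Sum>i<2 * m. dyadic_sum f N (bisect c i) (bisect c (Suc i)))" by (rule Suc.IH)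
  also have "\<dots> = (\<Sum>i<m. dyadic_sum f (Suc N) (c i) (c (Suc i)))" unfolding sum_bisect by simp
  finally show ?case .
qed simp

lemma bisect_power_ends: "(bisect ^^ N) c 0 = c 0" "(bisect ^^ N) c (2^N * m) = c m"
proof (induction N arbitrary: c m)
  case (Suc N)
  { case 1 show ?case unfolding funpow_Suc_right o_apply Suc.IH(1) by (simp add: bisect_def) }
  { case 2
    have "2^Suc N * m = 2^N * (2 * m)" by simp
    then show ?case unfolding funpow_Suc_right o_apply by (simp only: Suc.IH(2)) (simp add: bisect_def) }
qed auto

lemma bisect_power_in:
  assumes "convex C" "\<And>i. i \<le> m \<Longrightarrow> c i \<in> C" "i \<le> 2^N * m"
  shows "(bisect ^^ N) c i \<in> C"
  using assms(2,3)
proof (induction N arbitrary: c m)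
  case (Suc N)
  show ?case unfolding funpow_Suc_right o_apply
  proof (rule Suc.IH)
    show "i \<le> 2^N * (2 * m)" using Suc.prems(2) by simp
    fix j assume j: "j \<le> 2 * m"
    show "bisect c j \<in> C"
    proof (cases "even j")
      case True
      then show ?thesis using Suc.prems(1) j by (simp add: bisect_def)
    next
      case False
      then have "c (j div 2) \<in> C" "c (Suc (j div 2)) \<in> C"
        using j by (auto intro!: Suc.prems(1) elim!: oddE)
      then have "closed_segment (c (j div 2)) (c (Suc (j div 2))) \<subseteq> C"
        using assms(1) convex_contains_segment by blast
      then show ?thesis using False midpoint_in_closed_segment by (auto simp: bisect_def)
    qed
  qed
qed simp

lemma bisect_power_mesh:
  fixes c :: "nat \<Rightarrow> 'a::real_normed_vector"
  assumes "\<And>i. i < m \<Longrightarrow> norm (c i - c (Suc i)) \<le> r" "i < 2^N * m"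
  shows "norm ((bisect ^^ N) c i - (bisect ^^ N) c (Suc i)) \<le> r / 2^N"
  using assms
proof (induction N arbitrary: c m r)
  case (Suc N)
  have "norm ((bisect ^^ N) (bisect c) i - (bisect ^^ N) (bisect c) (Suc i)) \<le> (r / 2) / 2^N"
  proof (rule Suc.IH)
    show "i < 2^N * (2 * m)" using Suc.prems(2) by simp
    fix j assume j: "j < 2 * m"
    have jm: "j div 2 < m" using j by auto
    have n: "norm (x - midpoint x y) = norm (x - y) / 2" "norm (midpoint x y - y) = norm (x - y) / 2" for x y :: 'a
      using dist_midpoint(1)[of x y] dist_midpoint(4)[of x y] by (auto simp: dist_norm)
    show "norm (bisect c j - bisect c (Suc j)) \<le> r / 2"
      using Suc.prems(1)[OF jm] by (cases "even j") (auto simp: bisect_def n)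
  qed
  then show ?case unfolding funpow_Suc_right o_apply by simp
qed simp

text \<open>The coefficient of the increment of \<open>B\<close> is one while \<open>T\<close> is
below \<open>s - \<kappa>\<close> and zero once it is above \<open>s + \<delta>\<close>. So the
sum differs from \<open>B k - B 0\<close>, where \<open>T\<close> reaches \<open>s\<close> at
\<open>k\<close>, at most by the variation of \<open>T\<close> in between. The clamp
\<open>\<phi>\<close> turns that variation into a telescoping sum.\<close>

lemma trapezoid_cutoff_sum:
  fixes T A B :: "nat \<Rightarrow> real"
  assumes T0: "T 0 = 0" and s: "0 \<le> s" "s \<le> T m" and nn: "0 \<le> \<kappa>" "0 \<le> \<delta>" "0 \<le> \<mu>"
    and T: "\<And>i. i < m \<Longrightarrow> 0 \<le> T (Suc i) - T i \<and> T (Suc i) - T i \<le> \<mu>"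
    and B: "\<And>i. i < m \<Longrightarrow> \<bar>B (Suc i) - B i\<bar> \<le> T (Suc i) - T i"
    and A01: "\<And>i. 0 \<le> A i \<and> A i \<le> 1"
    and A1: "\<And>i. i \<le> m \<Longrightarrow> T i \<le> s - \<kappa> \<Longrightarrow> A i = 1" and A0: "\<And>i. i \<le> m \<Longrightarrow> s + \<delta> \<le> T i \<Longrightarrow> A i = 0"
  obtains k where "k \<le> m" "s \<le> T k"
    "\<bar>(\<Sum>i<m. (A i + A (Suc i)) / 2 * (B (Suc i) - B i)) - (B k - B 0)\<bar> \<le> \<kappa> + \<delta> + 2 * \<mu>"
proof -
  define k where "k = (LEAST k. s \<le> T k)"
  have k: "s \<le> T k" "k \<le> m" unfolding k_def using s(2) by (auto intro: LeastI Least_le)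
  have k': "T i < s" if "i < k" for i using not_less_Least[of i "\<lambda>k. s \<le> T k"] that by (auto simp: k_def)
  have mono: "T i \<le> T j" if "i \<le> j" "j \<le> m" for i j
    using that
  proof (induction j rule: dec_induct)
    case (step j)
    then show ?case using T[of j] by simp
  qed simp
  define \<phi> where "\<phi> = (\<lambda>\<tau>. max (s - \<kappa> - \<mu>) (min (s + \<delta> + \<mu>) \<tau>))"
  have "(\<Sum>i<m. (if i < k then 1 else 0) * (B (Suc i) - B i)) = (\<Sum>i<k. B (Suc i) - B i)"
  proof -
    have "(\<Sum>i<m. (if i < k then 1 else 0) * (B (Suc i) - B i)) = (\<Sum>i\<in>{..<m} \<inter> {..<k}. B (Suc i) - B i)"
      by (subst sum.inter_restrict) (auto intro!: sum.cong)
    also have "{..<m} \<inter> {..<k} = {..<k}" using k(2) by auto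
    finally show ?thesis .
  qed
  then have Bk: "B k - B 0 = (\<Sum>i<m. (if i < k then 1 else 0) * (B (Suc i) - B i))"
    by (simp add: sum_lessThan_telescope)
  have "\<bar>(\<Sum>i<m. (A i + A (Suc i)) / 2 * (B (Suc i) - B i)) - (B k - B 0)\<bar>
      = \<bar>\<Sum>i<m. ((A i + A (Suc i)) / 2 - (if i < k then 1 else 0)) * (B (Suc i) - B i)\<bar>"
    unfolding Bk by (simp add: sum_subtractf left_diff_distrib)
  also have "\<dots> \<le> (\<Sum>i<m. \<bar>((A i + A (Suc i)) / 2 - (if i < k then 1 else 0)) * (B (Suc i) - B i)\<bar>)" by (rule sum_abs)
  also have "\<dots> \<le> (\<Sum>i<m. \<phi> (T (Suc i)) - \<phi> (T i))"
  proof (rule sum_mono)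
    fix i assume "i \<in> {..<m}"
    then have i: "i < m" by simp
    have Ti: "T i \<le> T (Suc i)" "T (Suc i) \<le> T i + \<mu>" using T[OF i] by auto
    consider "T (Suc i) \<le> s - \<kappa>" "T (Suc i) < s" | "s + \<delta> \<le> T i" | "T (Suc i) = s" "\<kappa> = 0" | "s - \<kappa> < T (Suc i)" "T i < s + \<delta>"
      using nn by linarith
    then show "\<bar>((A i + A (Suc i)) / 2 - (if i < k then 1 else 0)) * (B (Suc i) - B i)\<bar> \<le> \<phi> (T (Suc i)) - \<phi> (T i)"
    proof cases
      case 1
      then have "A i = 1" "A (Suc i) = 1" using A1[of i] A1[of "Suc i"] Ti i by auto
      moreover have "i < k"
      proof (rule ccontr)
        assume "\<not> i < k"
        then have "T k \<le> T i" using mono[of k i] i by simp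
        then show False using k(1) Ti 1 by linarith
      qed
      ultimately show ?thesis using Ti by (simp add: \<phi>_def)
    next
      case 2
      then have "A i = 0" "A (Suc i) = 0" using A0[of i] A0[of "Suc i"] Ti i by auto
      moreover have "\<not> i < k" using k'[of i] 2 nn by auto
      ultimately show ?thesis using Ti by (simp add: \<phi>_def)
    next
      case 3
      have c: "\<bar>(A i + A (Suc i)) / 2 - (if i < k then 1 else 0)\<bar> \<le> 1" using A01[of i] A01[of "Suc i"] by auto
      have "\<bar>((A i + A (Suc i)) / 2 - (if i < k then 1 else 0)) * (B (Suc i) - B i)\<bar> \<le> 1 * (T (Suc i) - T i)"
        unfolding abs_mult by (intro mult_mono c B[OF i]) auto
      also have "\<dots> = \<phi> (T (Suc i)) - \<phi> (T i)" using 3 Ti nn by (auto simp: \<phi>_def)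
      finally show ?thesis .
    next
      case 4
      have c: "\<bar>(A i + A (Suc i)) / 2 - (if i < k then 1 else 0)\<bar> \<le> 1" using A01[of i] A01[of "Suc i"] by auto
      have "\<bar>((A i + A (Suc i)) / 2 - (if i < k then 1 else 0)) * (B (Suc i) - B i)\<bar> \<le> 1 * (T (Suc i) - T i)"
        unfolding abs_mult by (intro mult_mono c B[OF i]) auto
      also have "\<dots> = \<phi> (T (Suc i)) - \<phi> (T i)" using 4 Ti nn by (auto simp: \<phi>_def)
      finally show ?thesis .
    qed
  qed
  also have "\<dots> = \<phi> (T m) - \<phi> (T 0)" by (rule sum_lessThan_telescope)
  also have "\<dots> \<le> \<kappa> + \<delta> + 2 * \<mu>" using nn by (auto simp: \<phi>_def)
  finally show thesis using that k by blast
qed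

locale rank_one_map = lipschitz_into M F L
  for M :: "'b metric" and F :: "'a::euclidean_space \<Rightarrow> 'b" and L :: real +
  fixes C U :: "'a set" and root :: 'a
  assumes U: "convex U" "open U" "bounded U" and CU: "C = closure U" and root_in: "root \<in> C"
    and rank: "AE x in lborel. x \<in> U \<longrightarrow> (\<exists>\<sigma>. has_metric_derivative M U F x \<sigma> \<and> seminorm_rank \<sigma> \<le> 1)"
begin

lemma convex_C: "convex C" and closed_C: "closed C" and C_nonempty: "C \<noteq> {}"
proof -
  show "convex C" unfolding CU by (rule convex_closure[OF U(1)])
  show "closed C" unfolding CU by (rule closed_closure)
  show "C \<noteq> {}" using root_in by blast
qed

lemma UC: "U \<subseteq> C" using CU closure_subset by blast

lemma segment_subset_C: "x \<in> C \<Longrightarrow> y \<in> C \<Longrightarrow> closed_segment x y \<subseteq> C"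
  using convex_C convex_contains_segment by blast

definition walk :: "(nat \<Rightarrow> 'a) \<Rightarrow> nat \<Rightarrow> 'a \<Rightarrow> bool" where
  "walk c m x \<longleftrightarrow> c 0 = root \<and> c m = x \<and> (\<forall>i\<le>m. c i \<in> C)"

definition walk_len :: "(nat \<Rightarrow> 'a) \<Rightarrow> nat \<Rightarrow> real" where
  "walk_len c m = (\<Sum>i<m. seg_len (c i) (c (Suc i)))"

definition height :: "'a \<Rightarrow> real" where
  "height x = Inf {walk_len c m | c m. walk c m x}"

lemma walk_len_nonneg: "0 \<le> walk_len c m"
  unfolding walk_len_def by (intro sum_nonneg seg_len_nonneg)

lemma walk_len_bdd: "bdd_below {walk_len c m | c m. walk c m x}"
  using walk_len_nonneg by (auto intro!: bdd_belowI[of _ 0])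

lemma walk_direct: "x \<in> C \<Longrightarrow> walk (\<lambda>i. if i = 0 then root else x) 1 x"
  using root_in by (simp add: walk_def)

lemma walk_exists: "x \<in> C \<Longrightarrow> {walk_len c m | c m. walk c m x} \<noteq> {}"
  using walk_direct by blast

lemma height_le: "walk c m x \<Longrightarrow> height x \<le> walk_len c m"
  unfolding height_def by (rule cInf_lower[OF _ walk_len_bdd]) blast

lemma height_nonneg: "x \<in> C \<Longrightarrow> 0 \<le> height x"
  unfolding height_def by (rule cInf_greatest[OF walk_exists]) (auto simp: walk_len_nonneg)

lemma height_near:
  assumes "x \<in> C" "e > 0"
  obtains c m where "walk c m x" "walk_len c m < height x + e"
proof -
  have "Inf {walk_len c m | c m. walk c m x} < height x + e" using assms(2) by (simp add: height_def)
  then show thesis using cInf_less_iff[OF walk_exists[OF assms(1)] walk_len_bdd] that by blast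
qed

lemma height_step: 
  assumes x: "x \<in> C" and y: "y \<in> C" shows "height y \<le> height x + seg_len x y"
proof (rule field_le_epsilon)
  fix e :: real assume "e > 0"
  then obtain c m where c: "walk c m x" "walk_len c m < height x + e" using height_near[OF x] by blast
  let ?c = "c(Suc m := y)"
  have "walk ?c (Suc m) y" using c(1) y by (auto simp: walk_def)
  from height_le[OF this] have "height y \<le> walk_len ?c (Suc m)" .
  also have "\<dots> = walk_len c m + seg_len x y" using c(1) by (simp add: walk_len_def walk_def)
  finally show "height y \<le> height x + seg_len x y + e" using c(2) by simp
qed

lemma height_diff: "x \<in> C \<Longrightarrow> y \<in> C \<Longrightarrow> \<bar>height x - height y\<bar> \<le> seg_len x y"
  using height_step[of x y] height_step[of y x] by (simp add: seg_len_commute)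

lemma height_lipschitz: "x \<in> C \<Longrightarrow> y \<in> C \<Longrightarrow> \<bar>height x - height y\<bar> \<le> L * norm (x - y)"
  using height_diff seg_len_le order_trans by blast

lemma height_walk_upper:
  assumes "walk c m x" "i \<le> m" shows "height (c i) \<le> walk_len c i"
  by (rule height_le) (use assms in \<open>auto simp: walk_def\<close>)

lemma height_walk_lower:
  assumes "walk c m x" "i \<le> m" shows "height x \<le> height (c i) + (walk_len c m - walk_len c i)"
proof -
  have "height (c j) \<le> height (c i) + (walk_len c j - walk_len c i)" if "i \<le> j" "j \<le> m" for j
    using that
  proof (induction j rule: dec_induct)
    case (step j)
    have "height (c (Suc j)) \<le> height (c j) + seg_len (c j) (c (Suc j))"
      by (rule height_step) (use assms step in \<open>auto simp: walk_def\<close>)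
    then show ?case using step by (simp add: walk_len_def)
  qed simp
  from this[of m] show ?thesis using assms by (simp add: walk_def)
qed

lemma mdist_walk:
  assumes "i \<le> m" shows "mdist M (F (c i)) (F (c m)) \<le> walk_len c m - walk_len c i"
  using assms
proof (induction m rule: dec_induct)
  case (step j)
  have "mdist M (F (c i)) (F (c (Suc j))) \<le> mdist M (F (c i)) (F (c j)) + mdist M (F (c j)) (F (c (Suc j)))" by (rule tri)
  also have "\<dots> \<le> (walk_len c j - walk_len c i) + seg_len (c j) (c (Suc j))" by (intro add_mono step.IH mdist_le_seg_len)
  finally show ?case by (simp add: walk_len_def)
qed (simp add: mdist_self)

lemma walk_refine:
  assumes "walk c m x"
  shows "walk ((bisect ^^ N) c) (2^N * m) x" "walk_len ((bisect ^^ N) c) (2^N * m) = walk_len c m"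
proof -
  show "walk ((bisect ^^ N) c) (2^N * m) x"
    using assms bisect_power_in[OF convex_C, of m c] by (auto simp: walk_def bisect_power_ends)
  have "dyadic_sum seg_len N u v = seg_len u v" for u v
    by (induction N arbitrary: u v) (auto simp: seg_len_midpoint[symmetric])
  then show "walk_len ((bisect ^^ N) c) (2^N * m) = walk_len c m"
    unfolding walk_len_def sum_bisect_power by simp
qed

text \<open>One up to level \<open>s - \<kappa>\<close>, zero from level \<open>s\<close> on. The
nearest-point projection extends it beyond \<open>C\<close> as a Lipschitz function.\<close>

definition cutoff :: "real \<Rightarrow> real \<Rightarrow> 'a \<Rightarrow> real" where
  "cutoff s \<kappa> u = max 0 (min 1 ((s - height (closest_point C u)) / \<kappa>))"

lemma cutoff_diff:
  assumes "\<kappa> > 0" shows "\<bar>cutoff s \<kappa> u - cutoff s \<kappa> v\<bar> \<le> \<bar>height (closest_point C u) - height (closest_point C v)\<bar> / \<kappa>"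
proof -
  have clip: "\<bar>max 0 (min 1 p) - max 0 (min 1 q)\<bar> \<le> \<bar>p - q\<bar>" for p q :: real by (auto simp: max_def min_def)
  have "\<bar>cutoff s \<kappa> u - cutoff s \<kappa> v\<bar> \<le> \<bar>(s - height (closest_point C u)) / \<kappa> - (s - height (closest_point C v)) / \<kappa>\<bar>"
    unfolding cutoff_def by (rule clip)
  also have "(s - height (closest_point C u)) / \<kappa> - (s - height (closest_point C v)) / \<kappa>
     = (height (closest_point C v) - height (closest_point C u)) / \<kappa>" by (simp flip: diff_divide_distrib)
  finally show ?thesis using assms by (simp add: abs_minus_commute)
qed

lemma closest_in: "closest_point C u \<in> C"
  by (rule closest_point_in_set[OF closed_C C_nonempty])

lemma closest_self: "u \<in> C \<Longrightarrow> closest_point C u = u"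
  by (rule closest_point_self)

definition dist_to :: "'a \<Rightarrow> 'a \<Rightarrow> real" where
  "dist_to x u = mdist M (F u) (F x)"

lemma dist_to_diff: "\<bar>dist_to x u - dist_to x v\<bar> \<le> mdist M (F u) (F v)"
  using tri[of u x v] tri[of v x u] by (simp add: dist_to_def mdist_commute abs_le_iff)

text \<open>Both functions are Lipschitz with respect to \<open>F\<close>-length, so Stokes'
theorem applies to them.\<close>

lemma cutoff_pair:
  assumes k: "\<kappa> > 0" defines "K' \<equiv> 1 + 1 / \<kappa>"
  shows "lipschitz_pair (cutoff s \<kappa>) (dist_to x) (K' * L)"
    and "\<And>u v w. \<lbrakk>u \<in> C; v \<in> C; w \<in> C\<rbrakk> \<Longrightarrow> lipschitz_pair.line_int (cutoff s \<kappa>) (dist_to x) u v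
      + lipschitz_pair.line_int (cutoff s \<kappa>) (dist_to x) v w + lipschitz_pair.line_int (cutoff s \<kappa>) (dist_to x) w u = 0"
proof -
  have K': "K' > 0" using k by (simp add: K'_def add_pos_pos)
  have K1: "p \<le> K' * p" "p / \<kappa> \<le> K' * p" if "p \<ge> 0" for p
    using that k by (auto simp: K'_def algebra_simps)
  have aLip: "\<bar>cutoff s \<kappa> u - cutoff s \<kappa> v\<bar> \<le> K' * L * norm (u - v)" for u v
  proof -
    have "\<bar>height (closest_point C u) - height (closest_point C v)\<bar> \<le> L * norm (closest_point C u - closest_point C v)"
      by (rule height_lipschitz[OF closest_in closest_in])
    also have "\<dots> \<le> L * norm (u - v)"
      using closest_point_lipschitz[OF convex_C closed_C C_nonempty, of u v] L_nonneg by (intro mult_left_mono) (auto simp: dist_norm)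
    finally have "\<bar>height (closest_point C u) - height (closest_point C v)\<bar> / \<kappa> \<le> L * norm (u - v) / \<kappa>"
      using k by (intro divide_right_mono) auto
    also have "\<dots> \<le> K' * (L * norm (u - v))" by (rule K1) (simp add: L_nonneg)
    finally show ?thesis using cutoff_diff[OF k, of s u v] by (simp add: mult.assoc)
  qed
  have bLip: "\<bar>dist_to x u - dist_to x v\<bar> \<le> K' * L * norm (u - v)" for u v
    using order_trans[OF dist_to_diff lip, of x u v] K1(1)[of "L * norm (u - v)"] L_nonneg by (simp add: mult.assoc)
  show P: "lipschitz_pair (cutoff s \<kappa>) (dist_to x) (K' * L)"
    by standard (use aLip bLip in auto)
  interpret P: lipschitz_pair "cutoff s \<kappa>" "dist_to x" "K' * L" by (rule P)
  have aU: "\<bar>cutoff s \<kappa> u - cutoff s \<kappa> v\<bar> \<le> K' * seg_len u v" if "u \<in> U" "v \<in> U" for u v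
  proof -
    have uv: "u \<in> C" "v \<in> C" using that UC by auto
    have "\<bar>cutoff s \<kappa> u - cutoff s \<kappa> v\<bar> \<le> seg_len u v / \<kappa>"
      using cutoff_diff[OF k, of s u v] height_diff[OF uv] k unfolding closest_self[OF uv(1)] closest_self[OF uv(2)]
      by (meson divide_right_mono less_imp_le order_trans)
    also have "\<dots> \<le> K' * seg_len u v" by (rule K1) (rule seg_len_nonneg)
    finally show ?thesis .
  qed
  have bU: "\<bar>dist_to x u - dist_to x v\<bar> \<le> K' * seg_len u v" for u v
    using dist_to_diff[of x u v] mdist_le_seg_len[of u v] K1(1)[OF seg_len_nonneg, of u v] by linarith
  have "lipschitz_function (cutoff s \<kappa>) (K' * L)" "lipschitz_function (dist_to x) (K' * L)"
    by (standard; use aLip bLip in blast)+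
  note J = jacobian_vanishes_AE[OF this U(2) K' aU bU rank]
  show "P.line_int u v + P.line_int v w + P.line_int w u = 0" if "u \<in> C" "v \<in> C" "w \<in> C" for u v w
    by (rule P.line_int_triangle[OF U J]) (use that in \<open>auto simp: CU\<close>)
qed

text \<open>The point \<open>z\<close> is where a nearly shortest polygon from the root to
\<open>x\<close> reaches level \<open>s\<close>. Along this polygon the height agrees up to
\<open>\<kappa>\<close> with the length travelled, so the line integral of the cut-off picks up
the increment of \<open>dist_to w\<close> from the root to \<open>z\<close>.\<close>

lemma level_point:
  assumes x: "x \<in> C" and s: "0 \<le> s" "s \<le> height x" and k: "\<kappa> > 0"
  obtains z where "mdist M (F z) (F x) \<le> height x - s + \<kappa>"
    "\<bar>lipschitz_pair.line_int (cutoff s \<kappa>) (dist_to w) root x - (dist_to w z - dist_to w root)\<bar> \<le> 5 * \<kappa>"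
proof -
  interpret P: lipschitz_pair "cutoff s \<kappa>" "dist_to w" "(1 + 1 / \<kappa>) * L" by (rule cutoff_pair(1)[OF k])
  note tria = cutoff_pair(2)[OF k]
  obtain c m where c: "walk c m x" "walk_len c m < height x + \<kappa>" by (rule height_near[OF x k])
  have cC: "c i \<in> C" if "i \<le> m" for i using c(1) that by (simp add: walk_def)
  have tel: "P.line_int root (c j) = (\<Sum>i<j. P.line_int (c i) (c (Suc i)))" if "j \<le> m" for j
    using that
  proof (induction j)
    case 0
    have "P.line_int root root = 0" using P.line_int_antisym[of root root] by simp
    then show ?case using c(1) by (simp add: walk_def)
  next
    case (Suc j)
    have "P.line_int root (c j) + P.line_int (c j) (c (Suc j)) + P.line_int (c (Suc j)) root = 0"
      by (rule tria) (use root_in cC Suc.prems in auto)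
    then show ?case using Suc P.line_int_antisym[of root "c (Suc j)"] by simp
  qed
  then have I: "P.line_int root x = (\<Sum>i<m. P.line_int (c i) (c (Suc i)))" using c(1) by (auto simp: walk_def)
  have lim1: "(\<lambda>N. \<Sum>i<m. P.trapezoid_sum N (c i) (c (Suc i))) \<longlonglongrightarrow> P.line_int root x"
    unfolding I by (intro tendsto_sum P.trapezoid_sum_tendsto)
  define r where "r = (\<Sum>i<m. norm (c i - c (Suc i)))"
  have r: "norm (c i - c (Suc i)) \<le> r" if "i < m" for i
    unfolding r_def by (rule member_le_sum) (use that in auto)
  have "(\<lambda>N. L * r * (1/2)^N) \<longlonglongrightarrow> L * r * 0" by (intro tendsto_mult tendsto_const LIMSEQ_realpow_zero) auto
  then have ev1: "\<forall>\<^sub>F N in sequentially. L * r * (1/2)^N < \<kappa>" using k by (intro order_tendstoD(2)) auto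
  have ev2: "\<forall>\<^sub>F N in sequentially. dist (\<Sum>i<m. P.trapezoid_sum N (c i) (c (Suc i))) (P.line_int root x) < \<kappa>"
    by (rule tendstoD[OF lim1 k])
  \<comment> \<open>The polygon is bisected until its edges have length below \<open>\<kappa>\<close> and the trapezoidal sum is close to the integral.\<close>
  obtain N where N: "L * r * (1/2)^N < \<kappa>" "dist (\<Sum>i<m. P.trapezoid_sum N (c i) (c (Suc i))) (P.line_int root x) < \<kappa>"
    using eventually_conj[OF ev1 ev2] by (auto simp: eventually_sequentially)
  define e where "e = (bisect ^^ N) c"
  define n where "n = 2^N * m"
  have e: "walk e n x" "walk_len e n = walk_len c m" using walk_refine[OF c(1), of N] by (auto simp: e_def n_def)
  have eC: "e i \<in> C" if "i \<le> n" for i using e(1) that by (simp add: walk_def)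
  have sumN: "(\<Sum>i<n. trapezoid (cutoff s \<kappa>) (dist_to w) (e i) (e (Suc i))) = (\<Sum>i<m. P.trapezoid_sum N (c i) (c (Suc i)))"
    unfolding e_def n_def by (rule sum_bisect_power)
  define A where "A = (\<lambda>i. cutoff s \<kappa> (e i))"
  define B where "B = (\<lambda>i. dist_to w (e i))"
  have A_eq: "A i = max 0 (min 1 ((s - height (e i)) / \<kappa>))" if "i \<le> n" for i
    unfolding A_def cutoff_def closest_self[OF eC[OF that]] ..
  have s': "s \<le> walk_len e n" using s(2) height_le[OF e(1)] by simp
  have d: "walk_len e (Suc i) - walk_len e i = seg_len (e i) (e (Suc i))" for i by (simp add: walk_len_def)
  have T: "0 \<le> walk_len e (Suc i) - walk_len e i \<and> walk_len e (Suc i) - walk_len e i \<le> \<kappa>" if i: "i < n" for i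
  proof -
    have "seg_len (e i) (e (Suc i)) \<le> L * norm (e i - e (Suc i))" by (rule seg_len_le)
    also have "\<dots> \<le> L * (r / 2^N)"
      unfolding e_def by (intro mult_left_mono bisect_power_mesh[where m = m] r) (use i L_nonneg in \<open>auto simp: n_def\<close>)
    also have "\<dots> \<le> \<kappa>" using N(1) by (simp add: power_divide)
    finally show ?thesis unfolding d using seg_len_nonneg by simp
  qed
  have Bd: "\<bar>B (Suc i) - B i\<bar> \<le> walk_len e (Suc i) - walk_len e i" for i
    unfolding d B_def using dist_to_diff[of w "e (Suc i)" "e i"] mdist_le_seg_len[of "e (Suc i)" "e i"]
    by (simp add: seg_len_commute)
  have A1: "A i = 1" if i: "i \<le> n" "walk_len e i \<le> s - \<kappa>" for i
  proof -
    have "height (e i) \<le> s - \<kappa>" using height_walk_upper[OF e(1) i(1)] i(2) by simp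
    then have "1 \<le> (s - height (e i)) / \<kappa>" using k by (simp add: field_simps)
    then show "A i = 1" using A_eq[OF i(1)] by simp
  qed
  have A0: "A i = 0" if i: "i \<le> n" "s + \<kappa> \<le> walk_len e i" for i
  proof -
    have "s \<le> height (e i)" using height_walk_lower[OF e(1) i(1)] i(2) e(2) c(2) by simp
    then have "(s - height (e i)) / \<kappa> \<le> 0" using k by (simp add: divide_nonpos_pos)
    then show "A i = 0" using A_eq[OF i(1)] by simp
  qed
  have A01: "0 \<le> A i \<and> A i \<le> 1" for i by (simp add: A_def cutoff_def)
  have w0: "walk_len e 0 = 0" by (simp add: walk_len_def)
  have k0: "0 \<le> \<kappa>" using k by simp
  obtain i where i: "i \<le> n" "s \<le> walk_len e i"
    "\<bar>(\<Sum>i<n. (A i + A (Suc i)) / 2 * (B (Suc i) - B i)) - (B i - B 0)\<bar> \<le> \<kappa> + \<kappa> + 2 * \<kappa>"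
    by (rule trapezoid_cutoff_sum[of "walk_len e", OF w0 s(1) s' k0 k0 k0 T Bd A01 A1 A0])
  have en: "e n = x" "e 0 = root" using e(1) by (auto simp: walk_def)
  have "mdist M (F (e i)) (F x) \<le> walk_len e n - walk_len e i" using mdist_walk[OF i(1), of e] en by simp
  then have z1: "mdist M (F (e i)) (F x) \<le> height x - s + \<kappa>" using i(2) e(2) c(2) by simp
  have "(\<Sum>i<n. (A i + A (Suc i)) / 2 * (B (Suc i) - B i)) = (\<Sum>i<m. P.trapezoid_sum N (c i) (c (Suc i)))"
    unfolding sumN[symmetric] by (simp add: A_def B_def trapezoid_def)
  then have "\<bar>P.line_int root x - (dist_to w (e i) - dist_to w root)\<bar> \<le> 5 * \<kappa>"
    using i(3) N(2) en by (simp add: B_def dist_real_def)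
  with z1 show thesis by (rule that)
qed

text \<open>Its transitive closure, not the reflexive one, is used for joining points, so that
joined points lie at height at least \<open>s\<close> themselves.\<close>

definition high_step :: "real \<Rightarrow> 'a \<Rightarrow> 'a \<Rightarrow> bool" where
  "high_step s x y \<longleftrightarrow> x \<in> C \<and> y \<in> C \<and> (\<forall>z\<in>closed_segment x y. s \<le> height z)"

abbreviation joined :: "real \<Rightarrow> 'a \<Rightarrow> 'a \<Rightarrow> bool" where
  "joined s \<equiv> (high_step s)\<^sup>+\<^sup>+"

lemma joined_in: "joined s x y \<Longrightarrow> x \<in> C \<and> y \<in> C \<and> s \<le> height x \<and> s \<le> height y"
  by (induction rule: tranclp_induct) (auto simp: high_step_def)

lemma joined_sym: "joined s x y \<Longrightarrow> joined s y x"
proof (induction rule: tranclp_induct)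
  case (base y)
  then have "high_step s y x" by (simp add: high_step_def closed_segment_commute)
  then show ?case by blast
next
  case (step y z)
  then have "high_step s z y" by (simp add: high_step_def closed_segment_commute)
  then show ?case using step.IH by (rule tranclp_into_tranclp2)
qed

lemma joined_mono:
  assumes "s' \<le> s" "joined s x y" shows "joined s' x y"
  using assms(2)
proof (induction rule: tranclp_induct)
  case (base y)
  then have "high_step s' x y" using assms(1) by (auto simp: high_step_def)
  then show ?case by blast
next
  case (step y z)
  then have "high_step s' y z" using assms(1) by (auto simp: high_step_def)
  with step.IH show ?case by (rule tranclp.trancl_into_trancl)
qed

text \<open>The cut-off vanishes along a polygon in \<open>{height \<ge> s}\<close>.\<close>

lemma line_int_joined:
  assumes k: "\<kappa> > 0" and j: "joined s x y"
  shows "lipschitz_pair.line_int (cutoff s \<kappa>) (dist_to w) root x = lipschitz_pair.line_int (cutoff s \<kappa>) (dist_to w) root y"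
proof -
  interpret P: lipschitz_pair "cutoff s \<kappa>" "dist_to w" "(1 + 1 / \<kappa>) * L" by (rule cutoff_pair(1)[OF k])
  note tria = cutoff_pair(2)[OF k]
  have step: "P.line_int root x = P.line_int root y" if h: "high_step s x y" for x y
  proof -
    have xy: "x \<in> C" "y \<in> C" using h by (auto simp: high_step_def)
    have "P.trapezoid_sum N u v = 0" if "closed_segment u v \<subseteq> closed_segment x y" for N u v
      using that
    proof (induction N arbitrary: u v)
      case 0
      have z: "cutoff s \<kappa> t = 0" if "t \<in> closed_segment x y" for t
      proof -
        have "t \<in> C" "s \<le> height t" using that h segment_subset_C[OF xy] by (auto simp: high_step_def)
        then show ?thesis using k by (simp add: cutoff_def closest_self divide_nonpos_pos)
      qed
      have "u \<in> closed_segment x y" "v \<in> closed_segment x y" using 0 ends_in_segment by blast+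
      then show ?case by (simp add: trapezoid_def z)
    next
      case (Suc N)
      have m: "midpoint u v \<in> closed_segment u v" by simp
      have "closed_segment u (midpoint u v) \<subseteq> closed_segment u v" "closed_segment (midpoint u v) v \<subseteq> closed_segment u v"
        using m by (simp_all add: subset_closed_segment)
      then have "P.trapezoid_sum N u (midpoint u v) = 0" "P.trapezoid_sum N (midpoint u v) v = 0"
        using Suc.IH Suc.prems by (meson subset_trans)+
      then show ?case by simp
    qed
    then have "(\<lambda>N. P.trapezoid_sum N x y) = (\<lambda>N. 0)" by auto
    then have "P.line_int x y = 0" using P.trapezoid_sum_tendsto[of x y] LIMSEQ_unique tendsto_const by metis
    then show ?thesis using tria[OF root_in xy, of s w] P.line_int_antisym[of root y] by simp
  qed
  from j show ?thesis by (induction rule: tranclp_induct) (auto simp: step)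
qed

text \<open>The line integrals from the root to \<open>x\<close> and to \<open>y\<close> agree, so
\<open>dist_to x\<close> nearly agrees at the points \<open>z\<close> and \<open>z'\<close> where
the two nearly shortest polygons reach level \<open>s\<close>. Hence \<open>z'\<close> is about as
close to \<open>x\<close> as \<open>z\<close>, that is, within \<open>height x - s\<close> up to a
small error, and it is close to \<open>y\<close> by construction.\<close>

lemma mdist_joined:
  assumes j: "joined s x y"
  shows "mdist M (F x) (F y) \<le> height x + height y - 2 * s"
proof -
  have xy: "x \<in> C" "y \<in> C" "s \<le> height x" "s \<le> height y" using joined_in[OF j] by auto
  have height_ge: "mdist M (F root) (F u) \<le> height u" if u: "u \<in> C" for u
  proof (rule field_le_epsilon)
    fix e :: real assume "e > 0"
    then obtain c m where c: "walk c m u" "walk_len c m < height u + e" using height_near[OF u] by blast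
    then show "mdist M (F root) (F u) \<le> height u + e" using mdist_walk[of 0 m c] by (simp add: walk_def walk_len_def)
  qed
  show ?thesis
  proof (cases "s \<ge> 0")
    case False
    have "mdist M (F x) (F y) \<le> height x + height y"
      using tri[of x y root] height_ge[OF xy(1)] height_ge[OF xy(2)] by (simp add: mdist_commute)
    then show ?thesis using False by simp
  next
    case s: True
    show ?thesis
    proof (rule field_le_epsilon)
      fix e :: real assume e: "e > 0"
      \<comment> \<open>The error terms are \<open>5 \<kappa>\<close> for each of the two line integrals and \<open>\<kappa>\<close> for each of the two distances.\<close>
      define \<kappa> where "\<kappa> = e / 12"
      have k: "\<kappa> > 0" using e by (simp add: \<kappa>_def)
      obtain z where z: "mdist M (F z) (F x) \<le> height x - s + \<kappa>"
        "\<bar>lipschitz_pair.line_int (cutoff s \<kappa>) (dist_to x) root x - (dist_to x z - dist_to x root)\<bar> \<le> 5 * \<kappa>"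
        by (rule level_point[OF xy(1) s xy(3) k])
      obtain z' where z': "mdist M (F z') (F y) \<le> height y - s + \<kappa>"
        "\<bar>lipschitz_pair.line_int (cutoff s \<kappa>) (dist_to x) root y - (dist_to x z' - dist_to x root)\<bar> \<le> 5 * \<kappa>"
        by (rule level_point[OF xy(2) s xy(4) k])
      have "dist_to x z' \<le> dist_to x z + 10 * \<kappa>"
        using z(2) z'(2) line_int_joined[OF k j, of x] by linarith
      then have "mdist M (F z') (F x) \<le> height x - s + 11 * \<kappa>" using z(1) by (simp add: dist_to_def)
      then have "mdist M (F x) (F y) \<le> (height x - s) + (height y - s) + 12 * \<kappa>"
        using tri[of x y z'] z'(1) by (simp add: mdist_commute)
      then show "mdist M (F x) (F y) \<le> height x + height y - 2 * s + e" by (simp add: \<kappa>_def)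
    qed
  qed
qed

definition meet :: "'a \<Rightarrow> 'a \<Rightarrow> real" where
  "meet x y = Sup {s. joined s x y}"

definition tree_dist :: "'a \<Rightarrow> 'a \<Rightarrow> real" where
  "tree_dist x y = height x + height y - 2 * meet x y"

lemma joined_bdd: "bdd_above {s. joined s x y}"
  using joined_in by (auto intro!: bdd_aboveI[of _ "height x"])

lemma joined_0: "x \<in> C \<Longrightarrow> y \<in> C \<Longrightarrow> joined 0 x y"
  using segment_subset_C height_nonneg by (intro tranclp.r_into_trancl) (auto simp: high_step_def)

lemma joined_ne: "x \<in> C \<Longrightarrow> y \<in> C \<Longrightarrow> {s. joined s x y} \<noteq> {}"
  using joined_0 by blast

lemma meet_ge: "joined s x y \<Longrightarrow> s \<le> meet x y"
  unfolding meet_def by (rule cSup_upper[OF _ joined_bdd]) simp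

lemma meet_le: "x \<in> C \<Longrightarrow> y \<in> C \<Longrightarrow> meet x y \<le> height x" "x \<in> C \<Longrightarrow> y \<in> C \<Longrightarrow> meet x y \<le> height y"
  unfolding meet_def by (rule cSup_least[OF joined_ne], assumption, assumption, use joined_in in blast)+

lemma meet_sym: "meet x y = meet y x"
  unfolding meet_def by (rule arg_cong[where f = Sup]) (auto intro: joined_sym)

lemma meet_refl: "x \<in> C \<Longrightarrow> meet x x = height x"
  by (rule antisym[OF meet_le(1) meet_ge]) (auto simp: high_step_def intro!: tranclp.r_into_trancl)

lemma meet_ultra:
  assumes C: "x \<in> C" "y \<in> C" "z \<in> C"
  shows "min (meet x y) (meet y z) \<le> meet x z"
proof (rule dense_le)
  fix s assume "s < min (meet x y) (meet y z)"
  then obtain s1 s2 where "s < s1" "joined s1 x y" "s < s2" "joined s2 y z"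
    unfolding meet_def using less_cSup_iff[OF joined_ne joined_bdd] C by auto
  then have "joined s x y" "joined s y z" using joined_mono less_imp_le by blast+
  then have "joined s x z" by (rule tranclp_trans)
  then show "s \<le> meet x z" by (rule meet_ge)
qed

lemma mdist_le_tree_dist:
  assumes "x \<in> C" "y \<in> C" shows "mdist M (F x) (F y) \<le> tree_dist x y"
proof -
  have "meet x y \<le> (height x + height y - mdist M (F x) (F y)) / 2"
    unfolding meet_def by (rule cSup_least[OF joined_ne[OF assms]]) (use mdist_joined in force)
  then show ?thesis by (simp add: tree_dist_def)
qed

lemma tree_dist_le:
  assumes C: "x \<in> C" "y \<in> C" shows "tree_dist x y \<le> 3 * L * norm (x - y)"
proof -
  have "high_step (height x - L * norm (x - y)) x y"
    unfolding high_step_def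
  proof (intro conjI ballI C)
    fix z assume z: "z \<in> closed_segment x y"
    have "norm (x - z) \<le> norm (x - y)" using segment_bound1[OF z] by (simp add: norm_minus_commute)
    then have "L * norm (x - z) \<le> L * norm (x - y)" using L_nonneg by (rule mult_left_mono)
    moreover have "\<bar>height x - height z\<bar> \<le> L * norm (x - z)" by (rule height_lipschitz) (use z segment_subset_C[OF C] C in auto)
    ultimately show "height x - L * norm (x - y) \<le> height z" by linarith
  qed
  then have "height x - L * norm (x - y) \<le> meet x y" by (intro meet_ge) blast
  then show ?thesis using height_lipschitz[OF C] by (simp add: tree_dist_def abs_le_iff)
qed

text \<open>Take the largest of the four values of \<open>meet\<close> on a pair from \<open>{x,
y} \<times> {z, w}\<close>. The ultrametric inequality through this pair bounds \<open>meet x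
y\<close> and \<open>meet z w\<close> from below by two others of these values.\<close>

lemma tree_dist_four_point:
  assumes "x \<in> C" "y \<in> C" "z \<in> C" "w \<in> C"
  shows "tree_dist x y + tree_dist z w \<le> max (tree_dist x z + tree_dist y w) (tree_dist x w + tree_dist y z)"
proof -
  have u: "min (meet a b) (meet b c) \<le> meet a c" if "a \<in> {x, y, z, w}" "b \<in> {x, y, z, w}" "c \<in> {x, y, z, w}" for a b c
    using meet_ultra that assms by blast
  have "min (meet x z + meet y w) (meet x w + meet y z) \<le> meet x y + meet z w"
    using u[of x z y] u[of x w y] u[of z x w] u[of z y w] meet_sym[of z y] meet_sym[of w y] meet_sym[of z x]
    by (simp add: min_def split: if_splits)
  then show ?thesis unfolding tree_dist_def by (simp add: min_def max_def split: if_splits)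
qed

lemma tree_dist_pseudometric:
  assumes "x \<in> C" "y \<in> C"
  shows "0 \<le> tree_dist x y" "tree_dist x x = 0" "tree_dist x y = tree_dist y x"
    "z \<in> C \<Longrightarrow> tree_dist x z \<le> tree_dist x y + tree_dist y z"
proof -
  show "0 \<le> tree_dist x y" using meet_le[OF assms] by (simp add: tree_dist_def)
  show r: "tree_dist x x = 0" using meet_refl[OF assms(1)] by (simp add: tree_dist_def)
  show sym: "tree_dist x y = tree_dist y x" using meet_sym[of x y] by (simp add: tree_dist_def)
  show "tree_dist x z \<le> tree_dist x y + tree_dist y z" if z: "z \<in> C"
  proof -
    have "tree_dist y y = 0" using meet_refl[OF assms(2)] by (simp add: tree_dist_def)
    moreover have "tree_dist z y = tree_dist y z" using meet_sym[of z y] by (simp add: tree_dist_def)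
    ultimately show ?thesis
      using tree_dist_four_point[OF assms(1) z assms(2) assms(2)] by (simp add: max_def)
  qed
qed

end

section \<open>Factorization through metric trees\<close>

abbreviation nearest :: "real ^ 'n \<Rightarrow> real ^ 'n" where
  "nearest \<equiv> closest_point (cbox 0 1)"

lemma cube_nonempty: "cbox 0 1 \<noteq> ({} :: (real ^ 'n) set)" "box 0 1 \<noteq> ({} :: (real ^ 'n) set)"
  by (simp_all add: interval_ne_empty_cart)

lemma nearest_in: "nearest x \<in> cbox 0 1"
  by (rule closest_point_in_set[OF closed_cbox cube_nonempty(1)])

lemma nearest_self: "x \<in> cbox 0 1 \<Longrightarrow> nearest x = x"
  by (rule closest_point_self)

text \<open>The nearest-point projection of the cube does not increase distances.\<close>

lemma Lipschitz_cube_extension: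
  fixes f :: "real ^ 'n \<Rightarrow> 'b"
  assumes "Lipschitz_continuous_map unit_cube X f"
  obtains L where "lipschitz_into X (f \<circ> nearest) L"
proof -
  obtain B where fX: "\<And>x. x \<in> cbox 0 1 \<Longrightarrow> f x \<in> mspace X" and B0: "B > 0"
    and B: "\<And>x y. x \<in> cbox 0 1 \<Longrightarrow> y \<in> cbox 0 1 \<Longrightarrow> mdist X (f x) (f y) \<le> B * dist x y"
    using assms unfolding Lipschitz_continuous_map_pos unit_cube_def by auto
  have "lipschitz_into X (f \<circ> nearest) B"
  proof
    fix x y :: "real ^ 'n"
    show "(f \<circ> nearest) x \<in> mspace X" using fX[OF nearest_in] by simp
    have "dist (nearest x) (nearest y) \<le> dist x y"
      by (rule closest_point_lipschitz[OF convex_box(1) closed_cbox cube_nonempty(1)])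
    then have "B * dist (nearest x) (nearest y) \<le> B * norm (x - y)"
      using B0 by (simp add: dist_norm)
    then show "mdist X ((f \<circ> nearest) x) ((f \<circ> nearest) y) \<le> B * norm (x - y)"
      using B[OF nearest_in nearest_in, of x y] by simp
  qed
  then show thesis by (rule that)
qed

lemma has_metric_derivative_cong:
  assumes "\<And>y. y \<in> \<Omega> \<Longrightarrow> f y = g y" "x \<in> \<Omega>"
  shows "has_metric_derivative X \<Omega> f x \<sigma> \<longleftrightarrow> has_metric_derivative X \<Omega> g x \<sigma>"
  unfolding has_metric_derivative_def
  by (intro conj_cong refl tendsto_cong) (auto simp: eventually_at_filter assms)

lemma has_metric_derivative_subset:
  assumes "has_metric_derivative X UNIV f x \<sigma>" shows "has_metric_derivative X \<Omega> f x \<sigma>"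
  using assms unfolding has_metric_derivative_def by (auto intro: tendsto_within_subset)

lemma AE_cube_iff: "(AE x in lebesgue_on (box 0 1 :: (real ^ 'n) set). P x) \<longleftrightarrow> (AE x in lborel. x \<in> box 0 1 \<longrightarrow> P x)"
  by (subst AE_restrict_space_iff) (simp_all add: AE_completion_iff)

text \<open>The metric derivative of \<open>f\<close> is bounded by a multiple of that of
\<open>\<psi>\<close>, and the latter degenerates on every plane by the four-point
condition.\<close>

theorem rank_le_one_if_factors_through_tree:
  fixes f :: "real ^ 'n \<Rightarrow> 'b" and Z :: "'t metric"
  assumes f: "Lipschitz_continuous_map unit_cube X f"
    and Z: "metric_tree Z" and fac: "factors_through unit_cube X Z f"
  shows "md_rank_le_one_ae X f"
proof -
  obtain \<psi> \<phi> where \<psi>: "Lipschitz_continuous_map unit_cube Z \<psi>" and \<phi>: "Lipschitz_continuous_map Z X \<phi>"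
    and f_eq: "\<And>x. x \<in> cbox 0 1 \<Longrightarrow> f x = \<phi> (\<psi> x)"
    using fac by (auto simp: factors_through_def unit_cube_def)
  obtain L where "lipschitz_into X (f \<circ> nearest) L" by (rule Lipschitz_cube_extension[OF f])
  then interpret G: lipschitz_into X "f \<circ> nearest" L .
  obtain L' where "lipschitz_into Z (\<psi> \<circ> nearest) L'" by (rule Lipschitz_cube_extension[OF \<psi>])
  then interpret F: lipschitz_into Z "\<psi> \<circ> nearest" L' .
  obtain B where B: "\<And>x y. x \<in> mspace Z \<Longrightarrow> y \<in> mspace Z \<Longrightarrow> mdist X (\<phi> x) (\<phi> y) \<le> B * mdist Z x y"
    using \<phi> unfolding Lipschitz_continuous_map_def by blast
  have 4: "four_point Z" by (rule metric_tree_imp_four_point[OF Z])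
  have "AE x in lborel. \<forall>\<sigma>. has_metric_derivative Z UNIV (\<psi> \<circ> nearest) x \<sigma> \<longrightarrow>
     (\<forall>u v. \<sigma> (u + v) + \<sigma> (u - v) \<le> max (2 * \<sigma> u) (2 * \<sigma> v))"
    by (rule F.four_point_metric_derivative_AE) (rule four_pointD[OF 4]; rule F.in_space)
  then have "AE x in lborel. x \<in> box 0 1 \<longrightarrow> metrically_differentiable X (box 0 1) f x \<and> seminorm_rank (md X (box 0 1) f x) \<le> 1"
    using F.metric_derivative_exists_AE G.metric_derivative_exists_AE
  proof eventually_elim
    case (elim x)
    show ?case
    proof
      assume x: "x \<in> box 0 1"
      have xc: "x \<in> cbox 0 1" using x box_subset_cbox by blast
      obtain \<tau> where \<tau>: "has_metric_derivative Z UNIV (\<psi> \<circ> nearest) x \<tau>" using elim(2) by blast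
      obtain \<sigma> where \<sigma>: "has_metric_derivative X UNIV (f \<circ> nearest) x \<sigma>" using elim(3) by blast
      have sn: "is_seminorm \<tau>" "is_seminorm \<sigma>" using \<sigma> \<tau> by (auto simp: has_metric_derivative_def)
      have le: "\<sigma> w \<le> B * \<tau> w" for w
      proof (rule tendsto_le)
        show "((\<lambda>h. mdist X ((f \<circ> nearest) (x + h *\<^sub>R w)) ((f \<circ> nearest) x) / \<bar>h\<bar>) \<longlongrightarrow> \<sigma> w) (at 0)"
          by (rule metric_derivative_directional[OF \<sigma> open_UNIV UNIV_I G.in_space])
        show "((\<lambda>h. B * (mdist Z ((\<psi> \<circ> nearest) (x + h *\<^sub>R w)) ((\<psi> \<circ> nearest) x) / \<bar>h\<bar>)) \<longlongrightarrow> B * \<tau> w) (at 0)"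
          by (intro tendsto_mult tendsto_const metric_derivative_directional[OF \<tau> open_UNIV UNIV_I F.in_space])
        show "\<forall>\<^sub>F h in at 0. mdist X ((f \<circ> nearest) (x + h *\<^sub>R w)) ((f \<circ> nearest) x) / \<bar>h\<bar>
            \<le> B * (mdist Z ((\<psi> \<circ> nearest) (x + h *\<^sub>R w)) ((\<psi> \<circ> nearest) x) / \<bar>h\<bar>)"
        proof (rule always_eventually, rule allI)
          fix h :: real
          have "mdist X ((f \<circ> nearest) (x + h *\<^sub>R w)) ((f \<circ> nearest) x) \<le> B * mdist Z ((\<psi> \<circ> nearest) (x + h *\<^sub>R w)) ((\<psi> \<circ> nearest) x)"
            using B[OF F.in_space F.in_space, of "x + h *\<^sub>R w" x] f_eq[OF nearest_in] by simp
          then show "mdist X ((f \<circ> nearest) (x + h *\<^sub>R w)) ((f \<circ> nearest) x) / \<bar>h\<bar>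
            \<le> B * (mdist Z ((\<psi> \<circ> nearest) (x + h *\<^sub>R w)) ((\<psi> \<circ> nearest) x) / \<bar>h\<bar>)"
            unfolding times_divide_eq_right by (rule divide_right_mono) simp
        qed
      qed simp
      have "\<exists>\<alpha> \<beta>. (\<alpha>, \<beta>) \<noteq> (0, 0) \<and> \<sigma> (\<alpha> *\<^sub>R p + \<beta> *\<^sub>R q) = 0" for p q
      proof -
        have ft: "\<tau> (u + v) + \<tau> (u - v) \<le> max (2 * \<tau> u) (2 * \<tau> v)" for u v using elim(1) \<tau> by blast
        obtain \<alpha> \<beta> where ab: "(\<alpha>, \<beta>) \<noteq> (0, 0)" "\<tau> (\<alpha> *\<^sub>R p + \<beta> *\<^sub>R q) = 0"
          by (rule four_point_seminorm_degenerate[OF sn(1) ft])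
        then have "\<sigma> (\<alpha> *\<^sub>R p + \<beta> *\<^sub>R q) = 0"
          using le[of "\<alpha> *\<^sub>R p + \<beta> *\<^sub>R q"] seminorm_nonneg[OF sn(2), of "\<alpha> *\<^sub>R p + \<beta> *\<^sub>R q"] by simp
        then show ?thesis using ab(1) by blast
      qed
      then have rank: "seminorm_rank \<sigma> \<le> 1" using seminorm_rank_le_one_iff[OF sn(2)] by blast
      have "has_metric_derivative X (box 0 1) (f \<circ> nearest) x \<sigma>" by (rule has_metric_derivative_subset[OF \<sigma>])
      moreover have "(f \<circ> nearest) y = f y" if "y \<in> box 0 1" for y
        using nearest_self[OF subsetD[OF box_subset_cbox that]] by simp
      ultimately have d: "has_metric_derivative X (box 0 1) f x \<sigma>"
        using has_metric_derivative_cong[of "box 0 1" "f \<circ> nearest" f x X \<sigma>] x by blast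
      have "f x \<in> mspace X" using G.in_space[of x] nearest_self[OF xc] by simp
      then have "md X (box 0 1) f x = \<sigma>" by (rule md_eq[OF d open_box x])
      then show "metrically_differentiable X (box 0 1) f x \<and> seminorm_rank (md X (box 0 1) f x) \<le> 1"
        using d rank by (auto simp: metrically_differentiable_def)
    qed
  qed
  then show ?thesis by (simp only: md_rank_le_one_ae_def AE_cube_iff)
qed

text \<open>The points of the tree are representatives of the classes \<open>tree_dist x y =
0\<close>, which keeps them in \<open>\<real>\<^sup>n\<close>. The tree is a Lipschitz image of
the cube and therefore connected, so the four-point condition is enough.\<close>

theorem factors_through_tree_if_rank_le_one:
  fixes f :: "real ^ 'n \<Rightarrow> 'b"
  assumes f: "Lipschitz_continuous_map unit_cube X f" and rank: "md_rank_le_one_ae X f"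
  shows "\<exists>Z :: (real ^ 'n) metric. metric_tree Z \<and> factors_through unit_cube X Z f"
proof -
  let ?C = "cbox 0 1 :: (real ^ 'n) set" and ?U = "box 0 1 :: (real ^ 'n) set"
  let ?F = "f \<circ> nearest"
  obtain L where "lipschitz_into X ?F L" by (rule Lipschitz_cube_extension[OF f])
  then interpret F: lipschitz_into X ?F L .
  have fF: "f x = ?F x" if "x \<in> ?C" for x using that by (simp add: nearest_self)
  have UC: "?U \<subseteq> ?C" by (rule box_subset_cbox)
  have rankF: "AE x in lborel. x \<in> ?U \<longrightarrow> (\<exists>\<sigma>. has_metric_derivative X ?U ?F x \<sigma> \<and> seminorm_rank \<sigma> \<le> 1)"
    using rank unfolding md_rank_le_one_ae_def AE_cube_iff
  proof eventually_elim
    case (elim x)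
    show ?case
    proof
      assume x: "x \<in> ?U"
      then obtain \<sigma> where \<sigma>: "has_metric_derivative X ?U f x \<sigma>" and r: "seminorm_rank (md X ?U f x) \<le> 1"
        using elim by (auto simp: metrically_differentiable_def)
      have "f x \<in> mspace X" using fF[of x] F.in_space[of x] x UC by auto
      then have "md X ?U f x = \<sigma>" by (rule md_eq[OF \<sigma> open_box x])
      moreover have "has_metric_derivative X ?U ?F x \<sigma>"
        using \<sigma> by (subst (asm) has_metric_derivative_cong[where g = ?F, OF fF x]) (use UC in auto)
      ultimately show "\<exists>\<sigma>. has_metric_derivative X ?U ?F x \<sigma> \<and> seminorm_rank \<sigma> \<le> 1" using r by auto
    qed
  qed
  interpret R: rank_one_map X ?F L ?C ?U 0
  proof
    show "?C = closure ?U" by (rule closure_box[symmetric]) (rule cube_nonempty)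
    show "0 \<in> ?C" by (simp add: mem_box_cart)
  qed (use rankF in \<open>auto simp: bounded_box\<close>)
  note pm = R.tree_dist_pseudometric
  define r where "r = (\<lambda>x. SOME z. z \<in> ?C \<and> R.tree_dist x z = 0)"
  have r: "r x \<in> ?C" "R.tree_dist x (r x) = 0" if "x \<in> ?C" for x
    using someI[of "\<lambda>z. z \<in> ?C \<and> R.tree_dist x z = 0" x] that pm(2)[OF that that] by (auto simp: r_def)
  have r_dist: "R.tree_dist (r x) (r y) = R.tree_dist x y" if "x \<in> ?C" "y \<in> ?C" for x y
  proof (rule antisym)
    show "R.tree_dist (r x) (r y) \<le> R.tree_dist x y"
      using pm(4)[OF r(1)[OF that(1)] that(1) r(1)[OF that(2)]] pm(4)[OF that r(1)[OF that(2)]]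
        pm(3)[OF r(1)[OF that(1)] that(1)] r(2)[OF that(1)] r(2)[OF that(2)] by linarith
    show "R.tree_dist x y \<le> R.tree_dist (r x) (r y)"
      using pm(4)[OF that(1) r(1)[OF that(1)] that(2)] pm(4)[OF r(1)[OF that(1)] r(1)[OF that(2)] that(2)]
        pm(3)[OF r(1)[OF that(2)] that(2)] r(2)[OF that(1)] r(2)[OF that(2)] by linarith
  qed
  have r_eq: "r x = r y" if "x \<in> ?C" "y \<in> ?C" "R.tree_dist x y = 0" for x y
  proof -
    have "R.tree_dist x z = R.tree_dist y z" if z: "z \<in> ?C" for z
      using pm(4)[OF \<open>x \<in> ?C\<close> \<open>y \<in> ?C\<close> z] pm(4)[OF \<open>y \<in> ?C\<close> \<open>x \<in> ?C\<close> z] pm(3)[OF \<open>x \<in> ?C\<close> \<open>y \<in> ?C\<close>] \<open>R.tree_dist x y = 0\<close>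
      by linarith
    then have "(\<lambda>z. z \<in> ?C \<and> R.tree_dist x z = 0) = (\<lambda>z. z \<in> ?C \<and> R.tree_dist y z = 0)" by auto
    then show ?thesis by (simp add: r_def)
  qed
  \<comment> \<open>A metric has to be nonnegative and symmetric also off its carrier; zero is the default value there.\<close>
  define d where "d = (\<lambda>x y. if x \<in> ?C \<and> y \<in> ?C then R.tree_dist x y else 0)"
  have rC: "r ` ?C \<subseteq> ?C" using r(1) by auto
  interpret Z: Metric_space "r ` ?C" d
  proof
    fix x y
    show "0 \<le> d x y" using pm(1) by (simp add: d_def)
    show "d x y = d y x" using pm(3) by (simp add: d_def)
  next
    fix x y assume "x \<in> r ` ?C" "y \<in> r ` ?C"
    then obtain x' y' where xy: "x' \<in> ?C" "y' \<in> ?C" "x = r x'" "y = r y'" by auto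
    then have "d x y = R.tree_dist x' y'" using r(1) r_dist by (simp add: d_def)
    moreover have "R.tree_dist x' y' = 0" if "r x' = r y'"
      using r_dist[OF xy(1,2)] that pm(2)[OF r(1)[OF xy(2)] r(1)[OF xy(2)]] by simp
    ultimately show "d x y = 0 \<longleftrightarrow> x = y" using r_eq[OF xy(1,2)] unfolding xy(3,4) by auto
  next
    fix x y z assume "x \<in> r ` ?C" "y \<in> r ` ?C" "z \<in> r ` ?C"
    then have "x \<in> ?C" "y \<in> ?C" "z \<in> ?C" using rC by auto
    then show "d x z \<le> d x y + d y z" using pm(4) by (simp add: d_def)
  qed
  define Z where "Z = metric (r ` ?C, d)"
  have Zs: "mspace Z = r ` ?C" "mdist Z = d" by (simp_all add: Z_def)
  have rLip: "Lipschitz_continuous_map unit_cube Z r"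
    unfolding Lipschitz_continuous_map_def
  proof (intro conjI exI ballI)
    show "r \<in> mspace unit_cube \<rightarrow> mspace Z" by (auto simp: Zs unit_cube_def)
    fix x y :: "real ^ 'n" assume "x \<in> mspace unit_cube" "y \<in> mspace unit_cube"
    then have xy: "x \<in> ?C" "y \<in> ?C" by (auto simp: unit_cube_def)
    then have "mdist Z (r x) (r y) = R.tree_dist x y" using r(1) r_dist by (simp add: Zs d_def)
    also have "\<dots> \<le> 3 * L * norm (x - y)" by (rule R.tree_dist_le[OF xy])
    finally show "mdist Z (r x) (r y) \<le> (3 * L) * mdist unit_cube x y" by (simp add: unit_cube_def dist_norm)
  qed
  have fLip: "Lipschitz_continuous_map Z X f"
    unfolding Lipschitz_continuous_map_def
  proof (intro conjI exI ballI)
    show "f \<in> mspace Z \<rightarrow> mspace X"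
    proof
      fix x assume "x \<in> mspace Z"
      then have "x \<in> ?C" using rC by (auto simp: Zs)
      then show "f x \<in> mspace X" using fF[of x] F.in_space[of x] by simp
    qed
    fix x y assume "x \<in> mspace Z" "y \<in> mspace Z"
    then have xy: "x \<in> ?C" "y \<in> ?C" using rC by (auto simp: Zs)
    have "mdist X (?F x) (?F y) \<le> R.tree_dist x y" by (rule R.mdist_le_tree_dist[OF xy])
    then show "mdist X (f x) (f y) \<le> 1 * mdist Z x y" using fF[OF xy(1)] fF[OF xy(2)] xy by (simp add: Zs d_def)
  qed
  have "f x = f (r x)" if x: "x \<in> ?C" for x
  proof -
    have "mdist X (?F x) (?F (r x)) \<le> 0" using R.mdist_le_tree_dist[OF x r(1)[OF x]] r(2)[OF x] by simp
    then have "mdist X (?F x) (?F (r x)) = 0" using mdist_nonneg[of X "?F x" "?F (r x)"] by linarith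
    then have "?F x = ?F (r x)" using mdist_zero[OF F.in_space F.in_space] by blast
    then show ?thesis using fF[OF x] fF[OF r(1)[OF x]] by simp
  qed
  then have "factors_through unit_cube X Z f"
    unfolding factors_through_def using rLip fLip by (intro exI[of _ r] exI[of _ f]) (auto simp: unit_cube_def)
  moreover have "four_point Z"
    unfolding four_point_def Zs
  proof (intro ballI)
    fix x y z w assume "x \<in> r ` ?C" "y \<in> r ` ?C" "z \<in> r ` ?C" "w \<in> r ` ?C"
    then have "x \<in> ?C" "y \<in> ?C" "z \<in> ?C" "w \<in> ?C" using rC by blast+
    then show "d x y + d z w \<le> max (d x z + d y w) (d x w + d y z)"
      using R.tree_dist_four_point by (simp add: d_def)
  qed
  moreover have "connected_space (mtopology_of Z)"
  proof -
    have "continuous_map (mtopology_of unit_cube) (mtopology_of Z) r"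
      by (rule Lipschitz_continuous_imp_continuous_map[OF rLip])
    moreover have "connectedin (mtopology_of unit_cube) ?C"
      by (simp add: unit_cube_def mtopology_of_submetric connectedin_subtopology convex_connected[OF convex_box(1)])
    ultimately have "connectedin (mtopology_of Z) (r ` ?C)" by (rule connectedin_continuous_map_image)
    then show ?thesis using connectedin_topspace[of "mtopology_of Z"] by (simp add: Zs)
  qed
  ultimately show ?thesis using four_point_connected_imp_metric_tree by blast
qed

theorem theorem1p9:
  fixes X :: "'b metric" and f :: "real ^ 'n \<Rightarrow> 'b"
  assumes "Lipschitz_continuous_map unit_cube X f"
  shows "((\<exists>Z :: (real ^ 'n) metric. metric_tree Z \<and> factors_through unit_cube X Z f)
            \<longleftrightarrow> md_rank_le_one_ae X f) \<and>
         (\<forall>Z :: 't metric. metric_tree Z \<and> factors_through unit_cube X Z f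
            \<longrightarrow> md_rank_le_one_ae X f)"
proof (intro conjI iffI allI impI)
  assume "md_rank_le_one_ae X f"
  then show "\<exists>Z :: (real ^ 'n) metric. metric_tree Z \<and> factors_through unit_cube X Z f"
    by (rule factors_through_tree_if_rank_le_one[OF assms])
next
  assume "\<exists>Z :: (real ^ 'n) metric. metric_tree Z \<and> factors_through unit_cube X Z f"
  then show "md_rank_le_one_ae X f" using rank_le_one_if_factors_through_tree[OF assms] by blast
next
  fix Z :: "'t metric" assume "metric_tree Z \<and> factors_through unit_cube X Z f"
  then show "md_rank_le_one_ae X f" using rank_le_one_if_factors_through_tree[OF assms] by blast
qed

end
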